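(* For each $n \geq 1$ and $i \geq 1$, both $F_n$ and $e_i[F_n]$ are Schur positive, where $F_n := \sum_{X \in \mathcal{H}^\infty_n} \eta(X)$ for a Hall set $\mathcal{H}^\infty = \bigcup_{m\ge1}\mathcal{H}^\infty_m$ on the free Lie algebra of countably infinite rank.
   Context: A Hall set $\mathcal{H}^\infty = \bigcup_{m\ge1}\mathcal{H}^\infty_m$ on the free complex Lie algebra $\mathfrak{f}_\infty$ on $X_1,X_2,\ldots$ is a totally ordered set constructed inductively: - $\mathcal{H}^\infty_1 := \{X_1,X_2,\ldots\}$ with $X_1<X_2<\cdots$. - For $m\ge2$, given $\mathcal{H}^\infty_1,\ldots,\mathcal{H}^\infty_{m-1}$ and a total order on their union, $\mathcal{H}^\infty_m$ is the set of all Lie brackets $[Y,Z]$ with $Y\in\mathcal{H}^\infty_a$, $Z\in\mathcal{H}^\infty_b$ such that $a+b=m$, $Y<Z$, and, if $Z=[Z_1,Z_2]$ is itself a bracket of the construction (with each $Z_i$ in some $\mathcal{H}^\infty_{k_i}$), then $Z_1\le Y$. - The order is extended by choosing any total order on $\mathcal{H}^\infty_m$ and declaring every element of $\mathcal{H}^\infty_j$, $j<m$, to be smaller than every element of $\mathcal{H}^\infty_m$. The map $\eta$ from $\mathcal{H}^\infty$ to monomials in $x_1,x_2,\ldots$ is defined inductively by $\eta(X_j):=x_j$ and $\eta([Y,Z]):=\eta(Y)\eta(Z)$. The series $F_n$ is a symmetric function in $x_1,x_2,\ldots$ with integer coefficients. The elementary symmetric functions are $e_i := \sum_{j_1<\cdots<j_i}x_{j_1}\cdots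 x_{j_i}$. If $f$ is a symmetric function and $g=\sum_{j\ge1}x^{\alpha_j}$ is a symmetric function written as a sum of monomials (a monomial may be repeated), the plethysm is $f[g]:=f(x^{\alpha_1},x^{\alpha_2},\ldots)$. Every symmetric function $f$ has a Schur expansion $f=\sum_\lambda c_\lambda s_\lambda$ over integer partitions $\lambda$, with $c_\lambda\in\mathbb{Z}$ and $s_\lambda$ the Schur functions; $f$ is called Schur positive if all $c_\lambda$ are non-negative. *)

theory Defs
  imports Complex_Main "HOL-Library.Poly_Mapping" "HOL-Library.Multiset" "HOL-Library.FuncSet"
begin

section \<open>The free complex Lie algebra\<close>

text \<open>
  The free Lie algebra on a set of generators is the free non-associative algebra (finitely
  supported complex combinations of bracketed words) modulo the two-sided ideal generated by all
  \<open>[p, p]\<close> and all Jacobi expressions.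
\<close>

datatype 'a bracketing = Leaf 'a | Node "'a bracketing" "'a bracketing"

lift_definition free_mult ::
  "('a bracketing \<Rightarrow>\<^sub>0 complex) \<Rightarrow> ('a bracketing \<Rightarrow>\<^sub>0 complex) \<Rightarrow> ('a bracketing \<Rightarrow>\<^sub>0 complex)"
  is "\<lambda>p q t. case t of Leaf _ \<Rightarrow> 0 | Node s u \<Rightarrow> p s * q u"
proof -
  fix p q :: "'a bracketing \<Rightarrow> complex"
  assume "finite {t. p t \<noteq> 0}" "finite {t. q t \<noteq> 0}"
  then have "finite ((\<lambda>(s, u). Node s u) ` ({t. p t \<noteq> 0} \<times> {t. q t \<noteq> 0}))"
    by blast
  then show "finite {t. (case t of Leaf _ \<Rightarrow> 0 | Node s u \<Rightarrow> p s * q u) \<noteq> 0}"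
  proof (rule finite_subset[rotated], intro subsetI)
    fix t assume "t \<in> {t. (case t of Leaf _ \<Rightarrow> 0 | Node s u \<Rightarrow> p s * q u) \<noteq> 0}"
    then show "t \<in> (\<lambda>(s, u). Node s u) ` ({t. p t \<noteq> 0} \<times> {t. q t \<noteq> 0})"
      by (cases t) auto
  qed
qed

lift_definition free_scale :: "complex \<Rightarrow> ('a \<Rightarrow>\<^sub>0 complex) \<Rightarrow> ('a \<Rightarrow>\<^sub>0 complex)"
  is "\<lambda>c p t. c * p t"
  by (auto elim: finite_subset[rotated])

inductive_set lie_ideal :: "('a bracketing \<Rightarrow>\<^sub>0 complex) set" where
  zero: "0 \<in> lie_ideal"
| add: "p \<in> lie_ideal \<Longrightarrow> q \<in> lie_ideal \<Longrightarrow> p + q \<in> lie_ideal"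
| scale: "p \<in> lie_ideal \<Longrightarrow> free_scale c p \<in> lie_ideal"
| mult_left: "p \<in> lie_ideal \<Longrightarrow> free_mult q p \<in> lie_ideal"
| mult_right: "p \<in> lie_ideal \<Longrightarrow> free_mult p q \<in> lie_ideal"
| alternating: "free_mult p p \<in> lie_ideal"
| jacobi: "free_mult p (free_mult q s) + free_mult q (free_mult s p) + free_mult s (free_mult p q)
    \<in> lie_ideal"

lemma free_mult_add_left: "free_mult (p + q) s = free_mult p s + free_mult q s"
  by (transfer, rule ext) (auto simp: algebra_simps split: bracketing.splits)

lemma free_mult_add_right: "free_mult p (q + s) = free_mult p q + free_mult p s"
  by (transfer, rule ext) (auto simp: algebra_simps split: bracketing.splits)

lemma free_mult_diff_left: "free_mult (p - q) s = free_mult p s - free_mult q s"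
  by (transfer, rule ext) (auto simp: algebra_simps split: bracketing.splits)

lemma free_mult_diff_right: "free_mult p (q - s) = free_mult p q - free_mult p s"
  by (transfer, rule ext) (auto simp: algebra_simps split: bracketing.splits)

lemma free_mult_scale_left: "free_mult (free_scale c p) q = free_scale c (free_mult p q)"
  by (transfer, rule ext) (auto split: bracketing.splits)

lemma free_mult_scale_right: "free_mult p (free_scale c q) = free_scale c (free_mult p q)"
  by (transfer, rule ext) (auto split: bracketing.splits)

lemma free_scale_diff: "free_scale c (p - q) = free_scale c p - free_scale c q"
  by (transfer, rule ext) (auto simp: algebra_simps)

lemma lie_ideal_uminus:
  assumes "p \<in> lie_ideal" shows "- p \<in> lie_ideal"
proof -
  have "- p = free_scale (- 1) p" by (transfer, rule ext) simp
  with lie_ideal.scale[OF assms] show ?thesis by metis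
qed

lemma lie_ideal_diff: "p \<in> lie_ideal \<Longrightarrow> q \<in> lie_ideal \<Longrightarrow> p - q \<in> lie_ideal"
  using lie_ideal.add[OF _ lie_ideal_uminus, of p q] by simp

definition lie_cong :: "('a bracketing \<Rightarrow>\<^sub>0 complex) \<Rightarrow> ('a bracketing \<Rightarrow>\<^sub>0 complex) \<Rightarrow> bool" where
  "lie_cong p q \<longleftrightarrow> p - q \<in> lie_ideal"

quotient_type 'a free_lie = "'a bracketing \<Rightarrow>\<^sub>0 complex" / lie_cong
proof (rule equivpI)
  show "reflp lie_cong" by (simp add: reflp_def lie_cong_def lie_ideal.zero)
  show "symp lie_cong" unfolding symp_def lie_cong_def
    by (metis lie_ideal_uminus minus_diff_eq)
  show "transp lie_cong" unfolding transp_def lie_cong_def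
    using lie_ideal.add by fastforce
qed

instantiation free_lie :: (type) ab_group_add
begin

lift_definition zero_free_lie :: "'a free_lie" is 0 .

lift_definition plus_free_lie :: "'a free_lie \<Rightarrow> 'a free_lie \<Rightarrow> 'a free_lie" is "(+)"
  unfolding lie_cong_def by (metis add_diff_add lie_ideal.add)

lift_definition uminus_free_lie :: "'a free_lie \<Rightarrow> 'a free_lie" is uminus
  unfolding lie_cong_def by (metis lie_ideal_uminus minus_diff_minus)

lift_definition minus_free_lie :: "'a free_lie \<Rightarrow> 'a free_lie \<Rightarrow> 'a free_lie" is "(-)"
proof -
  fix p p' q q' :: "'a bracketing \<Rightarrow>\<^sub>0 complex"
  assume "lie_cong p p'" "lie_cong q q'"
  then have "(p - p') - (q - q') \<in> lie_ideal" unfolding lie_cong_def by (rule lie_ideal_diff)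
  then show "lie_cong (p - q) (p' - q')" by (simp add: lie_cong_def algebra_simps)
qed

instance
  by (standard; transfer) (simp_all add: lie_cong_def lie_ideal.zero algebra_simps)

end

lift_definition lie_gen :: "'a \<Rightarrow> 'a free_lie" is "\<lambda>i. Poly_Mapping.single (Leaf i) 1" .

lift_definition lie_scale :: "complex \<Rightarrow> 'a free_lie \<Rightarrow> 'a free_lie" is free_scale
  unfolding lie_cong_def by (metis free_scale_diff lie_ideal.scale)

lift_definition lie_bracket :: "'a free_lie \<Rightarrow> 'a free_lie \<Rightarrow> 'a free_lie" is free_mult
proof -
  fix p p' q q' :: "'a bracketing \<Rightarrow>\<^sub>0 complex"
  assume "lie_cong p p'" "lie_cong q q'"
  then have "free_mult (p - p') q + free_mult p' (q - q') \<in> lie_ideal"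
    unfolding lie_cong_def by (intro lie_ideal.add lie_ideal.mult_left lie_ideal.mult_right)
  then show "lie_cong (free_mult p q) (free_mult p' q')"
    by (simp add: lie_cong_def free_mult_diff_left free_mult_diff_right)
qed

lemma lie_bracket_self: "lie_bracket x x = 0"
  by transfer (simp add: lie_cong_def lie_ideal.alternating)

lemma lie_bracket_jacobi:
  "lie_bracket x (lie_bracket y z) + lie_bracket y (lie_bracket z x)
    + lie_bracket z (lie_bracket x y) = 0"
  by transfer (simp add: lie_cong_def lie_ideal.jacobi)

lemma lie_bracket_add:
  "lie_bracket (x + y) z = lie_bracket x z + lie_bracket y z"
  "lie_bracket x (y + z) = lie_bracket x y + lie_bracket x z"
  by (transfer, simp add: lie_cong_def lie_ideal.zero free_mult_add_left free_mult_add_right)+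

lemma lie_bracket_scale:
  "lie_bracket (lie_scale c x) y = lie_scale c (lie_bracket x y)"
  "lie_bracket x (lie_scale c y) = lie_scale c (lie_bracket x y)"
  by (transfer, simp add: lie_cong_def lie_ideal.zero free_mult_scale_left free_mult_scale_right)+


section \<open>Hall sets\<close>

text \<open>
  Generators and variables are indexed by all of \<open>nat\<close>, so \<open>lie_gen 0\<close> is the
  first generator \<open>X\<^sub>1\<close>.  The order is a strict relation \<open>r\<close>.  The set
  \<open>hall_pairs r m\<close> consists of the pairs \<open>(Y, Z)\<close> whose bracket is formed at
  stage \<open>m\<close> of the construction; ``\<open>Z = [Z\<^sub>1, Z\<^sub>2]\<close> is a bracket of
  the construction'' means that \<open>(Z\<^sub>1, Z\<^sub>2)\<close> is such a pair.  Stage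
  \<open>m\<close> only consults \<open>r\<close> on elements of smaller stages, so one relation
  encodes all the successive choices of orders.
\<close>

declare conj_cong [fundef_cong]

function hall :: "nat free_lie rel \<Rightarrow> nat \<Rightarrow> nat free_lie set"
  and hall_pairs :: "nat free_lie rel \<Rightarrow> nat \<Rightarrow> (nat free_lie \<times> nat free_lie) set" where
  "hall r m = (if m = 1 then range lie_gen else {lie_bracket Y Z | Y Z. (Y, Z) \<in> hall_pairs r m})"
| "hall_pairs r m = {(Y, Z). \<exists>a b. 1 \<le> a \<and> 1 \<le> b \<and> a + b = m \<and> Y \<in> hall r a \<and> Z \<in> hall r b
    \<and> (Y, Z) \<in> r
    \<and> (\<forall>(Z1, Z2) \<in> hall_pairs r b. Z = lie_bracket Z1 Z2 \<longrightarrow> Z1 = Y \<or> (Z1, Y) \<in> r)}"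
  by pat_completeness auto
termination
  by (relation "measure (case_sum (\<lambda>(_, m). 2 * m + 1) (\<lambda>(_, m). 2 * m))") auto

declare conj_cong [fundef_cong del]
declare hall.simps [simp del] hall_pairs.simps [simp del]

definition hall_order :: "nat free_lie rel \<Rightarrow> bool" where
  "hall_order r \<longleftrightarrow>
    strict_linear_order_on (\<Union>m\<in>{1..}. hall r m) r \<and>
    (\<forall>i j. i < j \<longrightarrow> (lie_gen i, lie_gen j) \<in> r) \<and>
    (\<forall>j m Y Z. 1 \<le> j \<and> j < m \<and> Y \<in> hall r j \<and> Z \<in> hall r m \<longrightarrow> (Y, Z) \<in> r)"

text \<open>
  The monomial \<open>x\<^sub>i x\<^sub>j \<cdots>\<close> is the multiset \<open>{#i, j, \<dots>#}\<close>; the product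
  of monomials is the sum of multisets.  Distinct pairs give
  distinct brackets (Hall's basis theorem), so each Hall element has exactly one monomial.
\<close>

inductive hall_eta_rel :: "nat free_lie rel \<Rightarrow> nat free_lie \<Rightarrow> nat multiset \<Rightarrow> bool" for r where
  gen: "hall_eta_rel r (lie_gen j) {#j#}"
| bracket: "(Y, Z) \<in> hall_pairs r m \<Longrightarrow> hall_eta_rel r Y \<alpha> \<Longrightarrow> hall_eta_rel r Z \<beta>
    \<Longrightarrow> hall_eta_rel r (lie_bracket Y Z) (\<alpha> + \<beta>)"

definition hall_eta :: "nat free_lie rel \<Rightarrow> nat free_lie \<Rightarrow> nat multiset" where
  "hall_eta r X = (THE \<alpha>. hall_eta_rel r X \<alpha>)"


section \<open>Series in infinitely many variables\<close>

text \<open>A series is given by its coefficient function on monomials.\<close>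

type_synonym series = "nat multiset \<Rightarrow> int"

text \<open>The series \<open>\<Sum>j\<in>J. x\<^sup>\<alpha>\<^sup>(\<^sup>j\<^sup>)\<close>; meaningful when every monomial occurs finitely often.\<close>

definition monomial_sum :: "'j set \<Rightarrow> ('j \<Rightarrow> nat multiset) \<Rightarrow> series" where
  "monomial_sum J \<alpha> = (\<lambda>m. int (card {j \<in> J. \<alpha> j = m}))"

definition hall_series :: "nat free_lie rel \<Rightarrow> nat \<Rightarrow> series" where
  "hall_series r n = monomial_sum (hall r n) (hall_eta r)"

definition elementary :: "nat \<Rightarrow> series" where
  "elementary i = monomial_sum {A. finite A \<and> card A = i} mset_set"

definition monomial_enumeration :: "series \<Rightarrow> nat set \<Rightarrow> (nat \<Rightarrow> nat multiset) \<Rightarrow> bool" where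
  "monomial_enumeration g J \<alpha> \<longleftrightarrow> (\<forall>m. finite {j \<in> J. \<alpha> j = m}) \<and> g = monomial_sum J \<alpha>"

text \<open>
  The substitution of \<open>x\<^sup>\<alpha>\<^sup>(\<^sup>j\<^sup>)\<close> for the \<open>j\<close>-th variable of \<open>f\<close> if
  \<open>j \<in> J\<close>, and of \<open>0\<close> otherwise: the monomial \<open>\<gamma>\<close> of \<open>f\<close> becomes
  the product over \<open>j \<in># \<gamma>\<close> of the \<open>x\<^sup>\<alpha>\<^sup>(\<^sup>j\<^sup>)\<close>.  The sum is finite if every
  monomial occurs finitely often among the \<open>x\<^sup>\<alpha>\<^sup>(\<^sup>j\<^sup>)\<close> and the monomial \<open>1\<close> does not occur.
\<close>

definition monomial_subst :: "series \<Rightarrow> nat set \<Rightarrow> (nat \<Rightarrow> nat multiset) \<Rightarrow> series" where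
  "monomial_subst f J \<alpha> =
    (\<lambda>m. \<Sum>\<gamma> | set_mset \<gamma> \<subseteq> J \<and> sum_mset (image_mset \<alpha> \<gamma>) = m. f \<gamma>)"

text \<open>
  The choice is immaterial for symmetric \<open>f\<close>: two enumerations of \<open>g\<close> differ by
  a bijection of the index sets.  The index set may be finite, as \<open>g\<close> may have only finitely
  many monomials.
\<close>

definition plethysm :: "series \<Rightarrow> series \<Rightarrow> series" where
  "plethysm f g =
    (case (SOME (J, \<alpha>). monomial_enumeration g J \<alpha>) of (J, \<alpha>) \<Rightarrow> monomial_subst f J \<alpha>)"


section \<open>Schur functions\<close>

definition integer_partition :: "nat list \<Rightarrow> bool" where
  "integer_partition \<mu> \<longleftrightarrow> sorted_wrt (\<ge>) \<mu> \<and> 0 \<notin> set \<mu>"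

definition cells :: "nat list \<Rightarrow> (nat \<times> nat) set" where
  "cells \<mu> = {(i, j). i < length \<mu> \<and> j < \<mu> ! i}"

definition ssyt :: "nat list \<Rightarrow> (nat \<times> nat \<Rightarrow> nat) set" where
  "ssyt \<mu> = {T \<in> cells \<mu> \<rightarrow>\<^sub>E UNIV.
    (\<forall>i j j'. j < j' \<and> (i, j) \<in> cells \<mu> \<and> (i, j') \<in> cells \<mu> \<longrightarrow> T (i, j) \<le> T (i, j')) \<and>
    (\<forall>i i' j. i < i' \<and> (i, j) \<in> cells \<mu> \<and> (i', j) \<in> cells \<mu> \<longrightarrow> T (i, j) < T (i', j))}"

definition schur :: "nat list \<Rightarrow> series" where
  "schur \<mu> = monomial_sum (ssyt \<mu>) (\<lambda>T. image_mset T (mset_set (cells \<mu>)))"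

definition schur_expansion :: "series \<Rightarrow> (nat list \<Rightarrow> int) \<Rightarrow> bool" where
  "schur_expansion f c \<longleftrightarrow>
    finite {\<mu>. c \<mu> \<noteq> 0} \<and> (\<forall>\<mu>. c \<mu> \<noteq> 0 \<longrightarrow> integer_partition \<mu>) \<and>
    f = (\<lambda>m. \<Sum>\<mu> | c \<mu> \<noteq> 0. c \<mu> * schur \<mu> m)"

text \<open>The Schur functions are linearly independent, so the coefficients are determined by \<open>f\<close>.\<close>

definition schur_positive :: "series \<Rightarrow> bool" where
  "schur_positive f \<longleftrightarrow> (\<exists>c. schur_expansion f c \<and> (\<forall>\<mu>. 0 \<le> c \<mu>))"

end

theory Submission
  imports Defs "HOL-Library.Countable_Set"
begin

text \<open>
  The Hall elements of degree \<open>n\<close> map to a weight basis of the degree \<open>n\<close> part \<open>L\<close> of the free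
  Lie algebra inside the tensor algebra \<open>T\<close>, so \<open>F\<^sub>n\<close> is the character of \<open>L\<close> and \<open>e\<^sub>i[F\<^sub>n]\<close> that of
  \<open>\<Lambda>\<^sup>i L\<close>.  Both are realised as submodules of \<open>T\<close> for the derivations \<open>x\<^sub>b \<mapsto> x\<^sub>a\<close>, and it remains to
  see that the character of such a submodule \<open>W\<close> of the degree \<open>d\<close> part \<open>T\<^sub>d\<close> is
  \<open>\<Sum> c\<^sub>\<lambda>(W) s\<^sub>\<lambda>\<close>, where \<open>c\<^sub>\<lambda>(W)\<close> is the dimension of the space of highest weight vectors of
  weight \<open>\<lambda>\<close>.  Applying maximal powers of the raising operators shows that
  \<open>dim W\<^sub>\<mu> \<le> \<Sum> c\<^sub>\<lambda>(W) K\<^sub>\<lambda>\<^sub>\<mu>\<close>.  The same holds for the orthogonal complement \<open>W'\<close>.  As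
  \<open>c\<^sub>\<lambda>(W) + c\<^sub>\<lambda>(W') \<le> c\<^sub>\<lambda>(T\<^sub>d) \<le> f\<^sup>\<lambda>\<close>, and as \<open>dim (T\<^sub>d)\<^sub>\<mu> = \<Sum> f\<^sup>\<lambda> K\<^sub>\<lambda>\<^sub>\<mu>\<close> is the number of words of content
  \<open>\<mu>\<close>, all these inequalities are equalities.

  For the linear independence of the Hall elements, bracket rewriting shows that their decreasing
  products span \<open>T\<close>, and Lazard elimination bounds the number of these products by the number of
  words.
\<close>

section \<open>Finite-dimensional subspaces\<close>

text \<open>Neither complete reducibility nor a classification of irreducible modules enters. Their
  place is taken by positivity of the inner product in which words are orthonormal:
  \<open>der b a\<close> is the adjoint of \<open>der a b\<close>, so orthogonal complements of
  submodules are submodules, and a vector whose raised or lowered image would get a negative squared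
  norm must vanish. This yields only upper bounds, which is why a submodule and its complement are
  estimated together against the number of words. That number comes from the local rule of growth
  diagrams instead of a global insertion algorithm. The independence of the Hall polynomials is
  closed in the same way: rewriting gives a spanning family, elimination bounds its size, and the
  dimension of a weight space of \<open>T\<close> lies between the two. Hall elements have real
  coefficients in \<open>T\<close>, so real tensors suffice; complex ones occur only where the given
  Lie algebra is mapped into \<open>T\<close>. The series \<open>F_n\<close> itself is the case
  \<open>i = 1\<close> of the exterior power.\<close>

definition findim :: "'v::real_vector set \<Rightarrow> bool" where
  "findim S \<longleftrightarrow> (\<exists>B. finite B \<and> S \<subseteq> span B)"

lemma findim_subset: "findim T \<Longrightarrow> S \<subseteq> T \<Longrightarrow> findim S"
  unfolding findim_def by blast

lemma findim_basis:
  assumes "findim S"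
  obtains B where "finite B" "B \<subseteq> S" "independent B" "S \<subseteq> span B" "card B = dim S"
proof -
  obtain C where C: "finite C" "S \<subseteq> span C" using assms unfolding findim_def by blast
  obtain B where B: "B \<subseteq> S" "independent B" "S \<subseteq> span B" "card B = dim S"
    using real_vector.basis_exists by blast
  then have "finite B" using real_vector.independent_span_bound[OF C(1) B(2)] C(2) by blast
  with B that show ?thesis by blast
qed

lemma card_le_dim:
  assumes "findim S" "B \<subseteq> S" "independent B"
  shows "finite B \<and> card B \<le> dim S"
proof -
  obtain C where C: "finite C" "S \<subseteq> span C" "card C = dim S" using findim_basis[OF assms(1)] by metis
  then show ?thesis using real_vector.independent_span_bound[OF C(1) assms(3)] assms(2) by auto
qed

text \<open>\<open>dim\<close> is the cardinality of a basis, hence 0 for a space of infinite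
  dimension; monotonicity therefore depends on \<open>findim\<close>.\<close>

lemma dim_mono_findim:
  assumes "findim T" "S \<subseteq> T" shows "dim S \<le> dim T"
proof -
  obtain B where "B \<subseteq> S" "independent B" "card B = dim S"
    using findim_basis[OF findim_subset[OF assms]] by metis
  with card_le_dim[OF assms(1)] assms(2) show ?thesis by (metis order_trans)
qed

lemma findim_image: "linear f \<Longrightarrow> findim S \<Longrightarrow> findim (f ` S)"
  unfolding findim_def by (metis finite_imageI image_mono linear_span_image)

lemma dim_zero_space: "dim {0::'v::real_vector} = 0"
  using real_vector.dim_le_card[of "{0}" "{}"] by simp

text \<open>A basis of the kernel together with preimages of a basis of the image is a basis of
  \<open>S\<close>.\<close>

lemma rank_nullity:
  assumes f: "linear f" and S: "subspace S" "findim S"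
  shows "dim S = dim {x \<in> S. f x = 0} + dim (f ` S)"
proof -
  interpret linear f by fact
  have fK: "findim {x \<in> S. f x = 0}" using S(2) by (rule findim_subset) auto
  obtain K where K: "finite K" "K \<subseteq> {x \<in> S. f x = 0}" "independent K" "{x \<in> S. f x = 0} \<subseteq> span K"
    "card K = dim {x \<in> S. f x = 0}" using findim_basis[OF fK] .
  obtain B where B: "finite B" "B \<subseteq> f ` S" "independent B" "f ` S \<subseteq> span B" "card B = dim (f ` S)"
    using findim_basis[OF findim_image[OF f S(2)]] .
  define g where "g = inv_into S f"
  have g: "g y \<in> S" "f (g y) = y" if "y \<in> B" for y
    using that B(2) unfolding g_def by (auto intro: inv_into_into f_inv_into_f)
  have inj: "inj_on g B" by (metis g(2) inj_onI)
  have disj: "K \<inter> g ` B = {}"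
  proof -
    have "0 \<notin> B" using B(3) real_vector.dependent_zero by blast
    then show ?thesis using K(2) g(2) by fastforce
  qed
  have sp: "S \<subseteq> span (K \<union> g ` B)"
  proof
    fix x assume x: "x \<in> S"
    then have "f x \<in> span B" using B(4) by blast
    then obtain c where c: "f x = (\<Sum>b\<in>B. c b *\<^sub>R b)" using B(1) by (auto simp: real_vector.span_finite)
    define y where "y = (\<Sum>b\<in>B. c b *\<^sub>R g b)"
    have yS: "y \<in> S" unfolding y_def by (intro real_vector.subspace_sum real_vector.subspace_scale S g)
    have "f y = f x" unfolding y_def c by (simp add: sum scale g cong: sum.cong)
    then have "x - y \<in> {x \<in> S. f x = 0}" using x yS S(1) by (auto simp: diff real_vector.subspace_diff)
    then have "x - y \<in> span (K \<union> g ` B)" using K(4) real_vector.span_mono[of K "K \<union> g ` B"] by blast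
    moreover have "y \<in> span (K \<union> g ` B)" unfolding y_def
      by (intro real_vector.span_sum real_vector.span_scale real_vector.span_base) auto
    ultimately show "x \<in> span (K \<union> g ` B)" using real_vector.span_add by fastforce
  qed
  have indep: "independent (K \<union> g ` B)"
  proof (rule real_vector.independent_if_scalars_zero)
    show "finite (K \<union> g ` B)" using K B by simp
    fix u x assume s0: "(\<Sum>x\<in>K \<union> g ` B. u x *\<^sub>R x) = 0" and x: "x \<in> K \<union> g ` B"
    have s: "(\<Sum>x\<in>K. u x *\<^sub>R x) + (\<Sum>b\<in>B. u (g b) *\<^sub>R g b) = 0"
      using s0 K(1) B(1) disj by (simp add: sum.union_disjoint sum.reindex[OF inj])
    then have "f ((\<Sum>x\<in>K. u x *\<^sub>R x) + (\<Sum>b\<in>B. u (g b) *\<^sub>R g b)) = 0" by (simp add: zero)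
    moreover have "f (\<Sum>x\<in>K. u x *\<^sub>R x) = 0" using K(2) by (auto simp: sum scale intro!: sum.neutral)
    ultimately have "(\<Sum>b\<in>B. u (g b) *\<^sub>R b) = 0" by (simp add: add sum scale g cong: sum.cong)
    then have u0: "u (g b) = 0" if "b \<in> B" for b
      using real_vector.independentD[OF B(3,1) subset_refl _ that, of "\<lambda>b. u (g b)"] by simp
    then have "(\<Sum>x\<in>K. u x *\<^sub>R x) = 0" using s by simp
    then have "u x = 0" if "x \<in> K" for x using real_vector.independentD[OF K(3,1) subset_refl _ that] by simp
    then show "u x = 0" using u0 x by auto
  qed
  have "dim S = card (K \<union> g ` B)"
    by (rule real_vector.basis_card_eq_dim[symmetric]) (use sp indep K(2) g in auto)
  also have "\<dots> = card K + card B" using K(1) B(1) disj inj by (simp add: card_Un_disjoint card_image)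
  finally show ?thesis using K(5) B(5) by simp
qed

lemma linear_funpow:
  assumes "linear (f :: 'v::real_vector \<Rightarrow> 'v)" shows "linear (f ^^ n)"
proof (induct n)
  case 0
  show ?case using real_vector.linear_id by (simp add: id_def)
next
  case (Suc n)
  then show ?case using linear_compose[OF Suc assms] by (simp add: o_def)
qed

lemma subspace_kernel:
  "linear f \<Longrightarrow> subspace S \<Longrightarrow> subspace {x \<in> S. f x = 0}"
  by (auto simp: real_vector.subspace_def linear_add linear_scale linear_0)

text \<open>The kernels of the powers of \<open>E\<close> filter \<open>S\<close>, and
  \<open>E ^^ b\<close> maps the quotient of two consecutive kernels isomorphically onto the
  \<open>b\<close>-th summand. This turns "apply the maximal non-vanishing power" into a dimension
  count.\<close>

lemma dim_nilpotent_filtration: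
  assumes E: "linear (E :: 'v::real_vector \<Rightarrow> 'v)" and S: "subspace S" "findim S" and nil: "\<And>x. x \<in> S \<Longrightarrow> (E ^^ m) x = 0"
  shows "dim S = (\<Sum>b<m. dim ((E ^^ b) ` {x \<in> S. (E ^^ Suc b) x = 0}))"
proof -
  define Q where "Q b = {x \<in> S. (E ^^ b) x = 0}" for b
  have "dim (Q m) = (\<Sum>b<m. dim ((E ^^ b) ` Q (Suc b)))"
  proof (induct m)
    case 0
    have "Q 0 = {0}" using real_vector.subspace_0[OF S(1)] by (auto simp: Q_def)
    then show ?case by (simp add: dim_zero_space)
  next
    case (Suc m)
    have sub: "subspace (Q (Suc m))" unfolding Q_def by (rule subspace_kernel[OF linear_funpow[OF E] S(1)])
    have fd: "findim (Q (Suc m))" using S(2) by (rule findim_subset) (auto simp: Q_def)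
    have "{x \<in> Q (Suc m). (E ^^ m) x = 0} = Q m"
      using linear_0[OF E] by (auto simp: Q_def)
    then show ?case using rank_nullity[OF linear_funpow[OF E, of m] sub fd] Suc by simp
  qed
  moreover have "Q m = S" using nil by (auto simp: Q_def)
  ultimately show ?thesis by (simp add: Q_def)
qed

lemma dim_add_le:
  assumes C: "findim C" "subspace C" and A: "subspace A" "A \<subseteq> C" and B: "subspace B" "B \<subseteq> C" and AB: "A \<inter> B \<subseteq> {0}"
  shows "dim A + dim B \<le> dim C"
proof -
  have fA: "findim A" and fB: "findim B" using C A B findim_subset by blast+
  obtain K where K: "finite K" "K \<subseteq> A" "independent K" "A \<subseteq> span K" "card K = dim A"
    using findim_basis[OF fA] .
  obtain L where L: "finite L" "L \<subseteq> B" "independent L" "B \<subseteq> span L" "card L = dim B"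
    using findim_basis[OF fB] .
  have 0: "0 \<notin> K" "0 \<notin> L" using K(3) L(3) real_vector.dependent_zero by blast+
  then have disj: "K \<inter> L = {}" using K(2) L(2) AB by blast
  have "independent (K \<union> L)"
  proof (rule real_vector.independent_if_scalars_zero)
    show "finite (K \<union> L)" using K L by simp
    fix u x assume s0: "(\<Sum>x\<in>K \<union> L. u x *\<^sub>R x) = 0" and x: "x \<in> K \<union> L"
    have s: "(\<Sum>x\<in>K. u x *\<^sub>R x) + (\<Sum>x\<in>L. u x *\<^sub>R x) = 0"
      using s0 K(1) L(1) disj by (simp add: sum.union_disjoint)
    have a: "(\<Sum>x\<in>K. u x *\<^sub>R x) \<in> A"
      using K(2) by (intro real_vector.subspace_sum real_vector.subspace_scale A) auto
    have b: "(\<Sum>x\<in>L. u x *\<^sub>R x) \<in> B"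
      using L(2) by (intro real_vector.subspace_sum real_vector.subspace_scale B) auto
    have "(\<Sum>x\<in>K. u x *\<^sub>R x) = - (\<Sum>x\<in>L. u x *\<^sub>R x)" using s by (simp add: eq_neg_iff_add_eq_0)
    then have "(\<Sum>x\<in>K. u x *\<^sub>R x) \<in> A \<inter> B" using a b real_vector.subspace_neg[OF B(1)] by auto
    then have z: "(\<Sum>x\<in>K. u x *\<^sub>R x) = 0" using AB by blast
    with s have "(\<Sum>x\<in>L. u x *\<^sub>R x) = 0" by simp
    with z show "u x = 0" using x real_vector.independentD[OF K(3,1) subset_refl, of u x]
      real_vector.independentD[OF L(3,1) subset_refl, of u x] by auto
  qed
  then have "card (K \<union> L) \<le> dim C" using card_le_dim[OF C(1), of "K \<union> L"] K(2) L(2) A(2) B(2) by blast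
  then show ?thesis using K L disj by (simp add: card_Un_disjoint)
qed

text \<open>Each functional cuts the dimension by at most one. Applied to the pairings with a basis
  of a subspace, this bounds its orthogonal complement from below.\<close>

lemma dim_kernel_family:
  assumes "finite I" and "\<And>i. i \<in> I \<Longrightarrow> linear (\<phi> i :: 'v::real_vector \<Rightarrow> real)" and "subspace S" "findim S"
  shows "dim S \<le> card I + dim {x \<in> S. \<forall>i\<in>I. \<phi> i x = 0}"
  using assms(1,2)
proof (induct I rule: finite_induct)
  case (insert i I)
  let ?S = "{x \<in> S. \<forall>i\<in>I. \<phi> i x = 0}"
  have sub: "subspace ?S" using insert.prems assms(3)
    by (auto simp: real_vector.subspace_def linear_add linear_scale linear_0)
  have fd: "findim ?S" using assms(4) by (rule findim_subset) auto
  have "\<phi> i ` ?S \<subseteq> span {1}" by (auto simp: real_vector.span_singleton)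
  then have "dim (\<phi> i ` ?S) \<le> 1" using real_vector.dim_le_card[of "\<phi> i ` ?S" "{1}"] by simp
  moreover have "dim ?S = dim {x \<in> ?S. \<phi> i x = 0} + dim (\<phi> i ` ?S)"
    using insert.prems by (intro rank_nullity sub fd) auto
  moreover have "{x \<in> ?S. \<phi> i x = 0} = {x \<in> S. \<forall>i\<in>insert i I. \<phi> i x = 0}" by auto
  ultimately show ?case using insert by simp
qed simp

section \<open>Tensors as functions on words\<close>

typedef 'a tensor = "UNIV :: (nat list \<Rightarrow> 'a) set" morphisms coeff Tensor ..

setup_lifting type_definition_tensor

lemma tensor_eqI: "(\<And>u. coeff f u = coeff g u) \<Longrightarrow> f = g"
  by transfer auto

text \<open>The sum of \<open>f v * g w\<close> over all splittings \<open>u = v @ w\<close>.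
  Recursion on the first letter replaces this sum, so that the ring laws follow by induction on the
  word.\<close>

primrec conv :: "nat list \<Rightarrow> (nat list \<Rightarrow> 'a::semiring_0) \<Rightarrow> (nat list \<Rightarrow> 'a) \<Rightarrow> 'a" where
  "conv [] f g = f [] * g []"
| "conv (x # u) f g = f [] * g (x # u) + conv u (\<lambda>v. f (x # v)) g"

lemma conv_add_left: "conv u (\<lambda>w. f w + f' w) g = conv u f g + conv u f' g"
  by (induct u arbitrary: f f') (simp_all add: algebra_simps)

lemma conv_add_right: "conv u f (\<lambda>w. g w + g' w) = conv u f g + conv u f g'"
  by (induct u arbitrary: f) (simp_all add: algebra_simps)

lemma conv_mult_left: "conv u (\<lambda>w. c * f w) g = c * conv u f g"
  by (induct u arbitrary: f) (simp_all add: algebra_simps)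

lemma conv_scaleR_left:
  "conv u (\<lambda>w. c *\<^sub>R f w) g = c *\<^sub>R conv u f (g :: _ \<Rightarrow> 'a::real_algebra)"
  by (induct u arbitrary: f) (simp_all add: algebra_simps)

lemma conv_scaleR_right:
  "conv u f (\<lambda>w. c *\<^sub>R g w) = c *\<^sub>R conv u f (g :: _ \<Rightarrow> 'a::real_algebra)"
  by (induct u arbitrary: f) (simp_all add: algebra_simps)

lemma conv_zero_left [simp]: "conv u (\<lambda>w. 0) g = 0"
  by (induct u) simp_all

lemma conv_assoc: "conv u (\<lambda>w. conv w f g) h = conv u f (\<lambda>w. conv w g h)"
  by (induct u arbitrary: f)
    (simp_all add: conv_add_left conv_mult_left algebra_simps)

lemma conv_one_left: "conv u (\<lambda>w. if w = [] then 1 else 0) g = (g u :: 'a::semiring_1)"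
  by (cases u) simp_all

lemma conv_one_right: "conv u f (\<lambda>w. if w = [] then 1 else 0) = (f u :: 'a::semiring_1)"
  by (induct u arbitrary: f) simp_all

instantiation tensor :: (real_algebra_1) real_algebra_1
begin
lift_definition zero_tensor :: "'a tensor" is "\<lambda>u. 0" .
lift_definition one_tensor :: "'a tensor" is "\<lambda>u. if u = [] then 1 else 0" .
lift_definition plus_tensor :: "'a tensor \<Rightarrow> 'a tensor \<Rightarrow> 'a tensor" is "\<lambda>f g u. f u + g u" .
lift_definition minus_tensor :: "'a tensor \<Rightarrow> 'a tensor \<Rightarrow> 'a tensor" is "\<lambda>f g u. f u - g u" .
lift_definition uminus_tensor :: "'a tensor \<Rightarrow> 'a tensor" is "\<lambda>f u. - f u" .
lift_definition times_tensor :: "'a tensor \<Rightarrow> 'a tensor \<Rightarrow> 'a tensor" is "\<lambda>f g u. conv u f g" .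
lift_definition scaleR_tensor :: "real \<Rightarrow> 'a tensor \<Rightarrow> 'a tensor" is "\<lambda>c f u. c *\<^sub>R f u" .
instance
proof
  fix f :: "'a tensor"
  show "1 * f = f" by transfer (simp add: conv_one_left)
  show "f * 1 = f" by transfer (simp add: conv_one_right)
  show "(0::'a tensor) \<noteq> 1" by transfer (metis zero_neq_one)
qed (transfer, simp add: fun_eq_iff algebra_simps conv_assoc conv_add_left conv_add_right conv_scaleR_left conv_scaleR_right
      scaleR_add_left scaleR_add_right)+
end

lemma coeff_simps [simp]:
  "coeff 0 u = 0" "coeff (f + g) u = coeff f u + coeff g u" "coeff (f - g) u = coeff f u - coeff g u"
  "coeff (- f) u = - coeff f u" "coeff (c *\<^sub>R f) u = c *\<^sub>R coeff f u"
  by (transfer, simp)+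

lemma coeff_mult: "coeff (f * g) u = conv u (coeff f) (coeff g)"
  by transfer simp

lemma coeff_one: "coeff 1 u = (if u = [] then 1 else 0)"
  by transfer simp

lemma coeff_sum: "coeff (sum f A) u = (\<Sum>a\<in>A. coeff (f a) u)"
  by (induct A rule: infinite_finite_induct) auto

text \<open>If \<open>f\<close> is homogeneous of degree \<open>n\<close>, only the splitting after
  \<open>n\<close> letters survives. Coefficients of products of Hall polynomials thus factor over
  blocks of letters.\<close>

lemma conv_append:
  assumes "\<And>v. length v \<noteq> n \<Longrightarrow> f v = 0" and "length u = n"
  shows "conv (u @ v) f g = f u * (g v :: 'a::semiring_0)"
  using assms
proof (induct u arbitrary: f n)
  case Nil
  then show ?case by (cases v) (auto intro!: arg_cong2[where f="(+)"] trans[OF _ conv_zero_left[of _ g]] cong: if_cong)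
next
  case (Cons x u)
  have "f [] = 0" using Cons.prems by auto
  moreover have "conv (u @ v) (\<lambda>v. f (x # v)) g = f (x # u) * g v"
    using Cons.prems by (intro Cons.hyps[where n="n - 1"]) auto
  ultimately show ?case by simp
qed

lift_definition monom :: "nat list \<Rightarrow> real tensor" is "\<lambda>w u. if u = w then 1 else 0" .

lemma coeff_monom: "coeff (monom w) u = (if u = w then 1 else 0)"
  by transfer simp

lemma monom_Nil: "monom [] = 1"
  by (rule tensor_eqI) (simp add: coeff_monom coeff_one)

lemma monom_Cons: "monom (x # w) = monom [x] * monom w"
proof (rule tensor_eqI)
  fix u show "coeff (monom (x # w)) u = coeff (monom [x] * monom w) u"
  proof (cases u)
    case (Cons y v)
    have *: "conv v (\<lambda>v. if v = [] then 1 else 0) (coeff (monom w)) = coeff (monom w) v"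
      by (rule conv_one_left)
    show ?thesis
    proof (cases "y = x")
      case True
      then show ?thesis using Cons * by (auto simp: coeff_mult coeff_monom)
    qed (use Cons in \<open>auto simp: coeff_mult coeff_monom\<close>)
  qed (simp add: coeff_mult coeff_monom)
qed

section \<open>Weights and weight spaces\<close>

text \<open>
  Weights are integer-valued: a weight with a negative entry has weight space \<open>0\<close>, and the shift of
  a weight never truncates.
\<close>

definition content :: "nat list \<Rightarrow> nat \<Rightarrow> int" where
  "content u = (\<lambda>j. int (count (mset u) j))"

definition words :: "(nat \<Rightarrow> int) \<Rightarrow> nat list set" where
  "words \<mu> = {u. content u = \<mu>}"

definition weight_space :: "(nat \<Rightarrow> int) \<Rightarrow> real tensor set" where
  "weight_space \<mu> = {f. \<forall>u. coeff f u \<noteq> 0 \<longrightarrow> content u = \<mu>}"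

lemma ctn_eq_iff: "content u = content v \<longleftrightarrow> mset u = mset v"
  by (auto simp: content_def fun_eq_iff multiset_eq_iff)

lemma finite_words_of: "finite (words \<mu>)"
proof (cases "words \<mu> = {}")
  case False
  then obtain u where u: "content u = \<mu>" by (auto simp: words_def)
  then have "words \<mu> = {v. mset v = mset u}" by (auto simp: words_def simp flip: ctn_eq_iff)
  also have "\<dots> \<subseteq> {v. set v \<subseteq> set u \<and> length v = length u}"
    by (auto dest: mset_eq_setD mset_eq_length)
  finally show ?thesis using finite_lists_length_eq[of "set u" "length u"] by (auto intro: finite_subset)
qed simp

lemma subspace_weight_space: "subspace (weight_space \<mu>)"
  by (auto simp: real_vector.subspace_def weight_space_def) force+

lemma monom_weight_space: "monom w \<in> weight_space (content w)"
  by (simp add: weight_space_def coeff_monom)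

lemma wspace_expand:
  assumes "f \<in> weight_space \<mu>" shows "f = (\<Sum>w\<in>words \<mu>. coeff f w *\<^sub>R monom w)"
proof (rule tensor_eqI)
  fix u
  have "coeff (\<Sum>w\<in>words \<mu>. coeff f w *\<^sub>R monom w) u = (\<Sum>w\<in>words \<mu>. if u = w then coeff f w else 0)"
    unfolding coeff_sum by (rule sum.cong) (auto simp: coeff_monom)
  also have "\<dots> = (if u \<in> words \<mu> then coeff f u else 0)" by (simp add: finite_words_of)
  also have "\<dots> = coeff f u" using assms by (auto simp: weight_space_def words_def)
  finally show "coeff f u = coeff (\<Sum>w\<in>words \<mu>. coeff f w *\<^sub>R monom w) u" by simp
qed

lemma inj_monom: "inj_on monom A"
  by (rule inj_onI) (metis coeff_monom zero_neq_one)

lemma independent_monom: "finite A \<Longrightarrow> independent (monom ` A)"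
proof (rule real_vector.independent_if_scalars_zero)
  fix c x assume A: "finite A" and s: "(\<Sum>x\<in>monom ` A. c x *\<^sub>R x) = 0" and x: "x \<in> monom ` A"
  then obtain w where w: "w \<in> A" "x = monom w" by auto
  have "0 = coeff (\<Sum>x\<in>A. c (monom x) *\<^sub>R monom x) w" using s by (simp add: sum.reindex[OF inj_monom])
  also have "\<dots> = (\<Sum>x\<in>A. if w = x then c (monom x) else 0)"
    unfolding coeff_sum by (rule sum.cong) (auto simp: coeff_monom)
  also have "\<dots> = c x" using A w by simp
  finally show "c x = 0" by simp
qed simp

lemma wspace_span: "weight_space \<mu> \<subseteq> span (monom ` words \<mu>)"
proof
  fix f assume "f \<in> weight_space \<mu>"
  then have "f = (\<Sum>w\<in>words \<mu>. coeff f w *\<^sub>R monom w)" by (rule wspace_expand)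
  also have "\<dots> \<in> span (monom ` words \<mu>)"
    by (intro real_vector.span_sum real_vector.span_scale real_vector.span_base) auto
  finally show "f \<in> span (monom ` words \<mu>)" .
qed

lemma findim_weight_space: "findim (weight_space \<mu>)"
  unfolding findim_def using wspace_span finite_words_of by blast

lemma dim_weight_space: "dim (weight_space \<mu>) = card (words \<mu>)"
proof -
  have "monom ` words \<mu> \<subseteq> weight_space \<mu>" using monom_weight_space by (auto simp: words_def)
  then show ?thesis
    using real_vector.basis_card_eq_dim[OF _ wspace_span independent_monom[OF finite_words_of]]
    by (simp add: card_image[OF inj_monom])
qed

lemma mult_weight_space:
  assumes "f \<in> weight_space \<mu>" "g \<in> weight_space \<nu>" shows "f * g \<in> weight_space (\<lambda>j. \<mu> j + \<nu> j)"
proof -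
  have "conv u F G \<noteq> 0 \<Longrightarrow> \<exists>a b. u = a @ b \<and> F a \<noteq> 0 \<and> G b \<noteq> 0" for u and F G :: "nat list \<Rightarrow> real"
  proof (induct u arbitrary: F)
    case (Cons x u)
    show ?case
    proof (cases "F [] * G (x # u) = 0")
      case True
      then have "conv u (\<lambda>v. F (x # v)) G \<noteq> 0" using Cons.prems by auto
      from Cons.hyps[OF this] obtain a b where "u = a @ b" "F (x # a) \<noteq> 0" "G b \<noteq> 0" by blast
      then show ?thesis by (metis append_Cons)
    next
      case False
      then show ?thesis by (metis append_Nil mult_eq_0_iff)
    qed
  qed simp
  then show ?thesis using assms unfolding weight_space_def
    by (simp add: coeff_mult) (fastforce simp: content_def fun_eq_iff)
qed

section \<open>Derivations of the tensor algebra\<close>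

text \<open>
  \<open>der a b\<close> is the derivation with \<open>x\<^sub>b \<mapsto> x\<^sub>a\<close>; on coefficient functions a letter \<open>a\<close> of the
  argument is turned back into \<open>b\<close>.
\<close>

primrec der_aux :: "nat list \<Rightarrow> nat \<Rightarrow> nat \<Rightarrow> (nat list \<Rightarrow> real) \<Rightarrow> real" where
  "der_aux [] a b f = 0"
| "der_aux (x # u) a b f = (if x = a then f (b # u) else 0) + der_aux u a b (\<lambda>v. f (x # v))"

lift_definition der :: "nat \<Rightarrow> nat \<Rightarrow> real tensor \<Rightarrow> real tensor" is "\<lambda>a b f u. der_aux u a b f" .

lemma coeff_der: "coeff (der a b f) u = der_aux u a b (coeff f)"
  by transfer simp

lemma coeff_der': "coeff (der a b f) = (\<lambda>u. der_aux u a b (coeff f))"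
  by (rule ext) (rule coeff_der)

lemma coeff_mult': "coeff (f * g) = (\<lambda>u. conv u (coeff f) (coeff g))"
  by (rule ext) (rule coeff_mult)

lemma coeff_add': "coeff (f + g) = (\<lambda>u. coeff f u + coeff g u)" "coeff (c *\<^sub>R f) = (\<lambda>u. c *\<^sub>R coeff f u)"
  by (rule ext, simp)+

lemma der_aux_add: "der_aux u a b (\<lambda>v. f v + g v) = der_aux u a b f + der_aux u a b g"
  by (induct u arbitrary: f g) auto

lemma der_aux_mult: "der_aux u a b (\<lambda>v. c * f v) = c * der_aux u a b f"
  by (induct u arbitrary: f) (auto simp: algebra_simps)

lemma der_aux_if: "der_aux u a b (\<lambda>v. if P then f v else 0) = (if P then der_aux u a b f else 0)"
  using der_aux_mult[of u a b "of_bool P" f] by (cases P) auto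

lemma linear_der: "linear (der a b)"
  by (rule linearI) (auto intro!: tensor_eqI simp: coeff_der coeff_add' der_aux_add der_aux_mult)

lemma der_add: "der a b (f + g) = der a b f + der a b g"
  and der_diff: "der a b (f - g) = der a b f - der a b g"
  and der_scale: "der a b (c *\<^sub>R f) = c *\<^sub>R der a b f"
  and der_zero [simp]: "der a b 0 = 0"
  using linear_der[of a b] by (auto simp: linear_add linear_diff linear_scale linear_0)

lemma der_mult: "der a b (f * g) = der a b f * g + f * der a b g"
proof -
  have "der_aux u a b (\<lambda>w. conv w f g) =
      conv u (\<lambda>w. der_aux w a b f) g + conv u f (\<lambda>w. der_aux w a b g)" for u and f g :: "nat list \<Rightarrow> real"
  proof (induct u arbitrary: f)
    case (Cons x u)
    then show ?case
      by (cases "x = a") (simp_all add: der_aux_add der_aux_mult conv_add_left algebra_simps)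
  qed simp
  then show ?thesis by (intro tensor_eqI) (simp add: coeff_der' coeff_mult')
qed

text \<open>The commutation relations of matrix units: \<open>der a b\<close> is the action of the
  matrix unit E_ab on tensors.\<close>

lemma der_commutator:
  "der a b (der c d f) - der c d (der a b f) =
    of_bool (b = c) *\<^sub>R der a d f - of_bool (a = d) *\<^sub>R der c b f"
proof -
  have "der_aux u a b (\<lambda>w. der_aux w c d f) - der_aux u c d (\<lambda>w. der_aux w a b f) =
    of_bool (b = c) * der_aux u a d f - of_bool (a = d) * der_aux u c b f" for u f
  proof (induct u arbitrary: f)
    case (Cons x u)
    show ?case using Cons[of "\<lambda>v. f (x # v)"]
      by (auto simp: der_aux_add der_aux_if algebra_simps)
  qed simp
  then show ?thesis by (intro tensor_eqI) (simp add: coeff_der')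
qed

lemma der_diag: "f \<in> weight_space \<mu> \<Longrightarrow> der a a f = of_int (\<mu> a) *\<^sub>R f"
proof -
  have *: "der_aux u a a f = of_int (content u a) * f u" for u f
    by (induct u arbitrary: f) (auto simp: content_def algebra_simps)
  show "f \<in> weight_space \<mu> \<Longrightarrow> der a a f = of_int (\<mu> a) *\<^sub>R f"
    by (intro tensor_eqI) (auto simp: coeff_der weight_space_def * )
qed

definition shift :: "int \<Rightarrow> nat \<Rightarrow> nat \<Rightarrow> (nat \<Rightarrow> int) \<Rightarrow> nat \<Rightarrow> int" where
  "shift n a b \<mu> = (\<lambda>j. \<mu> j + n * of_bool (j = a) - n * of_bool (j = b))"

text \<open>The word \<open>v\<close> is \<open>u\<close> with one letter \<open>a\<close> turned
  back into \<open>b\<close>. All facts about the weight, length and letters of a derivative are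
  read off from it.\<close>

lemma der_aux_nonzero: "der_aux u a b f \<noteq> 0 \<Longrightarrow> \<exists>v. f v \<noteq> 0 \<and> content u = shift 1 a b (content v) \<and> length v = length u
    \<and> set v \<subseteq> insert b (set u)"
proof (induct u arbitrary: f)
  case (Cons x u)
  show ?case
  proof (cases "x = a \<and> f (b # u) \<noteq> 0")
    case True
    then show ?thesis by (intro exI[of _ "b # u"]) (auto simp: content_def shift_def fun_eq_iff)
  next
    case False
    then have "der_aux u a b (\<lambda>v. f (x # v)) \<noteq> 0" using Cons.prems by (auto split: if_splits)
    from Cons.hyps[OF this] obtain v where "f (x # v) \<noteq> 0" "content u = shift 1 a b (content v)"
      "length v = length u" "set v \<subseteq> insert b (set u)" by blast
    then show ?thesis by (intro exI[of _ "x # v"]) (auto simp: content_def shift_def fun_eq_iff)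
  qed
qed simp

lemma der_wspace: "f \<in> weight_space \<mu> \<Longrightarrow> der a b f \<in> weight_space (shift 1 a b \<mu>)"
  unfolding weight_space_def using der_aux_nonzero by (fastforce simp: coeff_der)

lemma shift_zero [simp]: "shift 0 a b \<mu> = \<mu>"
  by (simp add: shift_def)

lemma shift_shift: "shift m a b (shift n a b \<mu>) = shift (m + n) a b \<mu>"
  by (auto simp: shift_def fun_eq_iff algebra_simps)

lemma der_funpow_wspace: "f \<in> weight_space \<mu> \<Longrightarrow> (der a b ^^ n) f \<in> weight_space (shift (int n) a b \<mu>)"
proof (induct n)
  case (Suc n)
  then show ?case using der_wspace[of "(der a b ^^ n) f" "shift (int n) a b \<mu>" a b]
    by (simp add: shift_shift)
qed simp

section \<open>The inner product on words\<close>

definition bounded_words :: "nat \<Rightarrow> nat \<Rightarrow> nat list set" where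
  "bounded_words N d = {u. set u \<subseteq> {..<N} \<and> length u = d}"

lemma finite_Ld: "finite (bounded_words N d)"
  unfolding bounded_words_def by (rule finite_lists_length_eq) simp

lemma sum_Ld_Suc: "(\<Sum>u\<in>bounded_words N (Suc d). h u) = (\<Sum>x<N. \<Sum>u\<in>bounded_words N d. h (x # u))"
proof -
  have "bounded_words N (Suc d) = (\<lambda>(x, u). x # u) ` ({..<N} \<times> bounded_words N d)"
    by (auto simp: bounded_words_def length_Suc_conv image_iff)
  moreover have "inj_on (\<lambda>(x, u). x # u) ({..<N} \<times> bounded_words N d)" by (auto simp: inj_on_def)
  ultimately show ?thesis by (simp add: sum.reindex sum.cartesian_product case_prod_unfold)
qed

text \<open>Adjointness of \<open>der a b\<close> and \<open>der b a\<close> needs a finite set of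
  words that is closed under replacing \<open>a\<close> by \<open>b\<close> and conversely; a bound
  on the letters and a fixed length provide one.\<close>

definition inner :: "nat \<Rightarrow> nat \<Rightarrow> real tensor \<Rightarrow> real tensor \<Rightarrow> real" where
  "inner N d f g = (\<Sum>u\<in>bounded_words N d. coeff f u * coeff g u)"

lemma der_adjoint:
  assumes "a < N" "b < N" shows "inner N d (der a b f) g = inner N d f (der b a g)"
proof -
  have "(\<Sum>u\<in>bounded_words N d. der_aux u a b f * g u) = (\<Sum>u\<in>bounded_words N d. f u * der_aux u b a g)" for f g
  proof (induct d arbitrary: f g)
    case 0
    have "bounded_words N 0 = {[]}" by (auto simp: bounded_words_def)
    then show ?case by simp
  next
    case (Suc d)
    \<comment> \<open>In the terms where the derivation hits the first letter, \<open>f\<close> is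
      evaluated at \<open>b # u\<close> and \<open>g\<close> at \<open>a # u\<close> on either side;
      the remaining terms are covered by induction.\<close>
    have 1: "(\<Sum>x<N. \<Sum>u\<in>bounded_words N d. (if x = a then f (b # u) else 0) * g (x # u)) =
        (\<Sum>u\<in>bounded_words N d. f (b # u) * g (a # u))"
    proof -
      have "(\<Sum>x<N. \<Sum>u\<in>bounded_words N d. (if x = a then f (b # u) else 0) * g (x # u)) =
        (\<Sum>x<N. if x = a then \<Sum>u\<in>bounded_words N d. f (b # u) * g (a # u) else 0)"
        by (rule sum.cong) auto
      then show ?thesis using assms by simp
    qed
    have 2: "(\<Sum>x<N. \<Sum>u\<in>bounded_words N d. f (x # u) * (if x = b then g (a # u) else 0)) =
        (\<Sum>u\<in>bounded_words N d. f (b # u) * g (a # u))"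
    proof -
      have "(\<Sum>x<N. \<Sum>u\<in>bounded_words N d. f (x # u) * (if x = b then g (a # u) else 0)) =
        (\<Sum>x<N. if x = b then \<Sum>u\<in>bounded_words N d. f (b # u) * g (a # u) else 0)"
        by (rule sum.cong) auto
      then show ?thesis using assms by simp
    qed
    show ?case
      by (simp add: sum_Ld_Suc distrib_left distrib_right sum.distrib 1 2 Suc)
  qed
  then show ?thesis by (simp add: inner_def coeff_der)
qed

lemma ip_simps:
  "inner N d (f + f') g = inner N d f g + inner N d f' g"
  "inner N d f (g + g') = inner N d f g + inner N d f g'"
  "inner N d (c *\<^sub>R f) g = c * inner N d f g"
  "inner N d f (c *\<^sub>R g) = c * inner N d f g"
  "inner N d 0 g = 0" "inner N d f 0 = 0"
  "inner N d f g = inner N d g f"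
  by (simp_all add: inner_def algebra_simps sum.distrib sum_distrib_left)

lemma ip_ge_0: "0 \<le> inner N d f f"
  by (simp add: inner_def sum_nonneg)

lemma ip_eq_0:
  assumes "\<And>u. coeff f u \<noteq> 0 \<Longrightarrow> u \<in> bounded_words N d" "inner N d f f = 0" shows "f = 0"
proof (rule tensor_eqI)
  fix u
  have "\<forall>u\<in>bounded_words N d. coeff f u * coeff f u = 0"
    using assms(2) unfolding inner_def by (subst (asm) sum_nonneg_eq_0_iff) (auto simp: finite_Ld)
  then show "coeff f u = coeff 0 u" using assms(1) by auto
qed

lemma der_adjoint_funpow:
  assumes "a < N" "b < N" shows "inner N d ((der a b ^^ n) f) g = inner N d f ((der b a ^^ n) g)"
proof (induct n arbitrary: g)
  case (Suc n)
  have "inner N d ((der a b ^^ Suc n) f) g = inner N d ((der a b ^^ n) f) (der b a g)"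
    using der_adjoint[OF assms] by simp
  also have "\<dots> = inner N d f ((der b a ^^ Suc n) g)"
    by (simp only: Suc funpow_Suc_right o_apply)
  finally show ?case .
qed simp

text \<open>All words of one weight are rearrangements of each other, hence share their letters and
  their length. The bound also covers \<open>a\<close> and \<open>b\<close>, as adjointness
  requires.\<close>

lemma wspace_bounds:
  obtains N d where "a < N" "b < N" "\<And>f u. f \<in> weight_space \<mu> \<Longrightarrow> coeff f u \<noteq> 0 \<Longrightarrow> u \<in> bounded_words N d"
proof (cases "words \<mu> = {}")
  case True
  then show ?thesis by (intro that[of "Suc (max a b)" 0]) (auto simp: weight_space_def words_def)
next
  case False
  then obtain w where w: "content w = \<mu>" by (auto simp: words_def)
  obtain N0 where N0: "\<forall>x\<in>set w. x < N0" by (meson finite_set finite_nat_set_iff_bounded)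
  show ?thesis
  proof (rule that[of "Suc (max N0 (max a b))" "length w"])
    fix f u assume "f \<in> weight_space \<mu>" "coeff f u \<noteq> 0"
    then have "mset u = mset w" using w by (auto simp: weight_space_def simp flip: ctn_eq_iff)
    then have "set u = set w" "length u = length w" by (metis set_mset_mset, metis size_mset)
    then show "u \<in> bounded_words (Suc (max N0 (max a b))) (length w)"
      using N0 by (fastforce simp: bounded_words_def)
  qed auto
qed

section \<open>Representations of sl2 by positivity\<close>

text \<open>
  Since \<open>der b a\<close> is adjoint to \<open>der a b\<close>, the squared norm of \<open>der b a f\<close> is
  \<open>(\<mu>\<^sub>a - \<mu>\<^sub>b)\<close> times that of \<open>f\<close> if \<open>der a b f = 0\<close>.
\<close>

lemma raising_injective:
  assumes f: "f \<in> weight_space \<mu>" "der a b f = 0" and "\<mu> a < \<mu> b"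
  shows "f = 0"
proof -
  obtain N d where N: "a < N" "b < N" and s: "\<And>f u. f \<in> weight_space \<mu> \<Longrightarrow> coeff f u \<noteq> 0 \<Longrightarrow> u \<in> bounded_words N d"
    using wspace_bounds[where \<mu>=\<mu> and a=a and b=b] by metis
  have "der a b (der b a f) = of_int (\<mu> a - \<mu> b) *\<^sub>R f"
    using der_commutator[of a b b a f] f by (simp add: der_diag scaleR_diff_left)
  then have "inner N d (der b a f) (der b a f) = of_int (\<mu> a - \<mu> b) * inner N d f f"
    using der_adjoint[OF N(2,1)] by (simp add: ip_simps)
  then have "0 \<le> of_int (\<mu> a - \<mu> b) * inner N d f f" using ip_ge_0 by metis
  then have "inner N d f f = 0"
    using assms(3) ip_ge_0[of N d f] by (auto simp: zero_le_mult_iff)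
  then show ?thesis using ip_eq_0 s f(1) by blast
qed

text \<open>The sl2 identity e f^(n+1) v = (n + 1)(m - n) f^n v for a highest weight vector
  \<open>v\<close> of weight m = \<open>\<mu> a - \<mu> b\<close>, where e is \<open>der a b\<close>
  and f is \<open>der b a\<close>.\<close>

lemma lowering_highest:
  assumes f: "f \<in> weight_space \<mu>" "der a b f = 0" and ab: "a \<noteq> b"
  shows "der a b ((der b a ^^ Suc n) f) = of_int (int (Suc n) * (\<mu> a - \<mu> b - int n)) *\<^sub>R (der b a ^^ n) f"
proof (induct n)
  case 0
  then show ?case using der_commutator[of a b b a f] f by (simp add: der_diag scaleR_diff_left)
next
  case (Suc n)
  let ?g = "(der b a ^^ Suc n) f"
  have g: "?g \<in> weight_space (shift (int (Suc n)) b a \<mu>)" by (rule der_funpow_wspace[OF f(1)])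
  have "der a b (der b a ?g) = der b a (der a b ?g) + (der a a ?g - der b b ?g)"
    using der_commutator[of a b b a ?g] by (simp add: algebra_simps)
  \<comment> \<open>Each lowering step decreases the sl2-weight by 2.\<close>
  also have "der a a ?g - der b b ?g = of_int (\<mu> a - \<mu> b - 2 * int (Suc n)) *\<^sub>R ?g"
    unfolding der_diag[OF g] scaleR_diff_left[symmetric] using ab by (simp add: shift_def)
  also have "der b a (der a b ?g) = of_int (int (Suc n) * (\<mu> a - \<mu> b - int n)) *\<^sub>R ?g"
    unfolding Suc by (simp add: der_scale)
  finally have "der a b (der b a ?g) = (of_int (int (Suc n) * (\<mu> a - \<mu> b - int n)) +
      of_int (\<mu> a - \<mu> b - 2 * int (Suc n))) *\<^sub>R ?g"
    by (simp only: scaleR_add_left)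
  also have "of_int (int (Suc n) * (\<mu> a - \<mu> b - int n)) + of_int (\<mu> a - \<mu> b - 2 * int (Suc n)) =
      real_of_int (int (Suc (Suc n)) * (\<mu> a - \<mu> b - int (Suc n)))"
    by (simp add: algebra_simps)
  finally show ?case by simp
qed

text \<open>For t = \<open>\<mu> a - \<mu> b\<close> the scalar in \<open>lowering_highest\<close>
  vanishes, so the vector lowered t + 1 times is killed by raising. Its sl2-weight is negative, and
  \<open>raising_injective\<close> makes it zero.\<close>

lemma lowering_nilpotent:
  assumes f: "f \<in> weight_space \<mu>" "der a b f = 0" and ab: "a \<noteq> b" and n: "int n > \<mu> a - \<mu> b"
  shows "(der b a ^^ n) f = 0"
proof (cases "\<mu> a < \<mu> b")
  case True
  then have "f = 0" using raising_injective f by blast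
  then show ?thesis using linear_0[OF linear_funpow[OF linear_der]] by blast
next
  case False
  define t where "t = nat (\<mu> a - \<mu> b)"
  have t: "int t = \<mu> a - \<mu> b" using False by (simp add: t_def)
  have "der a b ((der b a ^^ Suc t) f) = 0" using lowering_highest[OF f ab, of t] t by simp
  then have z: "(der b a ^^ Suc t) f = 0"
    by (rule raising_injective[OF der_funpow_wspace[OF f(1)]]) (use ab t in \<open>simp add: shift_def\<close>)
  have "n = (n - Suc t) + Suc t" using n t by linarith
  then have "(der b a ^^ n) f = (der b a ^^ (n - Suc t)) ((der b a ^^ Suc t) f)"
    by (metis funpow_add o_apply)
  then show ?thesis using z linear_0[OF linear_funpow[OF linear_der]] by simp
qed

text \<open>The vector g = \<open>(der a b ^^ n) f\<close> is killed by raising and has sl2-weight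
  \<open>\<mu> a - \<mu> b + 2 * n\<close>. If \<open>n\<close> exceeded this weight, lowering g
  \<open>n\<close> times would give 0, and by adjointness the squared norm of g would be 0.\<close>

lemma raising_length_bound:
  assumes f: "f \<in> weight_space \<mu>" and ab: "a \<noteq> b" and nz: "(der a b ^^ n) f \<noteq> 0" and z: "(der a b ^^ Suc n) f = 0"
  shows "\<mu> b - int n \<le> \<mu> a"
proof (rule ccontr)
  assume lt: "\<not> ?thesis"
  let ?g = "(der a b ^^ n) f"
  have g: "?g \<in> weight_space (shift (int n) a b \<mu>)" by (rule der_funpow_wspace[OF f])
  obtain N d where N: "a < N" "b < N" and s: "\<And>h u. h \<in> weight_space (shift (int n) a b \<mu>) \<Longrightarrow> coeff h u \<noteq> 0 \<Longrightarrow> u \<in> bounded_words N d"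
    using wspace_bounds[where \<mu>="shift (int n) a b \<mu>" and a=a and b=b] by metis
  have "(der b a ^^ n) ?g = 0"
    by (rule lowering_nilpotent[OF g _ ab]) (use z ab lt in \<open>auto simp: shift_def\<close>)
  then have "inner N d ?g ?g = 0" using der_adjoint_funpow[OF N, of d n f ?g] by (simp add: ip_simps)
  with s[OF g] have "?g = 0" by (rule ip_eq_0)
  with nz show False by simp
qed

section \<open>Branching of highest weight vectors\<close>

lemma funpow_commute_at:
  fixes D Q :: "'v \<Rightarrow> 'v"
  assumes "\<And>x. D (Q x) = Q (D x)" shows "D ((Q ^^ n) x) = (Q ^^ n) (D x)"
  using assms by (induct n) auto

text \<open>A Heisenberg algebra with central element \<open>X\<close>. It occurs below with
  \<open>P = der i j\<close>, \<open>Q = der j (Suc j)\<close> and \<open>X = der i (Suc j)\<close>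
  for \<open>i < j\<close>.\<close>

context
  fixes P Q X :: "'v::real_vector \<Rightarrow> 'v"
  assumes lin: "linear P" "linear Q" "linear X"
    and PQ: "\<And>x. P (Q x) = Q (P x) + X x"
    and PX: "\<And>x. P (X x) = X (P x)"
    and QX: "\<And>x. X (Q x) = Q (X x)"
begin

lemma heisenberg_commute:
  assumes "P x = 0" shows "P ((Q ^^ Suc c) x) = of_nat (Suc c) *\<^sub>R (Q ^^ c) (X x)"
proof (induct c)
  case 0
  then show ?case using assms PQ linear_0[OF lin(2)] by simp
next
  case (Suc c)
  have "P ((Q ^^ Suc (Suc c)) x) = Q (P ((Q ^^ Suc c) x)) + X ((Q ^^ Suc c) x)" using PQ by simp
  also have "X ((Q ^^ Suc c) x) = (Q ^^ Suc c) (X x)" by (rule funpow_commute_at) (rule QX)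
  also have "Q (P ((Q ^^ Suc c) x)) = of_nat (Suc c) *\<^sub>R (Q ^^ Suc c) (X x)"
    by (subst Suc) (simp add: linear_scale[OF lin(2)])
  finally show ?case by (simp only: of_nat_Suc[of "Suc c"] scaleR_add_left scaleR_one add.commute)
qed

lemma heisenberg_vanish:
  assumes "P x = 0" "n > c" shows "(P ^^ n) ((Q ^^ c) x) = 0"
  using assms
proof (induct c arbitrary: n x)
  case 0
  then obtain m where "n = Suc m" by (cases n) auto
  then show ?case using 0 linear_0[OF linear_funpow[OF lin(1), of m]] by (simp add: funpow_swap1)
next
  case (Suc c)
  then obtain m where n: "n = Suc m" "c < m" by (cases n) auto
  have "(P ^^ n) ((Q ^^ Suc c) x) = (P ^^ m) (P ((Q ^^ Suc c) x))" unfolding n by (simp add: funpow_swap1)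
  also have "\<dots> = of_nat (Suc c) *\<^sub>R (P ^^ m) ((Q ^^ c) (X x))"
    by (simp only: heisenberg_commute[OF Suc.prems(1)] linear_scale[OF linear_funpow[OF lin(1)]])
  also have "(P ^^ m) ((Q ^^ c) (X x)) = 0"
    using Suc.hyps[of "X x" m] n Suc.prems(1) PX linear_0[OF lin(3)] by simp
  finally show ?case by simp
qed

text \<open>Applying \<open>P\<close> to \<open>(Q ^^ Suc c) x = 0\<close> leaves a nonzero multiple
  of \<open>(Q ^^ c) (X x)\<close>.\<close>

lemma heisenberg_center:
  assumes "P x = 0" "(Q ^^ Suc c) x = 0" shows "X ((Q ^^ c) x) = 0"
proof -
  have "of_nat (Suc c) *\<^sub>R (Q ^^ c) (X x) = 0"
    using heisenberg_commute[OF assms(1), of c] assms(2) linear_0[OF lin(1)] by simp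
  then have "(Q ^^ c) (X x) = 0" by simp
  moreover have "X ((Q ^^ c) x) = (Q ^^ c) (X x)" by (rule funpow_commute_at) (rule QX)
  ultimately show ?thesis by simp
qed

end

text \<open>A submodule is recorded as the family of its weight spaces, so no tensor ever has to be
  decomposed into weight components.\<close>

definition weight_module :: "((nat \<Rightarrow> int) \<Rightarrow> real tensor set) \<Rightarrow> bool" where
  "weight_module W \<longleftrightarrow> (\<forall>\<mu>. subspace (W \<mu>) \<and> W \<mu> \<subseteq> weight_space \<mu> \<and> (\<forall>a b. der a b ` W \<mu> \<subseteq> W (shift 1 a b \<mu>)))"

lemma weight_moduleD:
  assumes "weight_module W"
  shows "subspace (W \<mu>)" "W \<mu> \<subseteq> weight_space \<mu>" "x \<in> W \<mu> \<Longrightarrow> der a b x \<in> W (shift 1 a b \<mu>)" "findim (W \<mu>)"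
  using assms findim_subset[OF findim_weight_space] unfolding weight_module_def by blast+

lemma weight_module_funpow:
  assumes "weight_module W" "x \<in> W \<mu>" shows "(der a b ^^ n) x \<in> W (shift (int n) a b \<mu>)"
proof (induct n)
  case (Suc n)
  then show ?case using weight_moduleD(3)[OF assms(1) Suc, of a b] by (simp add: shift_shift)
qed (use assms in simp)

text \<open>Highest weight vectors for gl_k acting on the first \<open>k\<close> letters. For
  \<open>k = 0\<close> this is all of \<open>W \<mu>\<close>; the branching steps lead from there to
  \<open>highest\<close>.\<close>

definition highest_below :: "nat \<Rightarrow> ((nat \<Rightarrow> int) \<Rightarrow> real tensor set) \<Rightarrow> (nat \<Rightarrow> int) \<Rightarrow> real tensor set" where
  "highest_below k W \<mu> = {u \<in> W \<mu>. \<forall>i l. i < l \<and> l < k \<longrightarrow> der i l u = 0}"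

lemma wspace_negative: "f \<in> weight_space \<mu> \<Longrightarrow> \<mu> i < 0 \<Longrightarrow> f = 0"
  by (rule tensor_eqI) (auto simp: weight_space_def content_def)

lemma der_raise_empty: "f \<in> weight_space \<mu> \<Longrightarrow> \<mu> b \<le> 0 \<Longrightarrow> a \<noteq> b \<Longrightarrow> der a b f = 0"
  by (rule wspace_negative[OF der_wspace, of f \<mu> a b b]) (auto simp: shift_def)

section \<open>One branching step\<close>

text \<open>
  One step of the Gelfand--Tsetlin branching: from vectors that are highest for the first \<open>k\<close>
  letters to vectors that are highest for the first \<open>k + 1\<close> letters, by applying the maximal
  non-vanishing powers of the raising operators \<open>k \<rightarrow> k - 1\<close>, \<dots>, \<open>1 \<rightarrow> 0\<close> in this order.
  \<open>Z j\<close> collects what is known after the operator \<open>j + 1 \<rightarrow> j\<close>, and \<open>J j\<close> the possible weights.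
  The bound \<open>\<mu> (Suc i) \<le> \<kappa> i\<close> of the horizontal strip condition comes from \<open>sl\<^sub>2\<close>-theory for
  a single step.
\<close>

context
  fixes W :: "(nat \<Rightarrow> int) \<Rightarrow> real tensor set" and k :: nat and \<kappa> :: "nat \<Rightarrow> int"
  assumes W: "weight_module W" and pos: "\<And>i. 0 \<le> \<kappa> i"
begin

text \<open>The lower bounds of the interlacing condition: rows below \<open>k\<close> never fall
  under \<open>\<kappa>\<close>, whereas row \<open>k\<close> may be emptied completely.\<close>

private definition \<nu> :: "nat \<Rightarrow> int" where "\<nu> i = (if i < k then \<kappa> i else 0)"

text \<open>Operators into the letter \<open>j\<close> are exempt from vanishing. What is kept of
  them is that \<open>der (j - 1) j\<close>, the next operator to be applied, moves at most
  \<open>\<mu> j - \<nu> j\<close> letters.\<close>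

private definition Z :: "nat \<Rightarrow> (nat \<Rightarrow> int) \<Rightarrow> real tensor set" where
  "Z j \<mu> = {u \<in> W \<mu>. (\<forall>i l. i < l \<and> l \<le> k \<and> l \<noteq> j \<longrightarrow> der i l u = 0) \<and>
     (0 < j \<longrightarrow> (der (j - 1) j ^^ Suc (nat (\<mu> j - \<nu> j))) u = 0)}"

private definition J :: "nat \<Rightarrow> (nat \<Rightarrow> int) set" where
  "J j = {\<mu>. (\<forall>i. i < j \<or> i > k \<longrightarrow> \<mu> i = \<kappa> i) \<and> (\<forall>i. j \<le> i \<and> i < k \<longrightarrow> \<mu> (Suc i) \<le> \<kappa> i) \<and>
     (\<forall>i. j \<le> i \<and> i \<le> k \<longrightarrow> \<nu> i \<le> \<mu> i) \<and> (\<Sum>i\<le>k. \<mu> i) = (\<Sum>i\<le>k. \<kappa> i)}"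

private lemma \<nu>_nonneg: "0 \<le> \<nu> i"
  using pos by (simp add: \<nu>_def)

private lemma finite_J: "finite (J j)"
proof -
  let ?S = "\<Sum>i\<le>k. \<kappa> i"
  have "J j \<subseteq> (\<lambda>f i. if i \<le> k then f i else \<kappa> i) `
      {f. \<forall>i. (i \<in> {..k} \<longrightarrow> f i \<in> {0..?S}) \<and> (i \<notin> {..k} \<longrightarrow> f i = 0)}" (is "_ \<subseteq> ?h ` ?A")
  proof
    fix \<mu> assume \<mu>: "\<mu> \<in> J j"
    have nn: "0 \<le> \<mu> i" if "i \<le> k" for i
    proof (cases "i < j")
      case True
      then have "\<mu> i = \<kappa> i" using \<mu> by (simp add: J_def)
      then show ?thesis using pos by simp
    next
      case False
      then have "\<nu> i \<le> \<mu> i" using \<mu> that by (simp add: J_def)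
      then show ?thesis using \<nu>_nonneg[of i] by linarith
    qed
    have "\<mu> i \<le> ?S" if "i \<le> k" for i
    proof -
      have "\<mu> i \<le> (\<Sum>i\<le>k. \<mu> i)" using that nn by (intro member_le_sum) auto
      then show ?thesis using \<mu> by (simp add: J_def)
    qed
    then have A: "(\<lambda>i. if i \<le> k then \<mu> i else 0) \<in> ?A" using nn by auto
    have B: "\<mu> = ?h (\<lambda>i. if i \<le> k then \<mu> i else 0)" using \<mu> by (auto simp: J_def fun_eq_iff)
    show "\<mu> \<in> ?h ` ?A" using B A by (rule image_eqI)
  qed
  moreover have "finite ?A" using finite_set_of_finite_funs[of "{..k}" "{0..?S}" 0] by simp
  ultimately show ?thesis by (rule finite_subset[OF _ finite_imageI])
qed

private lemma subspace_Z: "subspace (Z j \<mu>)"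
proof -
  have *: "linear (der (j - Suc 0) j ^^ n)" for n by (rule linear_funpow[OF linear_der])
  show ?thesis using weight_moduleD(1)[OF W, of \<mu>]
    unfolding Z_def real_vector.subspace_def mem_Collect_eq
    by (auto simp: der_add der_scale linear_add[OF *] linear_0[OF *] linear_scale[OF *] simp del: funpow.simps)
qed

private lemma findim_Z: "findim (Z j \<mu>)"
  by (rule findim_subset[OF weight_moduleD(4)[OF W]]) (auto simp: Z_def)

text \<open>Operators into the letter \<open>j + 1\<close> now vanish: the one from \<open>j\<close>
  by the choice of \<open>c\<close>, those from \<open>i < j\<close> because they are central in a
  Heisenberg algebra. In exchange the vanishing of operators into \<open>j\<close> is lost, except
  for the nilpotency bound, which is again a Heisenberg computation.\<close>

private lemma Z_step:
  assumes j: "j < k" and \<mu>: "\<mu> \<in> J (Suc j)" and x: "x \<in> Z (Suc j) \<mu>"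
    and c: "(der j (Suc j) ^^ Suc c) x = 0"
  shows "(der j (Suc j) ^^ c) x \<in> Z j (shift (int c) j (Suc j) \<mu>)"
proof -
  let ?E = "der j (Suc j)"
  let ?u = "(?E ^^ c) x"
  have xW: "x \<in> W \<mu>" and kill: "\<And>i l. i < l \<Longrightarrow> l \<le> k \<Longrightarrow> l \<noteq> Suc j \<Longrightarrow> der i l x = 0"
    using x by (auto simp: Z_def)
  have "?u \<in> W (shift (int c) j (Suc j) \<mu>)" by (rule weight_module_funpow[OF W xW])
  moreover have "der i l ?u = 0" if il: "i < l" "l \<le> k" "l \<noteq> j" for i l
  proof -
    have zero: "(?E ^^ c) 0 = 0" by (rule linear_0[OF linear_funpow[OF linear_der]])
    consider "l = Suc j" "i = j" | "l = Suc j" "i < j" | "l \<noteq> Suc j" "i = Suc j" | "l \<noteq> Suc j" "i \<noteq> Suc j"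
      using il by linarith
    then show ?thesis
    proof cases
      case 1
      then show ?thesis using c by simp
    next
      case 2
      show ?thesis unfolding 2(1)
      proof (rule heisenberg_center[where P="der i j" and Q="?E"])
        show "der i j x = 0" using kill[of i j] 2 j by simp
        show "der i j (?E y) = ?E (der i j y) + der i (Suc j) y" for y
          using der_commutator[of i j j "Suc j" y] 2 by (simp add: algebra_simps)
        show "der i j (der i (Suc j) y) = der i (Suc j) (der i j y)" for y
          using der_commutator[of i j i "Suc j" y] 2 by simp
        show "der i (Suc j) (?E y) = ?E (der i (Suc j) y)" for y
          using der_commutator[of i "Suc j" j "Suc j" y] 2 by simp
      qed (use c linear_der in auto)
    next
      case 3
      \<comment> \<open>\<open>der (Suc j) l\<close> does not commute with \<open>?E\<close>, but
        the error term \<open>der j l\<close> does, and it kills \<open>x\<close>, hence all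
        \<open>(?E ^^ n) x\<close>.\<close>
      have com: "der j l (?E y) = ?E (der j l y)" for y
        using der_commutator[of j l j "Suc j" y] 3 il by auto
      have com': "der (Suc j) l (?E y) = ?E (der (Suc j) l y) - der j l y" for y
        using der_commutator[of "Suc j" l j "Suc j" y] 3 il by (simp add: algebra_simps)
      have "der j l ((?E ^^ n) x) = 0" for n
        using funpow_commute_at[of "der j l" ?E n x] com kill[of j l] 3 il
          linear_0[OF linear_funpow[OF linear_der]] by simp
      then have "der (Suc j) l ((?E ^^ n) x) = 0" for n
        using kill[of "Suc j" l] 3 il by (induct n) (auto simp: com')
      then show ?thesis using 3 by simp
    next
      case 4
      have "der i l (?E y) = ?E (der i l y)" for y
        using der_commutator[of i l j "Suc j" y] 4 il by simp
      then have "der i l ?u = (?E ^^ c) (der i l x)" by (rule funpow_commute_at)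
      then show ?thesis using kill[of i l] il 4 zero by simp
    qed
  qed
  moreover have "(der (j - 1) j ^^ Suc (nat (shift (int c) j (Suc j) \<mu> j - \<nu> j))) ?u = 0" if "0 < j"
  proof -
    \<comment> \<open>Before the step row \<open>j\<close> equals \<open>\<kappa> j\<close>, which
      is also \<open>\<nu> j\<close>; the difference counts exactly the \<open>c\<close> letters
      that were moved.\<close>
    have "shift (int c) j (Suc j) \<mu> j - \<nu> j = int c" using \<mu> j by (simp add: shift_def \<nu>_def J_def)
    moreover have ne: "j - Suc 0 \<noteq> Suc j" "j \<noteq> j - Suc 0" using that by linarith+
    moreover have "(der (j - 1) j ^^ Suc c) ?u = 0"
    proof (rule heisenberg_vanish[where X="der (j - 1) (Suc j)"])
      show "der (j - 1) j x = 0" using kill[of "j - 1" j] that j by simp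
      show "der (j - 1) j (?E y) = ?E (der (j - 1) j y) + der (j - 1) (Suc j) y" for y
        using der_commutator[of "j - 1" j j "Suc j" y] ne by (simp add: algebra_simps)
      show "der (j - 1) j (der (j - 1) (Suc j) y) = der (j - 1) (Suc j) (der (j - 1) j y)" for y
        using der_commutator[of "j - 1" j "j - 1" "Suc j" y] ne by simp
      show "der (j - 1) (Suc j) (?E y) = ?E (der (j - 1) (Suc j) y)" for y
        using der_commutator[of "j - 1" "Suc j" j "Suc j" y] ne by simp
    qed (use linear_der in auto)
    ultimately show ?thesis by simp
  qed
  ultimately show ?thesis by (simp add: Z_def)
qed

text \<open>The first bound on \<open>c\<close> is the nilpotency recorded in \<open>Z\<close>, the
  second is \<open>raising_length_bound\<close>. Since \<open>\<mu> j = \<kappa> j\<close>, the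
  second one is the strip condition for row \<open>j + 1\<close>.\<close>

private lemma shift_J:
  assumes j: "j < k" and \<mu>: "\<mu> \<in> J (Suc j)" and c: "int c \<le> \<mu> (Suc j) - \<nu> (Suc j)" "\<mu> (Suc j) - int c \<le> \<mu> j"
  shows "shift (int c) j (Suc j) \<mu> \<in> J j"
proof -
  let ?s = "shift (int c) j (Suc j) \<mu>"
  have s: "?s i = (if i = j then \<mu> j + int c else if i = Suc j then \<mu> (Suc j) - int c else \<mu> i)" for i
    by (simp add: shift_def)
  have "(\<Sum>i\<le>k. ?s i) = (\<Sum>i\<le>k. \<mu> i)"
  proof -
    have "(\<Sum>i\<le>k. ?s i) = (\<Sum>i\<le>k. \<mu> i + (if i = j then int c else 0) - (if i = Suc j then int c else 0))"
      by (rule sum.cong) (auto simp: s)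
    then show ?thesis using j by (simp add: sum.distrib sum_subtractf)
  qed
  moreover have eq: "\<mu> j = \<kappa> j" "\<nu> j = \<kappa> j" using \<mu> j by (auto simp: J_def \<nu>_def)
  moreover have "?s i = \<kappa> i" if "i < j \<or> i > k" for i using that \<mu> j by (auto simp: s J_def)
  moreover have "?s (Suc i) \<le> \<kappa> i" if "j \<le> i" "i < k" for i
  proof (cases "i = j")
    case False
    then have "\<mu> (Suc i) \<le> \<kappa> i" using \<mu> that by (simp add: J_def)
    with False that show ?thesis by (simp add: s)
  qed (use c eq in \<open>simp add: s\<close>)
  moreover have "\<nu> i \<le> ?s i" if "j \<le> i" "i \<le> k" for i
  proof (cases "i = j \<or> i = Suc j")
    case False
    then have "\<nu> i \<le> \<mu> i" using \<mu> that by (simp add: J_def)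
    with False show ?thesis by (simp add: s)
  qed (use c eq in \<open>auto simp: s\<close>)
  ultimately show ?thesis using \<mu> by (simp add: J_def)
qed

text \<open>Filter by the maximal power of \<open>der j (Suc j)\<close>. A power whose target weight
  is outside \<open>J j\<close> has zero image by \<open>raising_length_bound\<close>.\<close>

private lemma dim_Z_step:
  assumes j: "j < k" and \<mu>: "\<mu> \<in> J (Suc j)"
  shows "dim (Z (Suc j) \<mu>) \<le> (\<Sum>c | shift (int c) j (Suc j) \<mu> \<in> J j. dim (Z j (shift (int c) j (Suc j) \<mu>)))"
    and "finite {c. shift (int c) j (Suc j) \<mu> \<in> J j}"
proof -
  let ?E = "der j (Suc j)" and ?s = "\<lambda>c. shift (int c) j (Suc j) \<mu>"
  let ?m = "Suc (nat (\<mu> (Suc j) - \<nu> (Suc j)))"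
  have nil: "(?E ^^ ?m) x = 0" if "x \<in> Z (Suc j) \<mu>" for x
    using that unfolding Z_def by simp
  have nonneg: "\<nu> (Suc j) \<le> \<mu> (Suc j)" using \<mu> j by (simp add: J_def)
  have Jc: "{c. ?s c \<in> J j} \<subseteq> {..<?m}"
  proof
    fix c assume "c \<in> {c. ?s c \<in> J j}"
    then have "\<nu> (Suc j) \<le> ?s c (Suc j)" using j by (auto simp: J_def)
    then show "c \<in> {..<?m}" by (auto simp: shift_def)
  qed
  then show "finite {c. ?s c \<in> J j}" using finite_subset by blast
  have le: "dim ((?E ^^ c) ` {x \<in> Z (Suc j) \<mu>. (?E ^^ Suc c) x = 0}) \<le>
      (if ?s c \<in> J j then dim (Z j (?s c)) else 0)" (is "dim ?I \<le> _") if c: "c < ?m" for c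
  proof (cases "?s c \<in> J j")
    case True
    have "?I \<subseteq> Z j (?s c)" using Z_step[OF j \<mu>] by blast
    then show ?thesis using True dim_mono_findim[OF findim_Z] by simp
  next
    case False
    have "?I \<subseteq> {0}"
    proof (rule ccontr)
      assume "\<not> ?I \<subseteq> {0}"
      then obtain x where x: "x \<in> Z (Suc j) \<mu>" "(?E ^^ Suc c) x = 0" "(?E ^^ c) x \<noteq> 0" by blast
      then have "x \<in> weight_space \<mu>" using weight_moduleD(2)[OF W] by (auto simp: Z_def)
      then have "\<mu> (Suc j) - int c \<le> \<mu> j" using raising_length_bound[of x \<mu> j "Suc j" c] x by simp
      then have "?s c \<in> J j" using shift_J[OF j \<mu>, of c] c nonneg by simp
      with False show False by simp
    qed
    then show ?thesis using real_vector.dim_le_card[of ?I "{}"] by simp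
  qed
  have "dim (Z (Suc j) \<mu>) = (\<Sum>c<?m. dim ((?E ^^ c) ` {x \<in> Z (Suc j) \<mu>. (?E ^^ Suc c) x = 0}))"
    by (rule dim_nilpotent_filtration[OF linear_der subspace_Z findim_Z nil])
  also have "\<dots> \<le> (\<Sum>c<?m. if ?s c \<in> J j then dim (Z j (?s c)) else 0)"
    by (rule sum_mono) (use le in auto)
  also have "\<dots> = (\<Sum>c | ?s c \<in> J j. dim (Z j (?s c)))"
    using Jc by (subst sum.If_cases) (auto intro!: sum.cong)
  finally show "dim (Z (Suc j) \<mu>) \<le> (\<Sum>c | ?s c \<in> J j. dim (Z j (?s c)))" .
qed

private lemma dim_sum_step:
  assumes j: "j < k"
  shows "(\<Sum>\<mu>\<in>J (Suc j). dim (Z (Suc j) \<mu>)) \<le> (\<Sum>\<mu>\<in>J j. dim (Z j \<mu>))"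
proof -
  let ?C = "\<lambda>\<mu>. {c. shift (int c) j (Suc j) \<mu> \<in> J j}"
  let ?h = "\<lambda>(\<mu>, c). shift (int c) j (Suc j) \<mu>"
  have "(\<Sum>\<mu>\<in>J (Suc j). dim (Z (Suc j) \<mu>)) \<le> (\<Sum>\<mu>\<in>J (Suc j). \<Sum>c\<in>?C \<mu>. dim (Z j (?h (\<mu>, c))))"
    using dim_Z_step(1)[OF j] by (intro sum_mono) auto
  also have "\<dots> = (\<Sum>p\<in>Sigma (J (Suc j)) ?C. dim (Z j (?h p)))"
    using dim_Z_step(2)[OF j] finite_J by (subst sum.Sigma) (auto simp: case_prod_unfold)
  also have "\<dots> = (\<Sum>\<mu>\<in>?h ` Sigma (J (Suc j)) ?C. dim (Z j \<mu>))"
  proof (rule sum.reindex[symmetric, unfolded o_def])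
    show "inj_on ?h (Sigma (J (Suc j)) ?C)"
    proof (rule inj_onI, clarsimp)
      fix \<mu> c \<mu>' c'
      assume m: "\<mu> \<in> J (Suc j)" "\<mu>' \<in> J (Suc j)"
        and eq: "shift (int c) j (Suc j) \<mu> = shift (int c') j (Suc j) \<mu>'"
      \<comment> \<open>Row \<open>j\<close> is \<open>\<kappa> j\<close> before the step, so its
        new length reveals \<open>c\<close>, and with \<open>c\<close> the old weight.\<close>
      have "\<mu> j = \<mu>' j" using m by (simp add: J_def)
      moreover have "\<mu> j + int c = \<mu>' j + int c'" using fun_cong[OF eq, of j] by (simp add: shift_def)
      ultimately have "c = c'" by simp
      moreover have "\<mu> = \<mu>'"
        using eq \<open>c = c'\<close> by (metis (no_types) ab_left_minus shift_shift shift_zero)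
      ultimately show "\<mu> = \<mu>' \<and> c = c'" by simp
    qed
  qed
  also have "\<dots> \<le> (\<Sum>\<mu>\<in>J j. dim (Z j \<mu>))"
    by (rule sum_mono2[OF finite_J]) auto
  finally show ?thesis .
qed

text \<open>The weights in \<open>L\<close> arise from the first \<open>k\<close> entries of
  \<open>\<kappa>\<close> by adding a horizontal strip with as many boxes as there are letters
  \<open>k\<close>, i.e. \<open>\<kappa> k\<close>. This is the strip that one step of
  \<open>kostka\<close> removes.\<close>

lemma branching:
  fixes L
  defines "L \<equiv> {\<mu>. (\<forall>i>k. \<mu> i = \<kappa> i) \<and> (\<forall>i<k. \<mu> (Suc i) \<le> \<kappa> i \<and> \<kappa> i \<le> \<mu> i) \<and> 0 \<le> \<mu> k \<and>
     (\<Sum>i\<le>k. \<mu> i) = (\<Sum>i\<le>k. \<kappa> i)}"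
  shows "finite L" "dim (highest_below k W \<kappa>) \<le> (\<Sum>\<mu>\<in>L. dim (highest_below (Suc k) W \<mu>))"
proof -
  have "(\<forall>i. i \<le> k \<longrightarrow> \<nu> i \<le> \<mu> i) \<longleftrightarrow> (\<forall>i<k. \<kappa> i \<le> \<mu> i) \<and> 0 \<le> \<mu> k" for \<mu>
    by (auto simp: \<nu>_def le_less)
  then have L: "J 0 = L" unfolding J_def L_def by (intro Collect_cong) (simp, blast)
  show "finite L" using finite_J[of 0] L by simp
  have "(\<Sum>\<mu>\<in>J (0 + n). dim (Z (0 + n) \<mu>)) \<le> (\<Sum>\<mu>\<in>J 0. dim (Z 0 \<mu>))" if "n \<le> k" for n
    using that
  proof (induct n)
    case (Suc n)
    then show ?case using dim_sum_step[of n] by simp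
  qed simp
  from this[of k] have le: "(\<Sum>\<mu>\<in>J k. dim (Z k \<mu>)) \<le> (\<Sum>\<mu>\<in>J 0. dim (Z 0 \<mu>))" by simp
  have "\<kappa> \<in> J k" using pos \<nu>_nonneg by (auto simp: J_def \<nu>_def)
  then have "dim (Z k \<kappa>) \<le> (\<Sum>\<mu>\<in>J k. dim (Z k \<mu>))" by (intro member_le_sum finite_J) auto
  moreover have "highest_below k W \<kappa> \<subseteq> Z k \<kappa>"
  proof
    fix u assume u: "u \<in> highest_below k W \<kappa>"
    then have uw: "u \<in> weight_space \<kappa>" using weight_moduleD(2)[OF W] by (auto simp: highest_below_def)
    \<comment> \<open>There are only \<open>\<kappa> k\<close> letters \<open>k\<close>, so raising
      one more would make the weight negative.\<close>
    have "(der (k - 1) k ^^ Suc (nat (\<kappa> k - \<nu> k))) u = 0" if "0 < k"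
      by (rule wspace_negative[OF der_funpow_wspace[OF uw], of _ _ _ k])
        (use that pos[of k] in \<open>auto simp: shift_def \<nu>_def\<close>)
    with u show "u \<in> Z k \<kappa>" by (auto simp: highest_below_def Z_def)
  qed
  then have "dim (highest_below k W \<kappa>) \<le> dim (Z k \<kappa>)" by (rule dim_mono_findim[OF findim_Z])
  moreover have "Z 0 \<mu> = highest_below (Suc k) W \<mu>" for \<mu> by (auto simp: Z_def highest_below_def)
  ultimately show "dim (highest_below k W \<kappa>) \<le> (\<Sum>\<mu>\<in>L. dim (highest_below (Suc k) W \<mu>))" using le L by simp
qed

end

section \<open>Kostka numbers\<close>

definition fsupp :: "(nat \<Rightarrow> nat) \<Rightarrow> bool" where
  "fsupp p \<longleftrightarrow> finite {i. p i \<noteq> 0}"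

definition decreasing :: "(nat \<Rightarrow> nat) \<Rightarrow> bool" where
  "decreasing p \<longleftrightarrow> (\<forall>i. p (Suc i) \<le> p i)"

definition psize :: "(nat \<Rightarrow> nat) \<Rightarrow> nat" where
  "psize p = (\<Sum>i | p i \<noteq> 0. p i)"

definition shapes :: "nat \<Rightarrow> (nat \<Rightarrow> nat) set" where
  "shapes d = {p. decreasing p \<and> fsupp p \<and> psize p = d}"

text \<open>For partitions: the skew shape \<open>p / q\<close> is a horizontal strip.\<close>

definition interlace :: "(nat \<Rightarrow> nat) \<Rightarrow> (nat \<Rightarrow> nat) \<Rightarrow> bool" where
  "interlace q p \<longleftrightarrow> (\<forall>i. q i \<le> p i \<and> p (Suc i) \<le> q i)"

definition addable :: "(nat \<Rightarrow> nat) \<Rightarrow> nat \<Rightarrow> bool" where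
  "addable p i \<longleftrightarrow> i = 0 \<or> p i < p (i - 1)"

definition removable :: "(nat \<Rightarrow> nat) \<Rightarrow> nat \<Rightarrow> bool" where
  "removable p i \<longleftrightarrow> p (Suc i) < p i"

abbreviation up :: "nat \<Rightarrow> (nat \<Rightarrow> nat) \<Rightarrow> nat \<Rightarrow> nat" where
  "up i p \<equiv> p(i := Suc (p i))"

abbreviation down :: "nat \<Rightarrow> (nat \<Rightarrow> nat) \<Rightarrow> nat \<Rightarrow> nat" where
  "down i p \<equiv> p(i := p i - 1)"

text \<open>
  A partition is a decreasing function on row indices.  \<open>kostka\<close> counts semistandard tableaux by
  stripping off the largest entry, and \<open>paths\<close> counts standard tableaux.
\<close>

primrec kostka :: "nat \<Rightarrow> (nat \<Rightarrow> nat) \<Rightarrow> (nat \<Rightarrow> nat) \<Rightarrow> nat" where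
  "kostka 0 \<mu> p = of_bool (p = (\<lambda>_. 0))"
| "kostka (Suc k) \<mu> p = (\<Sum>q | interlace q p \<and> psize p = psize q + \<mu> k. kostka k \<mu> q)"

primrec paths :: "nat \<Rightarrow> (nat \<Rightarrow> nat) \<Rightarrow> nat" where
  "paths 0 p = of_bool (p = (\<lambda>_. 0))"
| "paths (Suc d) p = (\<Sum>i | removable p i. paths d (down i p))"

section \<open>Shapes, their sizes, and single boxes\<close>

lemma supp_bounded:
  assumes "\<And>i. (i::nat) \<ge> n \<Longrightarrow> p i = (0::nat)" shows "{i. p i \<noteq> 0} \<subseteq> {..<n}"
proof
  fix i assume "i \<in> {i. p i \<noteq> 0}"
  then show "i \<in> {..<n}" using assms[of i] by (cases "i < n") auto
qed

lemma psize_bounded: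
  assumes "\<And>i. i \<ge> n \<Longrightarrow> p i = 0" shows "psize p = (\<Sum>i<n. p i)"
  unfolding psize_def
proof (rule sum.mono_neutral_left)
  show "{i. p i \<noteq> 0} \<subseteq> {..<n}" by (rule supp_bounded) (rule assms)
qed auto

lemma fsupp_bounded:
  assumes "\<And>i. i \<ge> n \<Longrightarrow> p i = 0" shows "fsupp p"
proof -
  have "{i. p i \<noteq> 0} \<subseteq> {..<n}" by (rule supp_bounded) (rule assms)
  then show ?thesis unfolding fsupp_def by (rule finite_subset) simp
qed

lemma fsupp_bound:
  assumes "fsupp p" obtains n where "\<And>i. i \<ge> n \<Longrightarrow> p i = 0"
proof -
  obtain n where "\<forall>i\<in>{i. p i \<noteq> 0}. i < n" using assms unfolding fsupp_def finite_nat_set_iff_bounded by blast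
  then show ?thesis using that[of n] by (metis mem_Collect_eq not_le)
qed

lemma finite_below:
  assumes "fsupp g" shows "finite {f. \<forall>i. f i \<le> (g i :: nat)}"
proof -
  let ?A = "{i. g i \<noteq> 0}" and ?m = "\<Sum>i | g i \<noteq> 0. g i"
  have "{f. \<forall>i. f i \<le> g i} \<subseteq> {f. \<forall>i. (i \<in> ?A \<longrightarrow> f i \<in> {..?m}) \<and> (i \<notin> ?A \<longrightarrow> f i = 0)}"
  proof (intro subsetI CollectI allI, simp only: mem_Collect_eq not_not)
    fix f i assume f: "\<forall>i. f i \<le> g i"
    have "g i \<le> ?m" if "0 < g i" using assms that by (intro member_le_sum) (auto simp: fsupp_def)
    then show "(g i \<noteq> 0 \<longrightarrow> f i \<in> {..?m}) \<and> (g i = 0 \<longrightarrow> f i = 0)"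
      using f[rule_format, of i] by auto
  qed
  moreover have "finite {f. \<forall>i. (i \<in> ?A \<longrightarrow> f i \<in> {..?m}) \<and> (i \<notin> ?A \<longrightarrow> f i = 0)}"
    using finite_set_of_finite_funs[of ?A "{..?m}" 0] assms by (simp add: fsupp_def)
  ultimately show ?thesis by (rule finite_subset)
qed

lemma dec_antimono: "decreasing p \<Longrightarrow> i \<le> j \<Longrightarrow> p j \<le> p i"
  unfolding decreasing_def by (rule lift_Suc_antimono_le) auto

lemma interlace_dec: "interlace q p \<Longrightarrow> decreasing q \<and> decreasing p"
  unfolding interlace_def decreasing_def using le_trans by blast

lemma fsupp_mono:
  assumes "fsupp p" "\<And>i. q i \<le> p i" shows "fsupp q"
proof -
  have "p i \<noteq> 0" if "q i \<noteq> 0" for i using assms(2)[of i] that by linarith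
  then have "{i. q i \<noteq> 0} \<subseteq> {i. p i \<noteq> 0}" by blast
  then show ?thesis using assms(1) unfolding fsupp_def by (rule finite_subset)
qed

lemma interlace_fsupp:
  assumes "interlace q p" shows "fsupp q \<longleftrightarrow> fsupp p"
proof
  assume "fsupp q"
  then obtain n where "\<And>i. i \<ge> n \<Longrightarrow> q i = 0" using fsupp_bound by metis
  then have "p i = 0" if "i \<ge> Suc n" for i
  proof -
    obtain j where "i = Suc j" "n \<le> j" using \<open>i \<ge> Suc n\<close> by (cases i) auto
    moreover from this have "q j = 0" using \<open>\<And>i. i \<ge> n \<Longrightarrow> q i = 0\<close> by simp
    moreover have "p (Suc j) \<le> q j" using assms by (simp add: interlace_def)
    ultimately show ?thesis by simp
  qed
  then show "fsupp p" by (rule fsupp_bounded)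
qed (use assms in \<open>auto simp: interlace_def intro: fsupp_mono\<close>)

lemma psize_mono: "fsupp p \<Longrightarrow> (\<And>i. q i \<le> p i) \<Longrightarrow> psize q \<le> psize p"
proof -
  assume "fsupp p" and le: "\<And>i. q i \<le> p i"
  then obtain n where n: "\<And>i. i \<ge> n \<Longrightarrow> p i = 0" using fsupp_bound by metis
  then have "q i = 0" if "i \<ge> n" for i using le[of i] that by simp
  then show ?thesis using n le by (simp add: psize_bounded[of n] sum_mono)
qed

lemma fsupp_upd [simp]: "fsupp (p(i := a)) \<longleftrightarrow> fsupp p"
proof -
  have "{j. (p(i := a)) j \<noteq> 0} \<subseteq> insert i {j. p j \<noteq> 0}" "{j. p j \<noteq> 0} \<subseteq> insert i {j. (p(i := a)) j \<noteq> 0}"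
    by auto
  then show ?thesis unfolding fsupp_def by (metis finite_insert finite_subset)
qed

lemma psize_up: assumes "fsupp p" shows "psize (up i p) = Suc (psize p)"
proof -
  obtain n where n: "\<And>i. i \<ge> n \<Longrightarrow> p i = 0" using fsupp_bound[OF assms] by metis
  let ?n = "max n (Suc i)"
  have "psize (up i p) = (\<Sum>j<?n. up i p j)" using n by (intro psize_bounded) auto
  also have "\<dots> = (\<Sum>j<?n. p j + (if j = i then 1 else 0))" by (rule sum.cong) auto
  also have "\<dots> = Suc (\<Sum>j<?n. p j)" by (simp add: sum.distrib)
  also have "(\<Sum>j<?n. p j) = psize p" using n by (intro psize_bounded[symmetric]) auto
  finally show ?thesis .
qed

lemma psize_down: "fsupp p \<Longrightarrow> p i > 0 \<Longrightarrow> Suc (psize (down i p)) = psize p"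
  using psize_up[of "down i p" i] by simp

lemma dec_up:
  assumes "decreasing p" "addable p i" shows "decreasing (up i p)"
  unfolding decreasing_def
proof
  fix j
  have "p (Suc j) \<le> p j" using assms(1) by (simp add: decreasing_def)
  moreover have "Suc (p (Suc j)) \<le> p j" if "i = Suc j" using assms(2) that by (simp add: addable_def)
  ultimately show "up i p (Suc j) \<le> up i p j" by auto
qed

lemma dec_down:
  assumes "decreasing p" "removable p i" shows "decreasing (down i p)"
  unfolding decreasing_def
proof
  fix j
  have "p (Suc j) \<le> p j" using assms(1) by (simp add: decreasing_def)
  moreover have "p (Suc j) < p j" if "i = j" using assms(2) that by (simp add: removable_def)
  ultimately show "down i p (Suc j) \<le> down i p j" by auto
qed

lemma removable_up: "decreasing p \<Longrightarrow> removable (up i p) i"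
  unfolding decreasing_def removable_def by (simp add: le_imp_less_Suc)

lemma addable_down:
  assumes "decreasing p" "removable p i" shows "addable (down i p) i"
proof (cases i)
  case (Suc j)
  have "p (Suc j) \<le> p j" using assms(1) by (simp add: decreasing_def)
  moreover have "p (Suc (Suc j)) < p (Suc j)" using assms(2) Suc by (simp add: removable_def)
  ultimately show ?thesis unfolding Suc addable_def by simp
qed (simp add: addable_def)

lemma finite_removable: "fsupp p \<Longrightarrow> finite {i. removable p i}"
  unfolding fsupp_def by (rule finite_subset[of _ "{i. p i \<noteq> 0}"]) (auto simp: removable_def)

lemma finite_addable: "fsupp p \<Longrightarrow> finite {i. addable p i}"
proof -
  assume "fsupp p"
  moreover have "{i. addable p i} \<subseteq> insert 0 (Suc ` {i. p i \<noteq> 0})"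
  proof
    fix i assume "i \<in> {i. addable p i}"
    then show "i \<in> insert 0 (Suc ` {i. p i \<noteq> 0})" by (cases i) (auto simp: addable_def)
  qed
  ultimately show ?thesis unfolding fsupp_def by (metis finite_imageI finite_insert finite_subset)
qed

lemma shapes_bound:
  assumes "p \<in> shapes d" "i \<ge> d" shows "p i = 0"
proof (rule ccontr)
  assume "p i \<noteq> 0"
  have p: "decreasing p" "fsupp p" "psize p = d" using assms by (auto simp: shapes_def)
  have "j \<le> i \<Longrightarrow> p j \<noteq> 0" for j using dec_antimono[OF p(1), of j i] \<open>p i \<noteq> 0\<close> by linarith
  then have "(\<Sum>j\<le>i. 1) \<le> (\<Sum>j\<le>i. p j)" by (intro sum_mono) (simp add: Suc_leI)
  also have "\<dots> \<le> psize p" unfolding psize_def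
    using p(2) \<open>\<And>j. j \<le> i \<Longrightarrow> p j \<noteq> 0\<close> by (intro sum_mono2) (auto simp: fsupp_def)
  finally show False using p(3) assms(2) by simp
qed

lemma finite_shapes: "finite (shapes d)"
proof (rule finite_subset)
  show "shapes d \<subseteq> {p. \<forall>i. p i \<le> (if i < d then d else 0)}"
  proof clarify
    fix p i assume p: "p \<in> shapes d"
    have "p i \<le> d" if "i < d"
    proof (cases "p i = 0")
      case False
      then have "p i \<le> psize p" unfolding psize_def using p by (intro member_le_sum) (auto simp: shapes_def fsupp_def)
      then show ?thesis using p by (simp add: shapes_def)
    qed simp
    then show "p i \<le> (if i < d then d else 0)" using shapes_bound[OF p, of i] by auto
  qed
  show "finite {p. \<forall>i. p i \<le> (if i < d then d else 0)}"
    using finite_below[OF fsupp_bounded[of d "\<lambda>i. if i < d then d else 0"]] by simp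
qed

lemma psize_eq_0:
  assumes "fsupp p" "psize p = 0" shows "p = (\<lambda>_. 0)"
proof (rule ext)
  fix i
  obtain n where n: "\<And>i. i \<ge> n \<Longrightarrow> p i = 0" using fsupp_bound[OF assms(1)] by metis
  have "psize p = (\<Sum>i<n. p i)" by (rule psize_bounded) (rule n)
  then have "i < n \<Longrightarrow> p i = 0" using assms(2) by simp
  then show "p i = 0" using n by (meson not_le)
qed

lemma kos_cong: "(\<And>i. i < N \<Longrightarrow> \<mu> i = \<mu>' i) \<Longrightarrow> kostka N \<mu> p = kostka N \<mu>' p"
proof (induct N arbitrary: p)
  case (Suc N)
  have "kostka N \<mu> q = kostka N \<mu>' q" for q by (rule Suc.hyps) (simp add: Suc.prems)
  moreover have "\<mu> N = \<mu>' N" by (simp add: Suc.prems)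
  ultimately show ?case by simp
qed simp

lemma kos_nonzero:
  assumes "kostka N \<mu> p \<noteq> 0" shows "decreasing p" "\<And>i. i \<ge> N \<Longrightarrow> p i = 0" "psize p = (\<Sum>i<N. \<mu> i)"
proof -
  have "decreasing p \<and> (\<forall>i\<ge>N. p i = 0) \<and> psize p = (\<Sum>i<N. \<mu> i)" using assms
  proof (induct N arbitrary: p)
    case 0
    then show ?case by (auto simp: decreasing_def psize_def)
  next
    case (Suc N)
    then have "\<exists>q\<in>{q. interlace q p \<and> psize p = psize q + \<mu> N}. kostka N \<mu> q \<noteq> 0"
      by (metis (no_types, lifting) kostka.simps(2) sum.neutral)
    then obtain q where q: "interlace q p" "psize p = psize q + \<mu> N" "kostka N \<mu> q \<noteq> 0" by blast
    have *: "decreasing q \<and> (\<forall>i\<ge>N. q i = 0) \<and> psize q = (\<Sum>i<N. \<mu> i)" using Suc.hyps q(3) by blast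
    have "p i = 0" if "i \<ge> Suc N" for i
    proof -
      obtain j where "i = Suc j" "N \<le> j" using \<open>i \<ge> Suc N\<close> by (cases i) auto
      moreover from this have "q j = 0" using * by simp
      moreover have "p (Suc j) \<le> q j" using q(1) by (simp add: interlace_def)
      ultimately show ?thesis by simp
    qed
    then show ?case using interlace_dec[OF q(1)] q(2) * by simp
  qed
  then show "decreasing p" "\<And>i. i \<ge> N \<Longrightarrow> p i = 0" "psize p = (\<Sum>i<N. \<mu> i)" by auto
qed

lemma kos_shapes: "kostka N \<mu> p \<noteq> 0 \<Longrightarrow> p \<in> shapes (\<Sum>i<N. \<mu> i)"
  using kos_nonzero[of N \<mu> p] fsupp_bounded[of N p] by (auto simp: shapes_def)

section \<open>Growth diagrams and the number of words\<close>

text \<open>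
  The local rule of growth diagrams.  If \<open>interlace \<kappa> \<nu>\<close>, removing a box in row \<open>i\<close> of \<open>\<kappa>\<close> corresponds
  to adding one in row \<open>i + 1\<close> of \<open>\<nu>\<close>, and row \<open>0\<close> is the extra one; otherwise both sides have to repair
  the same defect, in the same row.
\<close>

lemma local_rule:
  assumes \<kappa>: "decreasing \<kappa>" "fsupp \<kappa>" and \<nu>: "decreasing \<nu>" "fsupp \<nu>"
  shows "card {i. addable \<nu> i \<and> interlace \<kappa> (up i \<nu>)} =
     card {i. removable \<kappa> i \<and> interlace (down i \<kappa>) \<nu>} + of_bool (interlace \<kappa> \<nu>)"
proof (cases "interlace \<kappa> \<nu>")
  case True
  then have le: "\<kappa> i \<le> \<nu> i" "\<nu> (Suc i) \<le> \<kappa> i" for i by (auto simp: interlace_def)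
  \<comment> \<open>Both sides of the correspondence reduce to the same inequality, namely that row
    \<open>i + 1\<close> of \<open>\<nu>\<close> is strictly shorter than row \<open>i\<close> of
    \<open>\<kappa>\<close>.\<close>
  have A: "addable \<nu> (Suc i) \<and> interlace \<kappa> (up (Suc i) \<nu>) \<longleftrightarrow> \<nu> (Suc i) < \<kappa> i" for i
    using le by (auto simp: addable_def interlace_def Suc_le_eq intro: le_SucI less_le_trans)
  have B: "removable \<kappa> i \<and> interlace (down i \<kappa>) \<nu> \<longleftrightarrow> \<nu> (Suc i) < \<kappa> i" for i
  proof
    assume "removable \<kappa> i \<and> interlace (down i \<kappa>) \<nu>"
    then have "\<nu> (Suc i) \<le> \<kappa> i - 1" "0 < \<kappa> i" unfolding interlace_def removable_def
      by (metis fun_upd_same, linarith)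
    then show "\<nu> (Suc i) < \<kappa> i" by linarith
  next
    assume "\<nu> (Suc i) < \<kappa> i"
    then show "removable \<kappa> i \<and> interlace (down i \<kappa>) \<nu>"
      using le unfolding interlace_def removable_def
      by (auto intro: le_less_trans le_trans[OF diff_le_self])
  qed
  have "{i. addable \<nu> i \<and> interlace \<kappa> (up i \<nu>)} = insert 0 (Suc ` {i. removable \<kappa> i \<and> interlace (down i \<kappa>) \<nu>})"
  proof (intro set_eqI)
    fix i
    have "addable \<nu> 0 \<and> interlace \<kappa> (up 0 \<nu>)" using le by (auto simp: addable_def interlace_def intro: le_SucI)
    then show "i \<in> {i. addable \<nu> i \<and> interlace \<kappa> (up i \<nu>)} \<longleftrightarrow>
        i \<in> insert 0 (Suc ` {i. removable \<kappa> i \<and> interlace (down i \<kappa>) \<nu>})"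
      by (cases i) (simp_all only: A B mem_Collect_eq insert_iff image_iff, auto)
  qed
  moreover have "finite {i. removable \<kappa> i \<and> interlace (down i \<kappa>) \<nu>}"
    using finite_removable[OF \<kappa>(2)] by (rule rev_finite_subset) auto
  ultimately show ?thesis using True by (simp add: card_image)
next
  case False
  have *: "(addable \<nu> i \<and> interlace \<kappa> (up i \<nu>)) = (removable \<kappa> i \<and> interlace (down i \<kappa>) \<nu>)" for i
  proof (rule iffI)
    assume a: "addable \<nu> i \<and> interlace \<kappa> (up i \<nu>)"
    then have 1: "\<kappa> j \<le> \<nu> j" if "j \<noteq> i" for j using that unfolding interlace_def by (metis fun_upd_other)
    have 2: "\<nu> (Suc j) \<le> \<kappa> j" for j using a unfolding interlace_def
      by (cases "Suc j = i") (metis Suc_leD fun_upd_same, metis fun_upd_other)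
    have 3: "\<kappa> i \<le> Suc (\<nu> i)" using a unfolding interlace_def by (metis fun_upd_same)
    \<comment> \<open>The new box has to repair a defect of \<open>interlace \<kappa> \<nu>\<close>,
      and the only defect that it can repair is that row \<open>i\<close> of \<open>\<kappa>\<close>
      is too long by exactly one.\<close>
    have 4: "\<kappa> i = Suc (\<nu> i)"
    proof (rule ccontr)
      assume "\<kappa> i \<noteq> Suc (\<nu> i)"
      then have "\<kappa> j \<le> \<nu> j" for j using 1 3 by (cases "j = i") auto
      with 2 False show False by (auto simp: interlace_def)
    qed
    have "\<kappa> (Suc i) \<le> \<nu> i" using 1[of "Suc i"] dec_antimono[OF \<nu>(1), of i "Suc i"] by simp
    then show "removable \<kappa> i \<and> interlace (down i \<kappa>) \<nu>"
      using 1 2 4 dec_antimono[OF \<nu>(1), of i "Suc i"] unfolding removable_def interlace_def by auto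
  next
    assume a: "removable \<kappa> i \<and> interlace (down i \<kappa>) \<nu>"
    then have 0: "0 < \<kappa> i" by (auto simp: removable_def)
    have 1: "\<kappa> j \<le> \<nu> j" if "j \<noteq> i" for j using a that unfolding interlace_def by (metis fun_upd_other)
    have 2: "\<nu> (Suc j) \<le> down i \<kappa> j" for j using a unfolding interlace_def by blast
    then have h2: "\<nu> (Suc j) \<le> \<kappa> j" for j using order_trans[OF 2[of j], of "\<kappa> j"] by simp
    have 3: "\<kappa> i - 1 \<le> \<nu> i" using a unfolding interlace_def by (metis fun_upd_same)
    have 4: "\<kappa> i = Suc (\<nu> i)"
    proof (rule ccontr)
      assume "\<kappa> i \<noteq> Suc (\<nu> i)"
      then have "\<kappa> j \<le> \<nu> j" for j using 1 3 by (cases "j = i") auto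
      with h2 False show False by (auto simp: interlace_def)
    qed
    have 5: "Suc (\<nu> i) \<le> \<kappa> (i - 1) \<and> \<kappa> (i - 1) \<le> \<nu> (i - 1)" if "i \<noteq> 0"
      using 1[of "i - 1"] dec_antimono[OF \<kappa>(1), of "i - 1" i] 4 that by simp
    have "addable \<nu> i" using 5 by (cases "i = 0") (auto simp: addable_def)
    moreover have "\<kappa> j \<le> up i \<nu> j" for j using 1[of j] 4 by simp
    moreover have "up i \<nu> (Suc j) \<le> \<kappa> j" for j using h2[of j] 5 by (cases "Suc j = i") auto
    ultimately show "addable \<nu> i \<and> interlace \<kappa> (up i \<nu>)" by (simp add: interlace_def)
  qed
  have "{i. addable \<nu> i \<and> interlace \<kappa> (up i \<nu>)} = {i. removable \<kappa> i \<and> interlace (down i \<kappa>) \<nu>}" using * by simp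
  with False show ?thesis by simp
qed

lemma addable_bound:
  assumes "addable p i" "\<And>i. i \<ge> n \<Longrightarrow> p i = 0" shows "i \<le> n"
proof (cases i)
  case (Suc j)
  then have "p j \<noteq> 0" using assms(1) by (auto simp: addable_def)
  then have "j < n" using assms(2)[of j] by linarith
  then show ?thesis using Suc by simp
qed simp

text \<open>\<open>local_rule\<close> in summed form: adding a box and removing a strip of
  \<open>m\<close> boxes commute, up to removing a strip of \<open>m - 1\<close> boxes, where the
  new box is absorbed by the strip.\<close>

lemma sum_interlace_swap:
  assumes \<nu>: "decreasing \<nu>" "fsupp \<nu>"
  shows "(\<Sum>i | addable \<nu> i. \<Sum>\<kappa> | interlace \<kappa> (up i \<nu>) \<and> psize (up i \<nu>) = psize \<kappa> + m. h \<kappa>) =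
    (\<Sum>\<rho> | interlace \<rho> \<nu> \<and> psize \<nu> = psize \<rho> + m. \<Sum>i | addable \<rho> i. h (up i \<rho>)) +
    (\<Sum>\<kappa> | interlace \<kappa> \<nu> \<and> Suc (psize \<nu>) = psize \<kappa> + m. h \<kappa> :: nat)"
proof -
  obtain n where n: "\<And>i. i \<ge> n \<Longrightarrow> \<nu> i = 0" using fsupp_bound[OF \<nu>(2)] by metis
  \<comment> \<open>A common bound for all shapes involved: a box can be added only in a row up to
    \<open>n\<close>, and lengthens it by one. It makes the sum over the intermediate shapes
    finite.\<close>
  define g where "g i = (if i \<le> n then Suc (\<nu> i) else 0)" for i
  have g: "fsupp g" by (rule fsupp_bounded[of "Suc n"]) (simp add: g_def)
  have le_g: "\<nu> i \<le> g i" for i using n[of i] by (auto simp: g_def)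
  define G where "G = {\<kappa>. (\<forall>i. \<kappa> i \<le> g i) \<and> decreasing \<kappa> \<and> Suc (psize \<nu>) = psize \<kappa> + m}"
  have finG: "finite G" by (rule finite_subset[OF _ finite_below[OF g]]) (auto simp: G_def)
  have fsG: "fsupp \<kappa>" if "\<kappa> \<in> G" for \<kappa> using that g by (auto simp: G_def intro: fsupp_mono)
  have up_g: "up i \<rho> j \<le> g j" if "addable \<rho> i" "\<And>i. \<rho> i \<le> \<nu> i" for \<rho> i j
  proof -
    have "i \<le> n" 
    proof (rule addable_bound[OF that(1)])
      show "\<rho> i = 0" if "i \<ge> n" for i using \<open>\<And>i. \<rho> i \<le> \<nu> i\<close>[of i] n[OF that] by simp
    qed
    then show ?thesis using that(2)[of i] that(2)[of j] le_g[of j] by (auto simp: g_def)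
  qed
  have 1: "(\<Sum>\<kappa> | interlace \<kappa> (up i \<nu>) \<and> psize (up i \<nu>) = psize \<kappa> + m. h \<kappa>) =
      (\<Sum>\<kappa>\<in>G. if interlace \<kappa> (up i \<nu>) then h \<kappa> else 0)" if "addable \<nu> i" for i
  proof -
    have "{\<kappa>. interlace \<kappa> (up i \<nu>) \<and> psize (up i \<nu>) = psize \<kappa> + m} = {\<kappa>\<in>G. interlace \<kappa> (up i \<nu>)}"
    proof (intro equalityI subsetI CollectI conjI)
      fix \<kappa> assume "\<kappa> \<in> {\<kappa>. interlace \<kappa> (up i \<nu>) \<and> psize (up i \<nu>) = psize \<kappa> + m}"
      then have k: "interlace \<kappa> (up i \<nu>)" "psize (up i \<nu>) = psize \<kappa> + m" by auto
      have "\<kappa> j \<le> g j" for j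
        using k(1) up_g[OF that, of j] unfolding interlace_def by (metis le_refl le_trans)
      then show "\<kappa> \<in> G" using interlace_dec[OF k(1)] k(2) psize_up[OF \<nu>(2), of i] by (simp add: G_def)
      show "interlace \<kappa> (up i \<nu>)" by fact
    next
      fix \<kappa> assume k: "\<kappa> \<in> {\<kappa> \<in> G. interlace \<kappa> (up i \<nu>)}"
      then show "interlace \<kappa> (up i \<nu>)" by blast
      show "psize (up i \<nu>) = psize \<kappa> + m" using k psize_up[OF \<nu>(2), of i] by (simp add: G_def)
    qed
    then show ?thesis using finG by (simp add: sum.inter_filter)
  qed
  let ?B = "\<lambda>\<kappa>. {i. removable \<kappa> i \<and> interlace (down i \<kappa>) \<nu>}"
  have finB: "finite (?B \<kappa>)" if "\<kappa> \<in> G" for \<kappa>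
    using finite_removable[OF fsG[OF that]] by (rule rev_finite_subset) auto
  have finA: "finite {i. addable \<nu> i}" by (rule finite_addable[OF \<nu>(2)])
  have "(\<Sum>i | addable \<nu> i. \<Sum>\<kappa> | interlace \<kappa> (up i \<nu>) \<and> psize (up i \<nu>) = psize \<kappa> + m. h \<kappa>) =
      (\<Sum>i | addable \<nu> i. \<Sum>\<kappa>\<in>G. if interlace \<kappa> (up i \<nu>) then h \<kappa> else 0)"
    by (rule sum.cong) (auto simp: 1)
  also have "\<dots> = (\<Sum>\<kappa>\<in>G. \<Sum>i | addable \<nu> i. if interlace \<kappa> (up i \<nu>) then h \<kappa> else 0)"
    by (rule sum.swap)
  also have "\<dots> = (\<Sum>\<kappa>\<in>G. card {i. addable \<nu> i \<and> interlace \<kappa> (up i \<nu>)} * h \<kappa>)"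
    using finA by (intro sum.cong refl) (simp flip: sum.inter_filter)
  also have "\<dots> = (\<Sum>\<kappa>\<in>G. card (?B \<kappa>) * h \<kappa> + of_bool (interlace \<kappa> \<nu>) * h \<kappa>)"
    using local_rule[OF _ fsG \<nu>] by (intro sum.cong refl) (simp add: G_def algebra_simps)
  also have "\<dots> = (\<Sum>\<kappa>\<in>G. \<Sum>i\<in>?B \<kappa>. h \<kappa>) + (\<Sum>\<kappa>\<in>G. if interlace \<kappa> \<nu> then h \<kappa> else 0)"
    by (simp add: sum.distrib) (intro sum.cong, auto)
  also have "(\<Sum>\<kappa>\<in>G. if interlace \<kappa> \<nu> then h \<kappa> else 0) =
      (\<Sum>\<kappa> | interlace \<kappa> \<nu> \<and> Suc (psize \<nu>) = psize \<kappa> + m. h \<kappa>)"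
  proof -
    have "{\<kappa>. interlace \<kappa> \<nu> \<and> Suc (psize \<nu>) = psize \<kappa> + m} = {\<kappa>\<in>G. interlace \<kappa> \<nu>}"
    proof (intro equalityI subsetI CollectI conjI)
      fix \<kappa> assume "\<kappa> \<in> {\<kappa>. interlace \<kappa> \<nu> \<and> Suc (psize \<nu>) = psize \<kappa> + m}"
      then have k: "interlace \<kappa> \<nu>" "Suc (psize \<nu>) = psize \<kappa> + m" by auto
      have "\<kappa> j \<le> g j" for j
        using k(1) le_g[of j] unfolding interlace_def by (metis le_trans)
      then show "\<kappa> \<in> G" using interlace_dec[OF k(1)] k(2) by (simp add: G_def)
      show "interlace \<kappa> \<nu>" by fact
    next
      fix \<kappa> assume k: "\<kappa> \<in> {\<kappa> \<in> G. interlace \<kappa> \<nu>}"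
      then show "interlace \<kappa> \<nu>" "Suc (psize \<nu>) = psize \<kappa> + m" by (auto simp: G_def)
    qed
    then show ?thesis using finG by (simp add: sum.inter_filter)
  qed
  also have "(\<Sum>\<kappa>\<in>G. \<Sum>i\<in>?B \<kappa>. h \<kappa>) =
      (\<Sum>\<rho> | interlace \<rho> \<nu> \<and> psize \<nu> = psize \<rho> + m. \<Sum>i | addable \<rho> i. h (up i \<rho>))"
  proof -
    let ?R = "{\<rho>. interlace \<rho> \<nu> \<and> psize \<nu> = psize \<rho> + m}"
    have finR: "finite ?R"
      by (rule finite_subset[OF _ finite_below[OF \<nu>(2)]]) (auto simp: interlace_def)
    have fsR: "fsupp \<rho>" if "\<rho> \<in> ?R" for \<rho> using that interlace_fsupp \<nu>(2) by blast
    have "(\<Sum>\<kappa>\<in>G. \<Sum>i\<in>?B \<kappa>. h \<kappa>) = (\<Sum>(\<kappa>, i)\<in>Sigma G ?B. h \<kappa>)"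
      using finG finB by (subst sum.Sigma) auto
    also have "\<dots> = (\<Sum>(\<rho>, i)\<in>Sigma ?R (\<lambda>\<rho>. {i. addable \<rho> i}). h (up i \<rho>))"
    proof (rule sum.reindex_bij_witness[where i="\<lambda>(\<rho>, i). (up i \<rho>, i)" and j="\<lambda>(\<kappa>, i). (down i \<kappa>, i)"])
      fix a assume a: "a \<in> Sigma G ?B"
      obtain \<kappa> i where ai: "a = (\<kappa>, i)" by (cases a)
      have k: "\<kappa> \<in> G" "removable \<kappa> i" "interlace (down i \<kappa>) \<nu>" using a ai by auto
      then have pos: "\<kappa> i > 0" by (auto simp: removable_def)
      show "(case case a of (\<kappa>, i) \<Rightarrow> (down i \<kappa>, i) of (\<rho>, i) \<Rightarrow> (up i \<rho>, i)) = a"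
        using pos by (simp add: ai)
      have "psize \<nu> = psize (down i \<kappa>) + m"
        using psize_down[OF fsG[OF k(1)] pos] k(1) by (simp add: G_def)
      then show "(case a of (\<kappa>, i) \<Rightarrow> (down i \<kappa>, i)) \<in> Sigma ?R (\<lambda>\<rho>. {i. addable \<rho> i})"
        using k addable_down[of \<kappa> i] by (simp add: ai G_def)
      show "(case case a of (\<kappa>, i) \<Rightarrow> (down i \<kappa>, i) of (\<rho>, i) \<Rightarrow> h (up i \<rho>)) = (case a of (\<kappa>, i) \<Rightarrow> h \<kappa>)"
        using pos by (simp add: ai)
    next
      fix b assume b: "b \<in> Sigma ?R (\<lambda>\<rho>. {i. addable \<rho> i})"
      obtain \<rho> i where bi: "b = (\<rho>, i)" by (cases b)
      have r: "interlace \<rho> \<nu>" "psize \<nu> = psize \<rho> + m" "addable \<rho> i" using b bi by auto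
      show "(case case b of (\<rho>, i) \<Rightarrow> (up i \<rho>, i) of (\<kappa>, i) \<Rightarrow> (down i \<kappa>, i)) = b" by (simp add: bi)
      have d: "decreasing \<rho>" using r(1) interlace_dec by blast
      have "up i \<rho> \<in> G"
        using up_g[OF r(3)] r dec_up[OF d r(3)] psize_up[OF fsR, of \<rho> i]
        by (auto simp: G_def interlace_def)
      then show "(case b of (\<rho>, i) \<Rightarrow> (up i \<rho>, i)) \<in> Sigma G ?B"
        using r removable_up[OF d, of i] by (simp add: bi)
    qed
    also have "\<dots> = (\<Sum>\<rho>\<in>?R. \<Sum>i | addable \<rho> i. h (up i \<rho>))"
      using finR finite_addable fsR by (subst sum.Sigma) auto
    finally show ?thesis .
  qed
  finally show ?thesis .
qed

text \<open>The added box is pushed through the strips, the last one first. Exactly one of them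
  absorbs it, and the content of that strip drops by one.\<close>

lemma kos_add:
  assumes "decreasing \<nu>" "fsupp \<nu>"
  shows "(\<Sum>i | addable \<nu> i. kostka N \<mu> (up i \<nu>)) = (\<Sum>j | j < N \<and> 0 < \<mu> j. kostka N (down j \<mu>) \<nu>)"
  using assms
proof (induct N arbitrary: \<nu>)
  case 0
  have "up i \<nu> \<noteq> (\<lambda>_. 0)" for i by (metis fun_upd_same nat.distinct(1))
  then have "kostka 0 \<mu> (up i \<nu>) = 0" for i by (simp only: kostka.simps of_bool_def if_False)
  then have "(\<Sum>i | addable \<nu> i. kostka 0 \<mu> (up i \<nu>)) = 0" by (simp only: sum.neutral_const)
  moreover have "(\<Sum>j | j < 0 \<and> 0 < \<mu> j. kostka 0 (down j \<mu>) \<nu>) = 0" by simp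
  ultimately show ?case by (simp only:)
next
  case (Suc N)
  let ?R = "{\<rho>. interlace \<rho> \<nu> \<and> psize \<nu> = psize \<rho> + \<mu> N}"
  let ?J = "{j. j < N \<and> 0 < \<mu> j}"
  have "(\<Sum>i | addable \<nu> i. kostka (Suc N) \<mu> (up i \<nu>)) =
     (\<Sum>\<rho>\<in>?R. \<Sum>i | addable \<rho> i. kostka N \<mu> (up i \<rho>)) +
     (\<Sum>\<kappa> | interlace \<kappa> \<nu> \<and> Suc (psize \<nu>) = psize \<kappa> + \<mu> N. kostka N \<mu> \<kappa>)"
    by (simp only: kostka.simps sum_interlace_swap[OF Suc.prems])
  also have "(\<Sum>\<rho>\<in>?R. \<Sum>i | addable \<rho> i. kostka N \<mu> (up i \<rho>)) = (\<Sum>\<rho>\<in>?R. \<Sum>j\<in>?J. kostka N (down j \<mu>) \<rho>)"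
    using interlace_dec interlace_fsupp Suc.prems by (intro sum.cong refl Suc.hyps) auto
  also have "\<dots> = (\<Sum>j\<in>?J. \<Sum>\<rho>\<in>?R. kostka N (down j \<mu>) \<rho>)" by (rule sum.swap)
  also have "\<dots> = (\<Sum>j\<in>?J. kostka (Suc N) (down j \<mu>) \<nu>)" by (intro sum.cong refl) simp
  \<comment> \<open>The case in which the last strip absorbs the box; it supplies the summand
    \<open>j = N\<close>.\<close>
  also have "(\<Sum>\<kappa> | interlace \<kappa> \<nu> \<and> Suc (psize \<nu>) = psize \<kappa> + \<mu> N. kostka N \<mu> \<kappa>) =
      (\<Sum>j | j = N \<and> 0 < \<mu> j. kostka (Suc N) (down j \<mu>) \<nu>)"
  proof (cases "\<mu> N")
    case 0
    have False if "interlace \<kappa> \<nu>" "Suc (psize \<nu>) = psize \<kappa> + \<mu> N" for \<kappa>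
      using psize_mono[OF Suc.prems(2), of \<kappa>] that 0 by (auto simp: interlace_def)
    then have E: "{\<kappa>. interlace \<kappa> \<nu> \<and> Suc (psize \<nu>) = psize \<kappa> + \<mu> N} = {}" by blast
    have E': "{j. j = N \<and> 0 < \<mu> j} = {}" using 0 by auto
    show ?thesis unfolding E E' by simp
  next
    case (Suc m)
    have "kostka N (down N \<mu>) \<kappa> = kostka N \<mu> \<kappa>" for \<kappa> by (rule kos_cong) simp
    moreover have "{j. j = N \<and> 0 < \<mu> j} = {N}" using Suc by auto
    ultimately show ?thesis using Suc by simp
  qed
  also have "(\<Sum>j\<in>?J. kostka (Suc N) (down j \<mu>) \<nu>) + (\<Sum>j | j = N \<and> 0 < \<mu> j. kostka (Suc N) (down j \<mu>) \<nu>) =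
      (\<Sum>j | j < Suc N \<and> 0 < \<mu> j. kostka (Suc N) (down j \<mu>) \<nu>)"
    by (subst sum.union_disjoint[symmetric]) (auto intro!: sum.cong simp: less_Suc_eq)
  finally show ?case .
qed

text \<open>Both sides sum over the edges of Young's lattice between sizes \<open>d\<close> and
  \<open>d + 1\<close>.\<close>

lemma sum_shapes_Suc:
  "(\<Sum>p\<in>shapes (Suc d). \<Sum>i | removable p i. h (down i p) p) =
   (\<Sum>q\<in>shapes d. \<Sum>i | addable q i. h q (up i q) :: nat)"
proof -
  have "(\<Sum>p\<in>shapes (Suc d). \<Sum>i | removable p i. h (down i p) p) =
      (\<Sum>(p, i)\<in>Sigma (shapes (Suc d)) (\<lambda>p. {i. removable p i}). h (down i p) p)"
    using finite_shapes finite_removable by (subst sum.Sigma) (auto simp: shapes_def)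
  also have "\<dots> = (\<Sum>(q, i)\<in>Sigma (shapes d) (\<lambda>q. {i. addable q i}). h q (up i q))"
  proof (rule sum.reindex_bij_witness[where i="\<lambda>(q, i). (up i q, i)" and j="\<lambda>(p, i). (down i p, i)"])
    fix a assume a: "a \<in> Sigma (shapes (Suc d)) (\<lambda>p. {i. removable p i})"
    obtain p i where ai: "a = (p, i)" by (cases a)
    have k: "p \<in> shapes (Suc d)" "removable p i" using a ai by auto
    then have pos: "p i > 0" by (auto simp: removable_def)
    show "(case case a of (\<kappa>, i) \<Rightarrow> (down i \<kappa>, i) of (\<rho>, i) \<Rightarrow> (up i \<rho>, i)) = a"
      using pos by (simp add: ai)
    show "(case a of (p, i) \<Rightarrow> (down i p, i)) \<in> Sigma (shapes d) (\<lambda>q. {i. addable q i})"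
      using k dec_down[of p i] psize_down[of p i] pos addable_down[of p i] by (auto simp: ai shapes_def)
    show "(case case a of (p, i) \<Rightarrow> (down i p, i) of (q, i) \<Rightarrow> h q (up i q)) = (case a of (p, i) \<Rightarrow> h (down i p) p)"
      using pos by (simp add: ai)
  next
    fix b assume b: "b \<in> Sigma (shapes d) (\<lambda>q. {i. addable q i})"
    obtain q i where bi: "b = (q, i)" by (cases b)
    have r: "q \<in> shapes d" "addable q i" using b bi by auto
    show "(case case b of (\<rho>, i) \<Rightarrow> (up i \<rho>, i) of (\<kappa>, i) \<Rightarrow> (down i \<kappa>, i)) = b" by (simp add: bi)
    show "(case b of (q, i) \<Rightarrow> (up i q, i)) \<in> Sigma (shapes (Suc d)) (\<lambda>p. {i. removable p i})"
      using r dec_up[of q i] psize_up[of q i] removable_up[of q i] by (auto simp: bi shapes_def)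
  qed
  also have "\<dots> = (\<Sum>q\<in>shapes d. \<Sum>i | addable q i. h q (up i q))"
    using finite_shapes finite_addable by (subst sum.Sigma) (auto simp: shapes_def)
  finally show ?thesis .
qed

abbreviation iw :: "(nat \<Rightarrow> nat) \<Rightarrow> nat \<Rightarrow> int" where
  "iw \<mu> \<equiv> (\<lambda>j. int (\<mu> j))"

lemma words_of_Cons:
  assumes "\<And>i. i \<ge> N \<Longrightarrow> \<mu> i = 0" "(\<Sum>i<N. \<mu> i) = Suc d"
  shows "card (words (iw \<mu>)) = (\<Sum>j | j < N \<and> 0 < \<mu> j. card (words (iw (down j \<mu>))))"
proof -
  let ?J = "{j. j < N \<and> 0 < \<mu> j}"
  have U: "words (iw \<mu>) = (\<Union>j\<in>?J. Cons j ` words (iw (down j \<mu>)))"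
  proof (intro equalityI subsetI)
    fix u assume "u \<in> words (iw \<mu>)"
    then have u: "count (mset u) j = \<mu> j" for j by (auto simp: words_def content_def fun_eq_iff)
    have "u \<noteq> []" using u assms(2) by (auto simp: sum_eq_0_iff)
    then obtain j v where uv: "u = j # v" by (cases u) auto
    have "\<mu> j > 0" using u[of j] uv by simp
    moreover have "j < N" using assms(1)[of j] \<open>\<mu> j > 0\<close> by (metis leI less_numeral_extra(3))
    moreover have "v \<in> words (iw (down j \<mu>))"
    proof -
      have "count (mset v) i = down j \<mu> i" for i using u[of i] uv by (cases "i = j") auto
      then show ?thesis unfolding words_def content_def by simp
    qed
    ultimately show "u \<in> (\<Union>j\<in>?J. Cons j ` words (iw (down j \<mu>)))" using uv by blast
  next
    fix u assume "u \<in> (\<Union>j\<in>?J. Cons j ` words (iw (down j \<mu>)))"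
    then obtain j v where jv: "u = j # v" "0 < \<mu> j" "content v = iw (down j \<mu>)" by (auto simp: words_def)
    have "int (count (mset u) i) = int (\<mu> i)" for i
      using fun_cong[OF jv(3), of i] jv(1,2) by (cases "i = j") (auto simp: content_def)
    then show "u \<in> words (iw \<mu>)" by (simp add: words_def content_def)
  qed
  have "card (words (iw \<mu>)) = (\<Sum>j\<in>?J. card (Cons j ` words (iw (down j \<mu>))))"
    unfolding U
  proof (rule card_UN_disjoint)
    show "\<forall>i\<in>?J. \<forall>j\<in>?J. i \<noteq> j \<longrightarrow> Cons i ` words (iw (down i \<mu>)) \<inter> Cons j ` words (iw (down j \<mu>)) = {}"
      by (intro ballI impI equals0I) (simp only: image_iff Int_iff, metis list.inject)
    show "finite ?J" by simp
    show "\<forall>j\<in>?J. finite (Cons j ` words (iw (down j \<mu>)))" by (simp only: finite_words_of finite_imageI simp_thms ball_triv)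
  qed
  also have "\<dots> = (\<Sum>j\<in>?J. card (words (iw (down j \<mu>))))"
  proof (rule sum.cong[OF refl])
    show "card (Cons j ` words (iw (down j \<mu>))) = card (words (iw (down j \<mu>)))" for j
      by (rule card_image) (rule inj_onI, simp only: list.inject)
  qed
  finally show ?thesis .
qed

lemma kos_zero: "(\<And>i. i < N \<Longrightarrow> \<mu> i = 0) \<Longrightarrow> kostka N \<mu> (\<lambda>_. 0) = 1"
proof (induct N)
  case (Suc N)
  have "{q. interlace q (\<lambda>_. 0) \<and> psize (\<lambda>_. 0) = psize q + \<mu> N} = {\<lambda>_. 0}"
  proof (intro equalityI subsetI)
    fix q assume "q \<in> {q. interlace q (\<lambda>_. 0) \<and> psize (\<lambda>_. 0) = psize q + \<mu> N}"
    then have "q i = 0" for i by (simp add: interlace_def)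
    then have "q = (\<lambda>_. 0)" by (rule ext)
    then show "q \<in> {\<lambda>_. 0}" by blast
  next
    fix q :: "nat \<Rightarrow> nat" assume "q \<in> {\<lambda>_. 0}"
    then show "q \<in> {q. interlace q (\<lambda>_. 0) \<and> psize (\<lambda>_. 0) = psize q + \<mu> N}"
      using Suc.prems[of N] by (simp add: interlace_def)
  qed
  then show ?case using Suc by simp
qed simp

lemma shapes_0: "shapes 0 = {\<lambda>_. 0}"
proof (intro equalityI subsetI)
  fix p assume "p \<in> shapes 0"
  then show "p \<in> {\<lambda>_. 0}" using psize_eq_0[of p] by (simp add: shapes_def)
next
  fix p :: "nat \<Rightarrow> nat" assume "p \<in> {\<lambda>_. 0}"
  then show "p \<in> shapes 0" by (simp add: shapes_def decreasing_def fsupp_def psize_def)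
qed

text \<open>The enumerative content of the Robinson--Schensted--Knuth correspondence. Both sides
  obey the same recursion in removing one letter: \<open>kos_add\<close> for the pairs of tableaux,
  \<open>words_of_Cons\<close> for the words.\<close>

lemma paths_kos_sum:
  assumes "\<And>i. i \<ge> N \<Longrightarrow> \<mu> i = 0" "(\<Sum>i<N. \<mu> i) = d"
  shows "(\<Sum>p\<in>shapes d. paths d p * kostka N \<mu> p) = card (words (iw \<mu>))"
  using assms
proof (induct d arbitrary: \<mu>)
  case 0
  have z: "\<mu> = (\<lambda>_. 0)"
  proof
    fix i show "\<mu> i = 0" using 0 by (cases "i < N") auto
  qed
  have "words (iw \<mu>) = {[]}"
    by (auto simp: words_def content_def z fun_eq_iff)
  then show ?case using kos_zero[of N \<mu>] by (simp add: shapes_0 z)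
next
  case (Suc d)
  let ?J = "{j. j < N \<and> 0 < \<mu> j}"
  have "(\<Sum>p\<in>shapes (Suc d). paths (Suc d) p * kostka N \<mu> p) =
      (\<Sum>p\<in>shapes (Suc d). \<Sum>i | removable p i. paths d (down i p) * kostka N \<mu> p)"
    by (simp add: sum_distrib_right)
  also have "\<dots> = (\<Sum>q\<in>shapes d. \<Sum>i | addable q i. paths d q * kostka N \<mu> (up i q))"
    by (rule sum_shapes_Suc)
  also have "\<dots> = (\<Sum>q\<in>shapes d. \<Sum>j\<in>?J. paths d q * kostka N (down j \<mu>) q)"
  proof (rule sum.cong[OF refl])
    fix q assume "q \<in> shapes d"
    then have "decreasing q" "fsupp q" by (auto simp: shapes_def)
    from kos_add[OF this, of N \<mu>]
    show "(\<Sum>i | addable q i. paths d q * kostka N \<mu> (up i q)) = (\<Sum>j\<in>?J. paths d q * kostka N (down j \<mu>) q)"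
      by (simp only: sum_distrib_left[symmetric])
  qed
  also have "\<dots> = (\<Sum>j\<in>?J. \<Sum>q\<in>shapes d. paths d q * kostka N (down j \<mu>) q)" by (rule sum.swap)
  also have "\<dots> = (\<Sum>j\<in>?J. card (words (iw (down j \<mu>))))"
  proof (intro sum.cong refl Suc.hyps)
    fix j assume j: "j \<in> ?J"
    have "(\<Sum>i<N. \<mu> i) = (\<Sum>i<N. down j \<mu> i + (if i = j then 1 else 0))"
      using j by (intro sum.cong) auto
    also have "\<dots> = Suc (\<Sum>i<N. down j \<mu> i)" using j by (simp add: sum.distrib)
    finally show "(\<Sum>i<N. down j \<mu> i) = d" using Suc.prems(2) by simp
  qed (use Suc.prems in auto)
  also have "\<dots> = card (words (iw \<mu>))" using words_of_Cons[OF Suc.prems] by simp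
  finally show ?case .
qed

section \<open>Characters of weight modules\<close>

definition highest :: "((nat \<Rightarrow> int) \<Rightarrow> real tensor set) \<Rightarrow> (nat \<Rightarrow> int) \<Rightarrow> real tensor set" where
  "highest W \<mu> = {u \<in> W \<mu>. \<forall>i l. i < l \<longrightarrow> der i l u = 0}"

lemma subspace_hwv: "weight_module W \<Longrightarrow> subspace (highest W \<mu>)"
  using weight_moduleD(1)[of W \<mu>]
  by (auto simp: highest_def real_vector.subspace_def der_add der_scale)

lemma weight_module_wspace: "weight_module weight_space"
  using subspace_weight_space der_wspace by (auto simp: weight_module_def)

text \<open>The weight after \<open>k\<close> branching steps: the letters below \<open>k\<close>
  have been raised to the rows of \<open>\<nu>\<close>, the others still have their content
  \<open>\<mu>\<close>.\<close>

definition join :: "nat \<Rightarrow> (nat \<Rightarrow> nat) \<Rightarrow> (nat \<Rightarrow> nat) \<Rightarrow> nat \<Rightarrow> int" where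
  "join k \<nu> \<mu> = (\<lambda>i. int (if i < k then \<nu> i else \<mu> i))"

text \<open>A finite range for the sums below. It also contains functions that are not decreasing;
  they drop out because \<open>kostka\<close> vanishes on them.\<close>

definition rows :: "nat \<Rightarrow> (nat \<Rightarrow> nat) \<Rightarrow> (nat \<Rightarrow> nat) set" where
  "rows k \<mu> = {\<nu>. (\<forall>i\<ge>k. \<nu> i = 0) \<and> psize \<nu> = (\<Sum>i<k. \<mu> i)}"

lemma finite_rows: "finite (rows k \<mu>)"
proof (rule finite_subset)
  let ?g = "\<lambda>i. if i < k then \<Sum>i<k. \<mu> i else 0"
  show "rows k \<mu> \<subseteq> {\<nu>. \<forall>i. \<nu> i \<le> ?g i}"
  proof (intro subsetI CollectI allI)
    fix \<nu> i assume "\<nu> \<in> rows k \<mu>"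
    then have \<nu>: "\<And>i. i \<ge> k \<Longrightarrow> \<nu> i = 0" "psize \<nu> = (\<Sum>i<k. \<mu> i)" by (auto simp: rows_def)
    have "psize \<nu> = (\<Sum>i<k. \<nu> i)" by (rule psize_bounded) (rule \<nu>(1))
    moreover have "\<nu> i \<le> (\<Sum>i<k. \<nu> i)" if "i < k" using that by (intro member_le_sum) auto
    ultimately show "\<nu> i \<le> ?g i" using \<nu> by (cases "i < k") auto
  qed
  show "finite {\<nu>. \<forall>i. \<nu> i \<le> ?g i}"
    by (rule finite_below, rule fsupp_bounded[of k]) simp
qed

lemma dim_hwk_step:
  assumes W: "weight_module W" and \<nu>: "\<nu> \<in> rows k \<mu>"
  shows "dim (highest_below k W (join k \<nu> \<mu>)) \<le>
    (\<Sum>p | p \<in> rows (Suc k) \<mu> \<and> interlace \<nu> p \<and> psize p = psize \<nu> + \<mu> k. dim (highest_below (Suc k) W (join (Suc k) p \<mu>)))"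
    (is "_ \<le> (\<Sum>p\<in>?P. ?D p)")
proof -
  let ?\<kappa> = "join k \<nu> \<mu>"
  let ?L = "{l. (\<forall>i>k. l i = ?\<kappa> i) \<and> (\<forall>i<k. l (Suc i) \<le> ?\<kappa> i \<and> ?\<kappa> i \<le> l i) \<and> 0 \<le> l k \<and>
     (\<Sum>i\<le>k. l i) = (\<Sum>i\<le>k. ?\<kappa> i)}"
  let ?j = "\<lambda>p. join (Suc k) p \<mu>"
  have pos: "0 \<le> ?\<kappa> i" for i by (simp add: join_def)
  have \<nu>0: "\<nu> i = 0" if "i \<ge> k" for i using \<nu> that by (simp add: rows_def)
  have \<nu>s: "psize \<nu> = (\<Sum>i<k. \<nu> i)" by (rule psize_bounded) (rule \<nu>0)
  have finP: "finite ?P" by (rule finite_subset[OF _ finite_rows]) blast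
  have "?L \<subseteq> ?j ` ?P"
  proof
    fix l assume l: "l \<in> ?L"
    define p where "p = (\<lambda>i. if i \<le> k then nat (l i) else 0)"
    have lp: "l i = int (p i)" if "i \<le> k" for i
    proof -
      have "0 \<le> l i"
      proof (cases "i = k")
        case False
        then have "?\<kappa> i \<le> l i" using l that by simp
        then show ?thesis using pos[of i] by linarith
      qed (use l in simp)
      then show ?thesis using that by (simp add: p_def)
    qed
    have eq: "l = ?j p"
    proof
      fix i show "l i = ?j p i"
        using l lp[of i] by (cases "i \<le> k") (auto simp: join_def less_Suc_eq_le)
    qed
    have p0: "p i = 0" if "i \<ge> Suc k" for i using that by (simp add: p_def)
    have "psize p = (\<Sum>i<Suc k. p i)" by (rule psize_bounded) (rule p0)
    then have "int (psize p) = (\<Sum>i\<le>k. int (p i))" by (simp add: lessThan_Suc_atMost)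
    also have "\<dots> = (\<Sum>i\<le>k. l i)" using lp by (intro sum.cong) auto
    also have "\<dots> = (\<Sum>i\<le>k. ?\<kappa> i)" using l by blast
    also have "\<dots> = int (psize \<nu> + \<mu> k)"
      unfolding \<nu>s by (simp add: join_def flip: lessThan_Suc_atMost)
    finally have size: "psize p = psize \<nu> + \<mu> k" by linarith
    have "interlace \<nu> p" unfolding interlace_def
    proof (intro allI conjI)
      fix i
      have kap: "?\<kappa> i = int (\<nu> i)" if "i < k" using that by (simp add: join_def)
      show "\<nu> i \<le> p i"
      proof (cases "i < k")
        case True
        then have "?\<kappa> i \<le> l i" using l by blast
        then show ?thesis using kap lp[of i] True by simp
      qed (simp add: \<nu>0)
      show "p (Suc i) \<le> \<nu> i"
      proof (cases "i < k")
        case True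
        then have "l (Suc i) \<le> ?\<kappa> i" using l by blast
        then show ?thesis using kap lp[of "Suc i"] True by simp
      qed (simp add: p_def)
    qed
    moreover have "p \<in> rows (Suc k) \<mu>" using p0 size \<nu> by (auto simp: rows_def)
    ultimately have "p \<in> ?P" using size by blast
    then show "l \<in> ?j ` ?P" using eq by blast
  qed
  have "dim (highest_below k W ?\<kappa>) \<le> (\<Sum>l\<in>?L. dim (highest_below (Suc k) W l))" using branching(2)[OF W pos] .
  also have "\<dots> \<le> (\<Sum>l\<in>?j ` ?P. dim (highest_below (Suc k) W l))"
    using finP \<open>?L \<subseteq> ?j ` ?P\<close> by (intro sum_mono2) auto
  also have "\<dots> \<le> (\<Sum>p\<in>?P. ?D p)"
    using sum_image_le[OF finP, of "\<lambda>l. dim (highest_below (Suc k) W l)" ?j] by (simp add: o_def)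
  finally show ?thesis .
qed

text \<open>\<open>kostka k\<close> counts the chains of interlacing rows, so it accumulates the
  choices made in the first \<open>k\<close> branching steps.\<close>

lemma dim_le_hwk:
  assumes W: "weight_module W"
  shows "dim (W (iw \<mu>)) \<le> (\<Sum>\<nu>\<in>rows k \<mu>. kostka k \<mu> \<nu> * dim (highest_below k W (join k \<nu> \<mu>)))"
proof (induct k)
  case 0
  have "join 0 (\<lambda>_. 0) \<mu> = iw \<mu>" by (simp add: join_def)
  moreover have "highest_below 0 W \<kappa> = W \<kappa>" for \<kappa> by (simp add: highest_below_def)
  moreover have "rows 0 \<mu> = {\<lambda>_. 0}"
    by (auto simp: rows_def psize_def)
  ultimately show ?case by simp
next
  case (Suc k)
  let ?D = "\<lambda>p. dim (highest_below (Suc k) W (join (Suc k) p \<mu>))"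
  let ?R = "\<lambda>\<nu> p. interlace \<nu> p \<and> psize p = psize \<nu> + \<mu> k"
  have "(\<Sum>\<nu>\<in>rows k \<mu>. kostka k \<mu> \<nu> * dim (highest_below k W (join k \<nu> \<mu>))) \<le>
      (\<Sum>\<nu>\<in>rows k \<mu>. kostka k \<mu> \<nu> * (\<Sum>p | p \<in> rows (Suc k) \<mu> \<and> ?R \<nu> p. ?D p))"
    using dim_hwk_step[OF W] by (intro sum_mono mult_left_mono) auto
  also have "\<dots> = (\<Sum>\<nu>\<in>rows k \<mu>. \<Sum>p\<in>rows (Suc k) \<mu>. if ?R \<nu> p then kostka k \<mu> \<nu> * ?D p else 0)"
    by (rule sum.cong[OF refl])
      (simp only: sum_distrib_left sum.inter_filter[OF finite_rows] if_distrib[of "\<lambda>x. _ * x"] mult_0_right)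
  also have "\<dots> = (\<Sum>p\<in>rows (Suc k) \<mu>. \<Sum>\<nu>\<in>rows k \<mu>. if ?R \<nu> p then kostka k \<mu> \<nu> * ?D p else 0)"
    by (rule sum.swap)
  also have "\<dots> \<le> (\<Sum>p\<in>rows (Suc k) \<mu>. kostka (Suc k) \<mu> p * ?D p)"
  proof (rule sum_mono)
    fix p assume p: "p \<in> rows (Suc k) \<mu>"
    then have fp: "fsupp p" by (intro fsupp_bounded[of "Suc k"]) (simp add: rows_def)
    have fin: "finite {\<nu>. ?R \<nu> p}"
      by (rule finite_subset[OF _ finite_below[OF fp]]) (auto simp: interlace_def)
    have "(\<Sum>\<nu>\<in>rows k \<mu>. if ?R \<nu> p then kostka k \<mu> \<nu> * ?D p else 0) =
        (\<Sum>\<nu> | \<nu> \<in> rows k \<mu> \<and> ?R \<nu> p. kostka k \<mu> \<nu> * ?D p)"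
      by (simp only: sum.inter_filter[OF finite_rows])
    also have "\<dots> \<le> (\<Sum>\<nu> | ?R \<nu> p. kostka k \<mu> \<nu> * ?D p)"
      using fin by (intro sum_mono2) auto
    also have "\<dots> = kostka (Suc k) \<mu> p * ?D p" by (simp only: kostka.simps sum_distrib_right)
    finally show "(\<Sum>\<nu>\<in>rows k \<mu>. if ?R \<nu> p then kostka k \<mu> \<nu> * ?D p else 0) \<le> kostka (Suc k) \<mu> p * ?D p" .
  qed
  finally show ?case using Suc by linarith
qed

text \<open>After \<open>N\<close> steps every letter that occurs has been treated. Raising a letter
  that does not occur gives 0, so \<open>highest_below N\<close> is then
  \<open>highest\<close>.\<close>

lemma dim_le_kos:
  assumes W: "weight_module W" and N: "\<And>i. i \<ge> N \<Longrightarrow> \<mu> i = 0" and d: "(\<Sum>i<N. \<mu> i) = d"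
  shows "dim (W (iw \<mu>)) \<le> (\<Sum>p\<in>shapes d. dim (highest W (iw p)) * kostka N \<mu> p)"
proof -
  have hw: "highest_below N W (join N p \<mu>) = highest W (iw p)" if "p \<in> rows N \<mu>" for p
  proof -
    have p0: "p i = 0" if "i \<ge> N" for i using \<open>p \<in> rows N \<mu>\<close> that by (simp add: rows_def)
    have j: "join N p \<mu> = iw p" using N p0 by (auto simp: join_def fun_eq_iff not_less)
    have "der i l u = 0" if "u \<in> W (iw p)" "i < l" "\<not> l < N" for u i l
      using der_raise_empty[of u "iw p" l i] weight_moduleD(2)[OF W] that p0[of l] by auto
    then show ?thesis unfolding j highest_below_def highest_def by blast
  qed
  have "dim (W (iw \<mu>)) \<le> (\<Sum>p\<in>rows N \<mu>. kostka N \<mu> p * dim (highest_below N W (join N p \<mu>)))"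
    by (rule dim_le_hwk[OF W])
  also have "\<dots> = (\<Sum>p\<in>rows N \<mu>. dim (highest W (iw p)) * kostka N \<mu> p)"
    by (rule sum.cong[OF refl]) (simp add: hw mult.commute)
  also have "\<dots> = (\<Sum>p | p \<in> rows N \<mu> \<and> kostka N \<mu> p \<noteq> 0. dim (highest W (iw p)) * kostka N \<mu> p)"
    by (rule sum.mono_neutral_right) (auto simp: finite_rows)
  also have "\<dots> \<le> (\<Sum>p\<in>shapes d. dim (highest W (iw p)) * kostka N \<mu> p)"
    using kos_shapes[of N \<mu>] d by (intro sum_mono2) (auto simp: finite_shapes)
  finally show ?thesis .
qed

section \<open>Highest weight vectors in the full tensor space\<close>

lift_definition left_quot :: "nat \<Rightarrow> real tensor \<Rightarrow> real tensor" is "\<lambda>x f u. f (x # u)" .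

lemma coeff_lq: "coeff (left_quot x f) u = coeff f (x # u)"
  by transfer simp

lemma linear_lq: "linear (left_quot x)"
  by (rule linearI) (auto intro!: tensor_eqI simp: coeff_lq)

lemma der_lq: "der i l (left_quot x f) = left_quot x (der i l f) - of_bool (x = i) *\<^sub>R left_quot l f"
proof -
  have "coeff (left_quot x f) = (\<lambda>v. coeff f (x # v))" by (rule ext) (rule coeff_lq)
  then show ?thesis by (intro tensor_eqI) (simp add: coeff_der coeff_lq)
qed

lemma lq_wspace:
  assumes "f \<in> weight_space \<mu>" shows "left_quot x f \<in> weight_space (\<mu>(x := \<mu> x - 1))"
  unfolding weight_space_def
proof (intro CollectI allI impI)
  fix u assume "coeff (left_quot x f) u \<noteq> 0"
  then have "content (x # u) = \<mu>" using assms by (simp add: coeff_lq weight_space_def)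
  then show "content u = \<mu>(x := \<mu> x - 1)" by (auto simp: content_def)
qed

text \<open>
  Among the \<open>left_quot x w\<close> of a highest weight vector \<open>w\<close>, the one with the largest \<open>x\<close> such that it
  is nonzero is again a highest weight vector.
\<close>

lemma dim_hwv_words: "p \<in> shapes d \<Longrightarrow> dim (highest weight_space (iw p)) \<le> paths d p"
proof (induct d arbitrary: p)
  case 0
  then have p: "p = (\<lambda>_. 0)" by (simp add: shapes_0)
  have "words (iw p) = {[]}" by (auto simp: words_def content_def p fun_eq_iff)
  then have "dim (weight_space (iw p)) = 1" by (simp add: dim_weight_space)
  moreover have "dim (highest weight_space (iw p)) \<le> dim (weight_space (iw p))"
    by (rule dim_mono_findim[OF findim_weight_space]) (auto simp: highest_def)
  ultimately show ?case by (simp add: p)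
next
  case (Suc d)
  have IH: "\<And>q. q \<in> shapes d \<Longrightarrow> dim (highest weight_space (iw q)) \<le> paths d q" by (rule Suc.hyps)
  have p: "decreasing p" "fsupp p" "psize p = Suc d" using Suc.prems by (auto simp: shapes_def)
  \<comment> \<open>A filtration by the largest letter with which a word of \<open>w\<close>
    begins.\<close>
  define H where "H n = {w \<in> highest weight_space (iw p). \<forall>x\<ge>n. left_quot x w = 0}" for n
  have subH: "subspace (H n)" for n
    using subspace_hwv[OF weight_module_wspace, of "iw p"]
    unfolding H_def real_vector.subspace_def
    by (auto simp: linear_add[OF linear_lq] linear_scale[OF linear_lq] linear_0[OF linear_lq])
  have finH: "findim (H n)" for n
    by (rule findim_subset[OF findim_weight_space]) (auto simp: H_def highest_def)
  have bound: "dim (H n) \<le> (\<Sum>i | removable p i \<and> i < n. paths d (down i p))" for n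
  proof (induct n)
    case 0
    have "H 0 \<subseteq> {0}"
    proof
      fix w assume w: "w \<in> H 0"
      have "coeff w u = 0" for u
      proof (cases u)
        case Nil
        have "content [] \<noteq> iw p"
        proof
          assume "content [] = iw p"
          then have "p = (\<lambda>_. 0)" by (auto simp: content_def fun_eq_iff)
          then show False using p(3) by (simp add: psize_def)
        qed
        then show ?thesis using w Nil by (auto simp: H_def highest_def weight_space_def)
      next
        case (Cons x v)
        have "left_quot x w = 0" using w by (simp add: H_def)
        then show ?thesis using coeff_lq[of x w v] Cons by simp
      qed
      then show "w \<in> {0}" by (auto intro: tensor_eqI)
    qed
    then show ?case using real_vector.dim_le_card[of "H 0" "{}"] by simp
  next
    case (Suc n)
    have "{w \<in> H (Suc n). left_quot n w = 0} = H n"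
      by (auto simp: H_def) (metis le_neq_implies_less Suc_leI)
    then have "dim (H (Suc n)) = dim (H n) + dim (left_quot n ` H (Suc n))"
      using rank_nullity[OF linear_lq[of n] subH[of "Suc n"] finH[of "Suc n"]] by simp
    moreover have "dim (left_quot n ` H (Suc n)) \<le> (\<Sum>i | removable p i \<and> i = n. paths d (down i p))"
    proof -
      let ?\<mu> = "(iw p)(n := int (p n) - 1)"
      have sub: "left_quot n ` H (Suc n) \<subseteq> highest weight_space ?\<mu>"
      proof
        fix v assume "v \<in> left_quot n ` H (Suc n)"
        then obtain w where w: "w \<in> H (Suc n)" "v = left_quot n w" by blast
        have "der i l v = 0" if "i < l" for i l
        proof -
          have "der i l w = 0" using w(1) that by (simp add: H_def highest_def)
          \<comment> \<open>The correction term of \<open>der_lq\<close> concerns a letter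
            \<open>l > n\<close>, and on \<open>H (Suc n)\<close> these quotients vanish.\<close>
          moreover have "left_quot l w = 0" if "n = i" using w(1) \<open>i < l\<close> that by (simp add: H_def)
          ultimately show ?thesis using der_lq[of i l n w] w(2) linear_0[OF linear_lq] by (cases "n = i") auto
        qed
        moreover have "v \<in> weight_space ?\<mu>" using w lq_wspace[of w "iw p" n] by (simp add: H_def highest_def)
        ultimately show "v \<in> highest weight_space ?\<mu>" by (simp add: highest_def)
      qed
      have fin: "findim (highest weight_space ?\<mu>)"
        by (rule findim_subset[OF findim_weight_space]) (auto simp: highest_def)
      show ?thesis
      proof (cases "removable p n")
        case True
        then have pos: "p n > 0" by (auto simp: removable_def)
        have eq: "?\<mu> = iw (down n p)" using pos by auto
        have "down n p \<in> shapes d"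
          using dec_down[OF p(1) True] psize_down[OF p(2) pos] p by (simp add: shapes_def)
        from IH[OF this] have "dim (highest weight_space ?\<mu>) \<le> paths d (down n p)" unfolding eq .
        moreover have "{i. removable p i \<and> i = n} = {n}" using True by auto
        ultimately show ?thesis using dim_mono_findim[OF fin sub] by simp
      next
        case False
        \<comment> \<open>Without a removable box the new weight increases from row \<open>n\<close>
          to row \<open>n + 1\<close>, and \<open>raising_injective\<close> excludes nonzero highest
          weight vectors.\<close>
        then have "p (Suc n) = p n" using p(1) by (auto simp: removable_def decreasing_def not_less intro: antisym)
        then have "?\<mu> n < ?\<mu> (Suc n)" by simp
        then have "highest weight_space ?\<mu> \<subseteq> {0}"
          using raising_injective[of _ ?\<mu> n "Suc n"] by (auto simp: highest_def)
        then have "dim (left_quot n ` H (Suc n)) \<le> 0"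
          using real_vector.dim_le_card[of "left_quot n ` H (Suc n)" "{}"] sub by simp
        then show ?thesis by simp
      qed
    qed
    moreover have "(\<Sum>i | removable p i \<and> i < Suc n. paths d (down i p)) =
       (\<Sum>i | removable p i \<and> i < n. paths d (down i p)) + (\<Sum>i | removable p i \<and> i = n. paths d (down i p))"
      by (subst sum.union_disjoint[symmetric]) (auto intro!: sum.cong)
    ultimately show ?case using Suc by linarith
  qed
  obtain n where n: "\<And>i. i \<ge> n \<Longrightarrow> p i = 0" using fsupp_bound[OF p(2)] by metis
  have "highest weight_space (iw p) \<subseteq> H n"
  proof
    fix w assume w: "w \<in> highest weight_space (iw p)"
    have "left_quot x w = 0" if "x \<ge> n" for x
      by (rule wspace_negative[OF lq_wspace[of w "iw p" x], of x])
        (use w n[OF that] in \<open>auto simp: highest_def\<close>)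
    then show "w \<in> H n" using w by (simp add: H_def)
  qed
  then have "dim (highest weight_space (iw p)) \<le> dim (H n)" by (rule dim_mono_findim[OF finH])
  also have "\<dots> \<le> (\<Sum>i | removable p i \<and> i < n. paths d (down i p))" by (rule bound)
  also have "\<dots> \<le> (\<Sum>i | removable p i. paths d (down i p))"
    using finite_removable[OF p(2)] by (intro sum_mono2) auto
  finally show ?case by simp
qed

text \<open>The inner product \<open>inner\<close> without the auxiliary bounds, which cannot be
  chosen uniformly for all weights of a module.\<close>

definition weight_inner :: "(nat \<Rightarrow> int) \<Rightarrow> real tensor \<Rightarrow> real tensor \<Rightarrow> real" where
  "weight_inner \<mu> f g = (\<Sum>u\<in>words \<mu>. coeff f u * coeff g u)"

lemma ipw_eq_ip:
  assumes "words \<mu> \<subseteq> bounded_words N d" "f \<in> weight_space \<mu>" shows "weight_inner \<mu> f g = inner N d f g" "weight_inner \<mu> g f = inner N d g f"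
  unfolding weight_inner_def inner_def using assms
  by (auto intro!: sum.mono_neutral_left simp: finite_Ld weight_space_def words_def)

lemma ipw_adjoint:
  assumes f: "f \<in> weight_space \<mu>" and g: "g \<in> weight_space (shift 1 a b \<mu>)"
  shows "weight_inner (shift 1 a b \<mu>) (der a b f) g = weight_inner \<mu> f (der b a g)"
proof -
  have ss: "shift 1 b a (shift 1 a b \<mu>) = \<mu>" by (auto simp: shift_def fun_eq_iff)
  have dg: "der b a g \<in> weight_space \<mu>" using der_wspace[OF g, of b a] by (simp add: ss)
  have df: "der a b f \<in> weight_space (shift 1 a b \<mu>)" by (rule der_wspace[OF f])
  \<comment> \<open>If one of the two weights has no words, \<open>f\<close> or \<open>g\<close> is
    0. Otherwise the words of both weights have the same length, and common bounds for
    \<open>der_adjoint\<close> exist.\<close>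
  consider "words \<mu> = {}" | "words (shift 1 a b \<mu>) = {}" |
    u v where "u \<in> words \<mu>" "v \<in> words (shift 1 a b \<mu>)" by blast
  then show ?thesis
  proof cases
    case 1
    then have "f = 0" using f by (intro tensor_eqI) (auto simp: weight_space_def words_def)
    then show ?thesis by (simp add: weight_inner_def)
  next
    case 2
    then have "g = 0" using g by (intro tensor_eqI) (auto simp: weight_space_def words_def)
    then show ?thesis by (simp add: weight_inner_def)
  next
    case 3
    have "count (mset v + {#b#}) j = count (mset u + {#a#}) j" for j
    proof -
      have "content v j = content u j + of_bool (j = a) - of_bool (j = b)" using 3 by (simp add: words_def shift_def)
      then show ?thesis by (cases "j = a"; cases "j = b") (simp_all add: content_def)
    qed
    then have "mset v + {#b#} = mset u + {#a#}" by (rule multiset_eqI)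
    from arg_cong[OF this, of size] have len: "length v = length u" by simp
    obtain N where N: "\<forall>x\<in>set u \<union> set v \<union> {a, b}. x < N"
      by (metis finite_Un finite_set finite.emptyI finite.insertI finite_nat_set_iff_bounded)
    have inc: "words \<mu> \<subseteq> bounded_words N (length u)" "words (shift 1 a b \<mu>) \<subseteq> bounded_words N (length u)"
    proof -
      have "w \<in> bounded_words N (length u)" if "w \<in> words \<mu>" for w
      proof -
        have "mset w = mset u" using that 3 by (simp add: words_def flip: ctn_eq_iff)
        then show ?thesis using N mset_eq_setD[of w u] mset_eq_length[of w u] by (auto simp: bounded_words_def)
      qed
      moreover have "w \<in> bounded_words N (length u)" if "w \<in> words (shift 1 a b \<mu>)" for w
      proof -
        have "mset w = mset v" using that 3 by (simp add: words_def flip: ctn_eq_iff)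
        then show ?thesis using N mset_eq_setD[of w v] mset_eq_length[of w v] len by (auto simp: bounded_words_def)
      qed
      ultimately show "words \<mu> \<subseteq> bounded_words N (length u)" "words (shift 1 a b \<mu>) \<subseteq> bounded_words N (length u)" by blast+
    qed
    show ?thesis using der_adjoint[of a N b "length u" f g] N ipw_eq_ip[OF inc(1) f] ipw_eq_ip[OF inc(2) g] by simp
  qed
qed

definition orth :: "((nat \<Rightarrow> int) \<Rightarrow> real tensor set) \<Rightarrow> (nat \<Rightarrow> int) \<Rightarrow> real tensor set" where
  "orth W \<mu> = {f \<in> weight_space \<mu>. \<forall>g\<in>W \<mu>. weight_inner \<mu> f g = 0}"

lemma ipw_simps:
  "weight_inner \<mu> (f + f') g = weight_inner \<mu> f g + weight_inner \<mu> f' g"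
  "weight_inner \<mu> (c *\<^sub>R f) g = c * weight_inner \<mu> f g" "weight_inner \<mu> 0 g = 0"
  "weight_inner \<mu> f (g + g') = weight_inner \<mu> f g + weight_inner \<mu> f g'"
  "weight_inner \<mu> f (c *\<^sub>R g) = c * weight_inner \<mu> f g" "weight_inner \<mu> f 0 = 0"
  by (simp_all add: weight_inner_def algebra_simps sum.distrib sum_distrib_left)

lemma ipw_eq_0: "f \<in> weight_space \<mu> \<Longrightarrow> weight_inner \<mu> f f = 0 \<Longrightarrow> f = 0"
proof -
  assume f: "f \<in> weight_space \<mu>" "weight_inner \<mu> f f = 0"
  have "\<forall>u\<in>words \<mu>. coeff f u * coeff f u = 0"
    using f(2) sum_nonneg_eq_0_iff[OF finite_words_of, of \<mu> "\<lambda>u. coeff f u * coeff f u"] by (simp add: weight_inner_def)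
  then show ?thesis using f(1) by (intro tensor_eqI) (auto simp: weight_space_def words_def)
qed

lemma weight_module_orth:
  assumes W: "weight_module W" shows "weight_module (orth W)"
  unfolding weight_module_def
proof (intro allI conjI)
  fix \<mu> a b
  show "subspace (orth W \<mu>)" using subspace_weight_space[of \<mu>]
    by (auto simp: orth_def real_vector.subspace_def ipw_simps)
  show "orth W \<mu> \<subseteq> weight_space \<mu>" by (auto simp: orth_def)
  have ss: "shift 1 b a (shift 1 a b \<mu>) = \<mu>" by (auto simp: shift_def fun_eq_iff)
  show "der a b ` orth W \<mu> \<subseteq> orth W (shift 1 a b \<mu>)"
  proof
    fix h assume "h \<in> der a b ` orth W \<mu>"
    then obtain f where f: "f \<in> orth W \<mu>" "h = der a b f" by blast
    have "weight_inner (shift 1 a b \<mu>) h g = 0" if g: "g \<in> W (shift 1 a b \<mu>)" for g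
    proof -
      have "der b a g \<in> W \<mu>" using weight_moduleD(3)[OF W g, of b a] by (simp add: ss)
      then show ?thesis
        using ipw_adjoint[of f \<mu> g a b] f g weight_moduleD(2)[OF W] by (auto simp: orth_def)
    qed
    then show "h \<in> orth W (shift 1 a b \<mu>)" using der_wspace f by (auto simp: orth_def)
  qed
qed

lemma dim_orth:
  assumes W: "weight_module W" shows "dim (weight_space \<mu>) \<le> dim (W \<mu>) + dim (orth W \<mu>)"
proof -
  obtain B where B: "finite B" "B \<subseteq> W \<mu>" "independent B" "W \<mu> \<subseteq> span B" "card B = dim (W \<mu>)"
    using findim_basis[OF weight_moduleD(4)[OF W]] .
  have lin: "linear (\<lambda>f. weight_inner \<mu> f g)" for g by (rule linearI) (simp_all add: ipw_simps)
  have "{f \<in> weight_space \<mu>. \<forall>g\<in>B. weight_inner \<mu> f g = 0} \<subseteq> orth W \<mu>"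
  proof
    fix f assume f: "f \<in> {f \<in> weight_space \<mu>. \<forall>g\<in>B. weight_inner \<mu> f g = 0}"
    have "weight_inner \<mu> f g = 0" if "g \<in> span B" for g
      using that by (induct rule: real_vector.span_induct_alt) (use f in \<open>auto simp: ipw_simps\<close>)
    then show "f \<in> orth W \<mu>" using f B(4) by (auto simp: orth_def)
  qed
  then have "dim {f \<in> weight_space \<mu>. \<forall>g\<in>B. weight_inner \<mu> f g = 0} \<le> dim (orth W \<mu>)"
    by (rule dim_mono_findim[OF weight_moduleD(4)[OF weight_module_orth[OF W]]])
  moreover have "dim (weight_space \<mu>) \<le> card B + dim {f \<in> weight_space \<mu>. \<forall>g\<in>B. weight_inner \<mu> f g = 0}"
    by (rule dim_kernel_family[OF B(1) lin subspace_weight_space findim_weight_space])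
  ultimately show ?thesis using B(5) by linarith
qed

lemma dim_hwv_orth:
  assumes W: "weight_module W" shows "dim (highest W \<mu>) + dim (highest (orth W) \<mu>) \<le> dim (highest weight_space \<mu>)"
proof (rule dim_add_le)
  show "findim (highest weight_space \<mu>)" by (rule findim_subset[OF findim_weight_space]) (auto simp: highest_def)
  show "highest W \<mu> \<subseteq> highest weight_space \<mu>" using weight_moduleD(2)[OF W] by (auto simp: highest_def)
  show "highest (orth W) \<mu> \<subseteq> highest weight_space \<mu>" by (auto simp: highest_def orth_def)
  show "highest W \<mu> \<inter> highest (orth W) \<mu> \<subseteq> {0}" using ipw_eq_0 by (auto simp: highest_def orth_def)
qed (use W weight_module_orth weight_module_wspace subspace_hwv in auto)

theorem weight_module_kostka:
  assumes W: "weight_module W" and N: "\<And>i. i \<ge> N \<Longrightarrow> \<mu> i = 0" and d: "(\<Sum>i<N. \<mu> i) = d"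
  shows "dim (W (iw \<mu>)) = (\<Sum>p\<in>shapes d. dim (highest W (iw p)) * kostka N \<mu> p)"
proof -
  let ?c = "\<lambda>p. dim (highest W (iw p))" and ?c' = "\<lambda>p. dim (highest (orth W) (iw p))"
  have 1: "dim (W (iw \<mu>)) \<le> (\<Sum>p\<in>shapes d. ?c p * kostka N \<mu> p)"
    by (rule dim_le_kos[OF W N d])
  have 2: "dim (orth W (iw \<mu>)) \<le> (\<Sum>p\<in>shapes d. ?c' p * kostka N \<mu> p)"
    by (rule dim_le_kos[OF weight_module_orth[OF W] N d])
  have "(\<Sum>p\<in>shapes d. ?c p * kostka N \<mu> p) + (\<Sum>p\<in>shapes d. ?c' p * kostka N \<mu> p) =
      (\<Sum>p\<in>shapes d. (?c p + ?c' p) * kostka N \<mu> p)" by (simp add: sum.distrib distrib_right)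
  also have "\<dots> \<le> (\<Sum>p\<in>shapes d. paths d p * kostka N \<mu> p)"
  proof (intro sum_mono mult_right_mono)
    fix p assume "p \<in> shapes d"
    then show "?c p + ?c' p \<le> paths d p"
      using dim_hwv_orth[OF W, of "iw p"] dim_hwv_words[of p d] by linarith
  qed simp
  also have "\<dots> = dim (weight_space (iw \<mu>))" using paths_kos_sum[OF N d] by (simp add: dim_weight_space)
  also have "\<dots> \<le> dim (W (iw \<mu>)) + dim (orth W (iw \<mu>))" by (rule dim_orth[OF W])
  finally show ?thesis using 1 2 by linarith
qed

section \<open>Semistandard tableaux\<close>

definition diagram :: "(nat \<Rightarrow> nat) \<Rightarrow> (nat \<times> nat) set" where
  "diagram p = {(i, j). j < p i}"

text \<open>The semistandard tableaux counted by one coefficient of \<open>schur\<close>. The bound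
  \<open>N\<close> on the entries is the induction parameter for stripping off the largest
  one.\<close>

definition tableaux :: "nat \<Rightarrow> (nat \<Rightarrow> nat) \<Rightarrow> (nat \<Rightarrow> nat) \<Rightarrow> (nat \<times> nat \<Rightarrow> nat) set" where
  "tableaux N \<mu> p = {T \<in> diagram p \<rightarrow>\<^sub>E UNIV.
    (\<forall>i j j'. j < j' \<and> (i, j) \<in> diagram p \<and> (i, j') \<in> diagram p \<longrightarrow> T (i, j) \<le> T (i, j')) \<and>
    (\<forall>i i' j. i < i' \<and> (i, j) \<in> diagram p \<and> (i', j) \<in> diagram p \<longrightarrow> T (i, j) < T (i', j)) \<and>
    (\<forall>c\<in>diagram p. T c < N) \<and> (\<forall>k<N. card {c \<in> diagram p. T c = k} = \<mu> k)}"

lemma cellsF_Sigma: "diagram p = Sigma {i. p i \<noteq> 0} (\<lambda>i. {..<p i})"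
  by (auto simp: diagram_def)

lemma finite_cellsF: "fsupp p \<Longrightarrow> finite (diagram p)"
  by (auto simp: cellsF_Sigma fsupp_def)

lemma card_cellsF: "fsupp p \<Longrightarrow> card (diagram p) = psize p"
  unfolding cellsF_Sigma psize_def fsupp_def by simp

lemma cellsF_inj: "diagram p = diagram q \<Longrightarrow> p = q"
proof
  fix i assume "diagram p = diagram q"
  then have "{..<p i} = {..<q i}" by (auto simp: diagram_def set_eq_iff)
  then show "p i = q i" by simp
qed

lemma finite_tabl: "fsupp p \<Longrightarrow> finite (tableaux N \<mu> p)"
proof (rule finite_subset)
  show "tableaux N \<mu> p \<subseteq> diagram p \<rightarrow>\<^sub>E {..<N}" by (auto simp: tableaux_def PiE_def Pi_def extensional_def)
qed (auto intro: finite_PiE finite_cellsF)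

lemma tablD:
  assumes "T \<in> tableaux N \<mu> p"
  shows "T \<in> diagram p \<rightarrow>\<^sub>E UNIV"
    "\<And>i j j'. j < j' \<Longrightarrow> (i, j) \<in> diagram p \<Longrightarrow> (i, j') \<in> diagram p \<Longrightarrow> T (i, j) \<le> T (i, j')"
    "\<And>i i' j. i < i' \<Longrightarrow> (i, j) \<in> diagram p \<Longrightarrow> (i', j) \<in> diagram p \<Longrightarrow> T (i, j) < T (i', j)"
    "\<And>c. c \<in> diagram p \<Longrightarrow> T c < N"
    "\<And>k. k < N \<Longrightarrow> card {c \<in> diagram p. T c = k} = \<mu> k"
  using assms unfolding tableaux_def by auto

text \<open>Deleting the entries \<open>N\<close> is undone by filling the cells outside
  \<open>q\<close> with \<open>N\<close>. The result is semistandard because a horizontal strip has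
  at most one cell in each column.\<close>

lemma tabl_fibre:
  assumes q: "interlace q p" "psize p = psize q + \<mu> N" and p: "fsupp p"
  shows "bij_betw (\<lambda>T. restrict T (diagram q))
    {T \<in> tableaux (Suc N) \<mu> p. \<forall>c\<in>diagram p. T c < N \<longleftrightarrow> c \<in> diagram q} (tableaux N \<mu> q)"
proof -
  have sub: "diagram q \<subseteq> diagram p" using q(1) by (force simp: diagram_def interlace_def intro: less_le_trans)
  have dq: "decreasing q" and dp: "decreasing p" using interlace_dec[OF q(1)] by auto
  have fq: "fsupp q" using interlace_fsupp[OF q(1)] p by simp
  \<comment> \<open>The value \<open>undefined\<close> outside \<open>diagram p\<close> keeps the
    tableau extensional.\<close>
  define ext where "ext T = (\<lambda>c. if c \<in> diagram q then T c else if c \<in> diagram p then N else undefined)"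
    for T :: "nat \<times> nat \<Rightarrow> nat"
  have mono_q: "(i, j) \<in> diagram q" if "(i', j') \<in> diagram q" "i \<le> i'" "j \<le> j'" for i i' j j'
    using that dec_antimono[OF dq, of i i'] by (auto simp: diagram_def)
  show ?thesis
  proof (rule bij_betw_byWitness[where f'=ext])
    show "\<forall>T\<in>{T \<in> tableaux (Suc N) \<mu> p. \<forall>c\<in>diagram p. T c < N \<longleftrightarrow> c \<in> diagram q}. ext (restrict T (diagram q)) = T"
    proof
      fix T assume T: "T \<in> {T \<in> tableaux (Suc N) \<mu> p. \<forall>c\<in>diagram p. T c < N \<longleftrightarrow> c \<in> diagram q}"
      then have T1: "T \<in> tableaux (Suc N) \<mu> p" and T2: "\<And>c. c \<in> diagram p \<Longrightarrow> T c < N \<longleftrightarrow> c \<in> diagram q" by auto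
      show "ext (restrict T (diagram q)) = T"
      proof
        fix c
        have "T c = N" if "c \<in> diagram p" "c \<notin> diagram q"
          using T2[OF that(1)] that tablD(4)[OF T1 that(1)] by simp
        moreover have "T c = undefined" if "c \<notin> diagram p" using tablD(1)[OF T1] that by auto
        ultimately show "ext (restrict T (diagram q)) c = T c" by (simp add: ext_def)
      qed
    qed
    show "\<forall>T\<in>tableaux N \<mu> q. restrict (ext T) (diagram q) = T"
    proof
      fix T assume T: "T \<in> tableaux N \<mu> q"
      show "restrict (ext T) (diagram q) = T"
        using tablD(1)[OF T] by (intro ext) (auto simp: ext_def fun_eq_iff PiE_def Pi_def extensional_def)
    qed
    show "(\<lambda>T. restrict T (diagram q)) ` {T \<in> tableaux (Suc N) \<mu> p. \<forall>c\<in>diagram p. T c < N \<longleftrightarrow> c \<in> diagram q} \<subseteq> tableaux N \<mu> q"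
    proof (rule image_subsetI)
      fix T assume T: "T \<in> {T \<in> tableaux (Suc N) \<mu> p. \<forall>c\<in>diagram p. T c < N \<longleftrightarrow> c \<in> diagram q}"
      then have T1: "T \<in> tableaux (Suc N) \<mu> p" and T2: "\<And>c. c \<in> diagram p \<Longrightarrow> T c < N \<longleftrightarrow> c \<in> diagram q" by auto
      have "card {c \<in> diagram q. restrict T (diagram q) c = k} = \<mu> k" if "k < N" for k
      proof -
        have "{c \<in> diagram q. restrict T (diagram q) c = k} = {c \<in> diagram p. T c = k}"
          using sub T2 that by auto
        then show ?thesis using tablD(5)[OF T1, of k] that by simp
      qed
      then show "restrict T (diagram q) \<in> tableaux N \<mu> q"
        unfolding tableaux_def using tablD(2,3)[OF T1] T2 sub by (auto simp: subset_iff)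
    qed
    show "ext ` tableaux N \<mu> q \<subseteq> {T \<in> tableaux (Suc N) \<mu> p. \<forall>c\<in>diagram p. T c < N \<longleftrightarrow> c \<in> diagram q}"
    proof (rule image_subsetI)
      fix T assume T: "T \<in> tableaux N \<mu> q"
      have in_q: "ext T c = T c" "T c < N" if "c \<in> diagram q" for c using that tablD(4)[OF T] by (simp_all add: ext_def)
      have out_q: "ext T c = N" if "c \<in> diagram p" "c \<notin> diagram q" for c using that by (simp add: ext_def)
      have "ext T \<in> diagram p \<rightarrow>\<^sub>E UNIV" using sub by (auto simp: ext_def PiE_def Pi_def extensional_def)
      moreover have "ext T (i, j) \<le> ext T (i, j')" if "j < j'" "(i, j) \<in> diagram p" "(i, j') \<in> diagram p" for i j j'
      proof (cases "(i, j') \<in> diagram q")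
        case True
        then have "(i, j) \<in> diagram q" using mono_q[of i j' i j] that by simp
        then show ?thesis using tablD(2)[OF T that(1)] True in_q by simp
      next
        case False
        then have "ext T (i, j') = N" using out_q that by simp
        moreover have "ext T (i, j) \<le> N"
          using in_q[of "(i, j)"] out_q[of "(i, j)"] that(2) by (cases "(i, j) \<in> diagram q") auto
        ultimately show ?thesis by simp
      qed
      moreover have "ext T (i, j) < ext T (i', j)" if "i < i'" "(i, j) \<in> diagram p" "(i', j) \<in> diagram p" for i i' j
      proof (cases "(i', j) \<in> diagram q")
        case True
        then have "(i, j) \<in> diagram q" using mono_q[of i' j i j] that by simp
        then show ?thesis using tablD(3)[OF T that(1)] True in_q by simp
      next
        case False
        \<comment> \<open>Every cell above one outside \<open>q\<close> lies in \<open>q\<close> and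
          thus has an entry below \<open>N\<close>.\<close>
        have "j < p i'" using that(3) by (simp add: diagram_def)
        also have "p i' \<le> p (Suc i)" using dec_antimono[OF dp, of "Suc i" i'] that(1) by simp
        also have "p (Suc i) \<le> q i" using q(1) by (simp add: interlace_def)
        finally have "(i, j) \<in> diagram q" by (simp add: diagram_def)
        then show ?thesis using in_q[of "(i, j)"] out_q[OF that(3) False] by simp
      qed
      moreover have "ext T c < Suc N" if "c \<in> diagram p" for c
        using in_q[of c] out_q[OF that] by (cases "c \<in> diagram q") auto
      moreover have "card {c \<in> diagram p. ext T c = k} = \<mu> k" if "k < Suc N" for k
      proof (cases "k = N")
        case True
        have "{c \<in> diagram p. ext T c = k} = diagram p - diagram q"
          using True in_q out_q by (auto, metis less_irrefl)
        then have "card {c \<in> diagram p. ext T c = k} = card (diagram p) - card (diagram q)"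
          using sub finite_cellsF[OF fq] by (simp add: card_Diff_subset)
        then show ?thesis using True q(2) by (simp add: card_cellsF p fq)
      next
        case False
        have "{c \<in> diagram p. ext T c = k} = {c \<in> diagram q. T c = k}"
        proof (intro equalityI subsetI)
          fix c assume "c \<in> {c \<in> diagram p. ext T c = k}"
          then have c: "c \<in> diagram p" "ext T c = k" by auto
          then have "c \<in> diagram q" using out_q[of c] False by auto
          then show "c \<in> {c \<in> diagram q. T c = k}" using c in_q[of c] by simp
        next
          fix c assume "c \<in> {c \<in> diagram q. T c = k}"
          then show "c \<in> {c \<in> diagram p. ext T c = k}" using in_q[of c] sub by auto
        qed
        then show ?thesis using tablD(5)[OF T, of k] False that by simp
      qed
      moreover have "ext T c < N \<longleftrightarrow> c \<in> diagram q" if "c \<in> diagram p" for c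
        using in_q[of c] out_q[OF that] by (cases "c \<in> diagram q") auto
      ultimately show "ext T \<in> {T \<in> tableaux (Suc N) \<mu> p. \<forall>c\<in>diagram p. T c < N \<longleftrightarrow> c \<in> diagram q}"
        unfolding tableaux_def by blast
    qed
  qed
qed

text \<open>Rows increase weakly, so the entries below \<open>N\<close> fill an initial segment of
  each row; columns increase strictly, so the other cells form a horizontal strip.\<close>

lemma tabl_shape:
  assumes T: "T \<in> tableaux (Suc N) \<mu> p" and p: "decreasing p" "fsupp p"
  obtains q where "interlace q p" "psize p = psize q + \<mu> N" "\<forall>c\<in>diagram p. T c < N \<longleftrightarrow> c \<in> diagram q"
proof -
  define q where "q i = card {j. j < p i \<and> T (i, j) < N}" for i
  have q: "{j. j < p i \<and> T (i, j) < N} = {..<q i}" for i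
  proof -
    have "\<exists>n. {j. j < p i \<and> T (i, j) < N} = {..<n}"
    proof (cases "\<exists>j. j < p i \<and> \<not> T (i, j) < N")
      case False
      then show ?thesis by (intro exI[of _ "p i"]) auto
    next
      case True
      define n where "n = (LEAST j. j < p i \<and> \<not> T (i, j) < N)"
      have n: "n < p i" "\<not> T (i, n) < N" unfolding n_def using LeastI_ex[OF True] by auto
      have "{j. j < p i \<and> T (i, j) < N} = {..<n}"
      proof (intro equalityI subsetI)
        fix j assume "j \<in> {j. j < p i \<and> T (i, j) < N}"
        then have j: "j < p i" "T (i, j) < N" by auto
        have "T (i, n) \<le> T (i, j)" if "n < j" using tablD(2)[OF T that] n j by (simp add: diagram_def)
        then show "j \<in> {..<n}" using j n by (cases "n < j"; cases "n = j") auto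
      next
        fix j assume "j \<in> {..<n}"
        then show "j \<in> {j. j < p i \<and> T (i, j) < N}"
          using not_less_Least[of j "\<lambda>j. j < p i \<and> \<not> T (i, j) < N"] n by (auto simp: n_def)
      qed
      then show ?thesis by blast
    qed
    then show ?thesis unfolding q_def by (metis card_lessThan)
  qed
  have cq: "T c < N \<longleftrightarrow> c \<in> diagram q" if "c \<in> diagram p" for c
  proof -
    obtain i j where c: "c = (i, j)" by (cases c)
    have "j < p i" using that by (simp add: c diagram_def)
    then show ?thesis using q[of i] by (auto simp: c diagram_def)
  qed
  have le: "q i \<le> p i" for i
    using card_mono[of "{..<p i}" "{j. j < p i \<and> T (i, j) < N}"] by (auto simp: q_def)
  have il: "interlace q p" unfolding interlace_def
  proof (intro allI conjI le)
    fix i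
    have "{..<p (Suc i)} \<subseteq> {..<q i}"
    proof (rule subsetI)
      fix j assume "j \<in> {..<p (Suc i)}"
      then have c: "(Suc i, j) \<in> diagram p" "(i, j) \<in> diagram p"
        using p(1) by (auto simp: diagram_def decreasing_def intro: less_le_trans)
      have "T (i, j) < T (Suc i, j)" using tablD(3)[OF T _ c(2,1)] by simp
      moreover have "T (Suc i, j) < Suc N" using tablD(4)[OF T c(1)] .
      ultimately have "(i, j) \<in> diagram q" using cq[OF c(2)] by simp
      then show "j \<in> {..<q i}" by (simp add: diagram_def)
    qed
    then show "p (Suc i) \<le> q i" by simp
  qed
  have fq: "fsupp q" using interlace_fsupp[OF il] p(2) by simp
  have sub: "diagram q \<subseteq> diagram p" using le by (force simp: diagram_def intro: less_le_trans)
  have "{c \<in> diagram p. T c = N} = diagram p - diagram q"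
  proof (intro equalityI subsetI)
    fix c assume "c \<in> {c \<in> diagram p. T c = N}"
    then show "c \<in> diagram p - diagram q" using cq[of c] by auto
  next
    fix c assume c: "c \<in> diagram p - diagram q"
    then show "c \<in> {c \<in> diagram p. T c = N}" using cq[of c] tablD(4)[OF T, of c] by auto
  qed
  then have "\<mu> N = card (diagram p) - card (diagram q)"
    using tablD(5)[OF T, of N] card_Diff_subset[OF finite_cellsF[OF fq] sub] by simp
  moreover have "card (diagram q) \<le> card (diagram p)" by (rule card_mono[OF finite_cellsF[OF p(2)] sub])
  ultimately have "psize p = psize q + \<mu> N" by (simp add: card_cellsF p fq)
  then show ?thesis using that il cq by blast
qed

lemma card_tabl:
  assumes "decreasing p" "fsupp p" shows "card (tableaux N \<mu> p) = kostka N \<mu> p"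
  using assms
proof (induct N arbitrary: p)
  case 0
  show ?case
  proof (cases "p = (\<lambda>_. 0)")
    case True
    then have "tableaux 0 \<mu> p = {\<lambda>_. undefined}" by (auto simp: tableaux_def diagram_def)
    then show ?thesis using True by simp
  next
    case False
    then obtain i where "p i \<noteq> 0" by auto
    then have "(i, 0) \<in> diagram p" by (simp add: diagram_def)
    then have "tableaux 0 \<mu> p = {}" by (auto simp: tableaux_def)
    then show ?thesis using False by simp
  qed
next
  case (Suc N)
  let ?Q = "{q. interlace q p \<and> psize p = psize q + \<mu> N}"
  let ?F = "\<lambda>q. {T \<in> tableaux (Suc N) \<mu> p. \<forall>c\<in>diagram p. T c < N \<longleftrightarrow> c \<in> diagram q}"
  have finQ: "finite ?Q"
    by (rule finite_subset[OF _ finite_below[OF Suc.prems(2)]]) (auto simp: interlace_def)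
  have U: "tableaux (Suc N) \<mu> p = (\<Union>q\<in>?Q. ?F q)"
  proof (intro equalityI subsetI)
    fix T assume T: "T \<in> tableaux (Suc N) \<mu> p"
    obtain q where "interlace q p" "psize p = psize q + \<mu> N" "\<forall>c\<in>diagram p. T c < N \<longleftrightarrow> c \<in> diagram q"
      using tabl_shape[OF T Suc.prems] .
    then show "T \<in> (\<Union>q\<in>?Q. ?F q)" using T by blast
  qed blast
  have disj: "?F q \<inter> ?F q' = {}" if "q \<in> ?Q" "q' \<in> ?Q" "q \<noteq> q'" for q q'
  proof (rule equals0I)
    fix T assume "T \<in> ?F q \<inter> ?F q'"
    then have "\<forall>c\<in>diagram p. c \<in> diagram q \<longleftrightarrow> c \<in> diagram q'" by blast
    moreover have "diagram q \<subseteq> diagram p" "diagram q' \<subseteq> diagram p"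
      using that by (force simp: diagram_def interlace_def intro: less_le_trans)+
    ultimately have "diagram q = diagram q'" by blast
    then show False using cellsF_inj that(3) by blast
  qed
  have "card (tableaux (Suc N) \<mu> p) = (\<Sum>q\<in>?Q. card (?F q))"
  proof -
    have "card (\<Union>q\<in>?Q. ?F q) = (\<Sum>q\<in>?Q. card (?F q))"
    proof (rule card_UN_disjoint[OF finQ])
      show "\<forall>q\<in>?Q. finite (?F q)" using finite_tabl[OF Suc.prems(2), of "Suc N" \<mu>] by simp
      show "\<forall>q\<in>?Q. \<forall>q'\<in>?Q. q \<noteq> q' \<longrightarrow> ?F q \<inter> ?F q' = {}" using disj by blast
    qed
    then show ?thesis by (simp only: U[symmetric])
  qed
  also have "\<dots> = (\<Sum>q\<in>?Q. kostka N \<mu> q)"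
  proof (rule sum.cong[OF refl])
    fix q assume "q \<in> ?Q"
    then have q: "interlace q p" "psize p = psize q + \<mu> N" by auto
    have "card (?F q) = card (tableaux N \<mu> q)" by (rule bij_betw_same_card, rule tabl_fibre) (fact q Suc.prems(2))+
    also have "\<dots> = kostka N \<mu> q" using Suc.hyps interlace_dec[OF q(1)] interlace_fsupp[OF q(1)] Suc.prems by blast
    finally show "card (?F q) = kostka N \<mu> q" .
  qed
  finally show ?case by simp
qed

section \<open>From partitions as lists to row functions\<close>

definition row_length :: "nat list \<Rightarrow> nat \<Rightarrow> nat" where
  "row_length xs i = (if i < length xs then xs ! i else 0)"

lemma cells_rowf: "cells xs = diagram (row_length xs)"
  by (auto simp: cells_def diagram_def row_length_def split: if_splits)

lemma schur_eq_kos: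
  assumes xs: "decreasing (row_length xs)" "fsupp (row_length xs)" and N: "\<And>x. x \<in># m \<Longrightarrow> x < N"
  shows "schur xs m = int (kostka N (count m) (row_length xs))"
proof -
  let ?C = "diagram (row_length xs)"
  have fin: "finite ?C" by (rule finite_cellsF[OF xs(2)])
  have cnt: "count (image_mset T (mset_set ?C)) k = card {c \<in> ?C. T c = k}" for T k
  proof -
    have "{c \<in> ?C. T c = k} = T -` {k} \<inter> ?C" by auto
    then show ?thesis using fin by (simp add: count_image_mset)
  qed
  have "{T \<in> ssyt xs. image_mset T (mset_set (cells xs)) = m} = tableaux N (count m) (row_length xs)"
  proof (intro equalityI subsetI)
    fix T assume "T \<in> {T \<in> ssyt xs. image_mset T (mset_set (cells xs)) = m}"
    then have T: "T \<in> ssyt xs" and m: "image_mset T (mset_set ?C) = m" by (auto simp: cells_rowf)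
    have "T c < N" if "c \<in> ?C" for c
      by (rule N) (use that fin in \<open>auto simp flip: m\<close>)
    then show "T \<in> tableaux N (count m) (row_length xs)" using T unfolding ssyt_def tableaux_def cells_rowf
      by (simp add: cnt flip: m)
  next
    fix T assume T: "T \<in> tableaux N (count m) (row_length xs)"
    have "image_mset T (mset_set ?C) = m"
    proof (rule multiset_eqI)
      fix k show "count (image_mset T (mset_set ?C)) k = count m k"
      proof (cases "k < N")
        case True
        then show ?thesis using tablD(5)[OF T] by (simp add: cnt)
      next
        case False
        then have "{c \<in> ?C. T c = k} = {}" using tablD(4)[OF T] by auto
        then have "card {c \<in> ?C. T c = k} = 0" by (simp only: card.empty)
        moreover have "count m k = 0" using N[of k] False by (auto simp: count_eq_zero_iff)
        ultimately show ?thesis unfolding cnt by (simp only:)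
      qed
    qed
    then show "T \<in> {T \<in> ssyt xs. image_mset T (mset_set (cells xs)) = m}"
      using T unfolding ssyt_def tableaux_def cells_rowf by blast
  qed
  then show ?thesis by (simp add: schur_def monomial_sum_def card_tabl[OF xs])
qed

lemma rowf_partition:
  assumes "integer_partition xs" shows "row_length xs \<in> shapes (sum_list xs)"
proof -
  have "decreasing (row_length xs)" unfolding decreasing_def
  proof
    fix i show "row_length xs (Suc i) \<le> row_length xs i"
      using assms sorted_wrt_nth_less[of "(\<ge>)" xs i "Suc i"] by (auto simp: row_length_def integer_partition_def)
  qed
  moreover have z: "row_length xs i = 0" if "i \<ge> length xs" for i using that by (simp add: row_length_def)
  moreover have "fsupp (row_length xs)" by (rule fsupp_bounded) (rule z)
  moreover have "psize (row_length xs) = (\<Sum>i<length xs. row_length xs i)" by (rule psize_bounded) (rule z)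
  moreover have "(\<Sum>i<length xs. row_length xs i) = sum_list xs"
    by (simp add: sum_list_sum_nth row_length_def atLeast0LessThan)
  ultimately show ?thesis by (simp add: shapes_def)
qed

lemma bij_partition_shapes:
  "bij_betw row_length {xs. integer_partition xs \<and> sum_list xs = d} (shapes d)"
  unfolding bij_betw_def
proof (intro conjI equalityI subsetI)
  show "inj_on row_length {xs. integer_partition xs \<and> sum_list xs = d}"
  proof (rule inj_onI)
    fix xs ys assume "xs \<in> {xs. integer_partition xs \<and> sum_list xs = d}" "ys \<in> {xs. integer_partition xs \<and> sum_list xs = d}"
    then have *: "0 \<notin> set xs" "0 \<notin> set ys" by (auto simp: integer_partition_def)
    assume eq: "row_length xs = row_length ys"
    have supp: "{i. row_length zs i \<noteq> 0} = {..<length zs}" if "0 \<notin> set zs" for zs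
    proof -
      have "zs ! i \<noteq> 0" if "i < length zs" for i using \<open>0 \<notin> set zs\<close> nth_mem[OF that] by metis
      then show ?thesis by (auto simp: row_length_def)
    qed
    have len: "length xs = length ys" using supp[OF *(1)] supp[OF *(2)] eq by simp
    show "xs = ys"
    proof (rule nth_equalityI[OF len])
      fix i assume "i < length xs"
      then show "xs ! i = ys ! i" using fun_cong[OF eq, of i] len by (simp add: row_length_def)
    qed
  qed
next
  fix p assume "p \<in> row_length ` {xs. integer_partition xs \<and> sum_list xs = d}"
  then show "p \<in> shapes d" using rowf_partition by auto
next
  fix p assume p: "p \<in> shapes d"
  then have dp: "decreasing p" by (simp add: shapes_def)
  define r where "r = (LEAST i. p i = 0)"
  have r0: "p r = 0" unfolding r_def by (rule LeastI[of _ d]) (use shapes_bound[OF p] in simp)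
  have pos: "p i \<noteq> 0" if "i < r" for i using not_less_Least[OF that[unfolded r_def]] .
  define xs where "xs = map p [0..<r]"
  have "sorted_wrt (\<ge>) xs" unfolding xs_def sorted_wrt_map
    by (rule sorted_wrt_mono_rel[of _ "(<)"]) (use dec_antimono[OF dp] in auto)
  moreover have "0 \<notin> set xs" using pos by (force simp: xs_def)
  ultimately have inner: "integer_partition xs" by (simp add: integer_partition_def)
  have eq: "row_length xs = p"
  proof
    fix i show "row_length xs i = p i"
      using dec_antimono[OF dp, of r i] r0 by (cases "i < r") (auto simp: row_length_def xs_def)
  qed
  have "sum_list xs = d" using rowf_partition[OF inner] p by (simp add: eq shapes_def)
  then show "p \<in> row_length ` {xs. integer_partition xs \<and> sum_list xs = d}" using inner eq by blast
qed

theorem schur_positive_weight_module: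
  assumes W: "weight_module W"
    and f: "\<And>m. size m = d \<Longrightarrow> f m = int (dim (W (\<lambda>j. int (count m j))))"
    and f0: "\<And>m. size m \<noteq> d \<Longrightarrow> f m = 0"
  shows "schur_positive f"
proof -
  let ?P = "{xs. integer_partition xs \<and> sum_list xs = d}"
  define c where "c xs = (if xs \<in> ?P then int (dim (highest W (iw (row_length xs)))) else 0)" for xs
  have bij: "bij_betw row_length ?P (shapes d)" by (rule bij_partition_shapes)
  have finP: "finite ?P" using bij_betw_finite[OF bij] finite_shapes by blast
  have sub: "{xs. c xs \<noteq> 0} \<subseteq> ?P" by (auto simp: c_def)
  have "f m = (\<Sum>xs | c xs \<noteq> 0. c xs * schur xs m)" for m
  proof -
    obtain N where N: "\<And>x. x \<in># m \<Longrightarrow> x < N"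
      using finite_nat_set_iff_bounded[of "set_mset m"] by auto
    have m0: "count m i = 0" if "i \<ge> N" for i using N[of i] that by (auto simp: count_eq_zero_iff)
    have size: "(\<Sum>i<N. count m i) = size m"
      unfolding size_multiset_overloaded_eq
      by (rule sum.mono_neutral_right) (use N in \<open>auto simp: count_eq_zero_iff\<close>)
    have "(\<Sum>xs | c xs \<noteq> 0. c xs * schur xs m) = (\<Sum>xs\<in>?P. c xs * schur xs m)"
      by (rule sum.mono_neutral_left[OF finP sub]) auto
    also have "\<dots> = (\<Sum>xs\<in>?P. int (dim (highest W (iw (row_length xs))) * kostka N (count m) (row_length xs)))"
    proof (rule sum.cong[OF refl])
      fix xs assume xs: "xs \<in> ?P"
      then have "row_length xs \<in> shapes d" using rowf_partition by auto
      then have "schur xs m = int (kostka N (count m) (row_length xs))"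
        using N by (intro schur_eq_kos) (auto simp: shapes_def)
      then show "c xs * schur xs m = int (dim (highest W (iw (row_length xs))) * kostka N (count m) (row_length xs))"
        using xs by (simp only: c_def if_True of_nat_mult)
    qed
    also have "\<dots> = (\<Sum>p\<in>shapes d. int (dim (highest W (iw p)) * kostka N (count m) p))"
      by (rule sum.reindex_bij_betw[OF bij])
    also have "\<dots> = f m"
    proof (cases "size m = d")
      case True
      have "dim (W (iw (count m))) = (\<Sum>p\<in>shapes d. dim (highest W (iw p)) * kostka N (count m) p)"
        by (rule weight_module_kostka[OF W]) (use m0 size True in auto)
      then show ?thesis using f[OF True] by simp
    next
      case False
      \<comment> \<open>A nonzero Kostka number forces the size of the shape to be the size of the
        content.\<close>
      have "kostka N (count m) p = 0" if "p \<in> shapes d" for p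
        using kos_nonzero(3)[of N "count m" p] size False that by (auto simp: shapes_def)
      then show ?thesis using f0[OF False] by simp
    qed
    finally show ?thesis by simp
  qed
  then have "schur_expansion f c"
    unfolding schur_expansion_def using finite_subset[OF sub finP] sub by (auto simp: fun_eq_iff)
  moreover have "0 \<le> c xs" for xs by (simp add: c_def)
  ultimately show ?thesis unfolding schur_positive_def by blast
qed

section \<open>Lazard elimination\<close>

lemma finite_submultisets: "finite {M'. M' \<subseteq># (M :: 'a multiset)}"
proof (rule finite_subset)
  show "{M'. M' \<subseteq># M} \<subseteq> mset ` {xs. set xs \<subseteq> set_mset M \<and> length xs \<le> size M}"
  proof
    fix M' assume "M' \<in> {M'. M' \<subseteq># M}"
    moreover obtain xs where "mset xs = M'" using ex_mset by blast
    ultimately show "M' \<in> mset ` {xs. set xs \<subseteq> set_mset M \<and> length xs \<le> size M}"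
      using set_mset_mono[of M' M] size_mset_mono[of M' M] by (intro image_eqI[of _ _ xs]) auto
  qed
qed (simp add: finite_lists_length_le)

text \<open>The words in free generators \<open>A\<close>, i.e. a basis of the free associative
  algebra on \<open>A\<close>, in one weight.\<close>

definition weight_lists :: "('h \<Rightarrow> 'b multiset) \<Rightarrow> 'h set \<Rightarrow> 'b multiset \<Rightarrow> 'h list set" where
  "weight_lists wt A M = {xs. set xs \<subseteq> A \<and> sum_list (map wt xs) = M}"

text \<open>A multiset stands for the decreasing product of its elements.\<close>

definition weight_msets :: "('h \<Rightarrow> 'b multiset) \<Rightarrow> 'h set \<Rightarrow> 'b multiset \<Rightarrow> 'h multiset set" where
  "weight_msets wt A M = {X. set_mset X \<subseteq> A \<and> sum_mset (image_mset wt X) = M}"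

lemma MS_eq_WL: "weight_msets wt A M = mset ` weight_lists wt A M"
proof (intro equalityI subsetI)
  fix X assume X: "X \<in> weight_msets wt A M"
  obtain xs where "mset xs = X" using ex_mset by blast
  then show "X \<in> mset ` weight_lists wt A M" using X
    by (intro image_eqI[of _ _ xs]) (auto simp: weight_msets_def weight_lists_def simp flip: sum_mset_sum_list)
qed (auto simp: weight_msets_def weight_lists_def simp flip: sum_mset_sum_list)

lemma finite_WL:
  assumes "finite A" "\<And>x. x \<in> A \<Longrightarrow> wt x \<noteq> {#}" shows "finite (weight_lists wt A M)"
proof (rule finite_subset)
  have "length xs \<le> size (sum_list (map wt xs))" if "set xs \<subseteq> A" for xs
    using that
  proof (induct xs)
    case (Cons x xs)
    then have "wt x \<noteq> {#}" using assms(2) by simp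
    then have "1 \<le> size (wt x)" by (simp add: Suc_le_eq nonempty_has_size)
    then show ?case using Cons by simp
  qed simp
  then show "weight_lists wt A M \<subseteq> {xs. set xs \<subseteq> A \<and> length xs \<le> size M}" by (auto simp: weight_lists_def)
qed (simp add: finite_lists_length_le assms(1))

text \<open>The first letter other than \<open>x\<close> marks the end of a code word.\<close>

lemma prefix_code_inj:
  assumes "replicate k x @ y # u = replicate k' x @ y' # u'" "y \<noteq> x" "y' \<noteq> x"
  shows "k = k' \<and> y = y' \<and> u = u'"
  using assms(1)
proof (induct k arbitrary: k')
  case 0
  then show ?case using assms(2,3) by (cases k') auto
next
  case (Suc k)
  then show ?case using assms(2,3) by (cases k') auto
qed

section \<open>Elimination in an abstract Hall set\<close>

text \<open>
  \<open>G\<close> are the generators and \<open>dl x\<close>, \<open>dr x\<close> the two halves of a composite \<open>x\<close>.  Eliminating the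
  smallest element \<open>x\<close> of an up-closed set \<open>U\<close> replaces the free generators
  \<open>A = {z \<in> U. z \<in> G \<or> dl z \<notin> U}\<close> by the elements \<open>[x, [x, \<dots>, [x, a]]]\<close> with \<open>a \<in> A - {x}\<close>.  On the level of
  words such an element is expanded to \<open>x \<dots> x a\<close>, which is a prefix code.
\<close>

locale lazard =
  fixes H :: "'h set" and r :: "'h rel" and G :: "'h set" and gi :: "'h \<Rightarrow> 'b"
    and dl dr :: "'h \<Rightarrow> 'h" and wt :: "'h \<Rightarrow> 'b multiset"
  assumes order: "trans r" "irrefl r" "total_on H r"
    and G: "G \<subseteq> H" "inj_on gi G" "\<And>x. x \<in> G \<Longrightarrow> wt x = {#gi x#}"
    and split_mem: "\<And>x. x \<in> H - G \<Longrightarrow> dl x \<in> H \<and> dr x \<in> H"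
    and split_less: "\<And>x. x \<in> H - G \<Longrightarrow> (dl x, dr x) \<in> r \<and> (dl x, x) \<in> r"
    and split_wt: "\<And>x. x \<in> H - G \<Longrightarrow> wt x = wt (dl x) + wt (dr x)"
    and split_hall: "\<And>x. x \<in> H - G \<Longrightarrow> dr x \<notin> G \<Longrightarrow> dl (dr x) = dl x \<or> (dl (dr x), dl x) \<in> r"
    and split_inj: "\<And>x y. x \<in> H - G \<Longrightarrow> y \<in> H - G \<Longrightarrow> dl x = dl y \<Longrightarrow> dr x = dr y \<Longrightarrow> x = y"
    and wt_nonempty: "\<And>x. x \<in> H \<Longrightarrow> wt x \<noteq> {#}"
begin

text \<open>A composite is determined by its two halves, whose weights are strictly smaller; the
  elements of \<open>G\<close> are determined by their single letter.\<close>

lemma finite_wt: "finite {x \<in> H. wt x = M}"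
proof (induct M rule: measure_induct_rule[where f=size])
  case (less M)
  define S where "S = (\<Union>M'\<in>{M'. M' \<subseteq># M \<and> size M' < size M}. {x \<in> H. wt x = M'})"
  have finS: "finite S" unfolding S_def
    by (intro finite_UN_I finite_subset[OF _ finite_submultisets[of M]]) (auto intro: less)
  have "finite ({x \<in> H. wt x = M} \<inter> G)"
  proof (rule inj_on_finite[where f=gi and B="set_mset M"])
    show "inj_on gi ({x \<in> H. wt x = M} \<inter> G)" using G(2) by (rule inj_on_subset) auto
  qed (use G(3) in fastforce)+
  moreover have "finite ({x \<in> H. wt x = M} - G)"
  proof (rule inj_on_finite[where f="\<lambda>x. (dl x, dr x)" and B="S \<times> S"])
    show "inj_on (\<lambda>x. (dl x, dr x)) ({x \<in> H. wt x = M} - G)"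
    proof (rule inj_onI)
      fix x y assume "x \<in> {x \<in> H. wt x = M} - G" "y \<in> {x \<in> H. wt x = M} - G" "(dl x, dr x) = (dl y, dr y)"
      then show "x = y" using split_inj[of x y] by simp
    qed
    show "(\<lambda>x. (dl x, dr x)) ` ({x \<in> H. wt x = M} - G) \<subseteq> S \<times> S"
    proof (intro image_subsetI SigmaI)
      fix x assume "x \<in> {x \<in> H. wt x = M} - G"
      then have x: "x \<in> H - G" and M: "M = wt (dl x) + wt (dr x)" using split_wt[of x] by auto
      have "0 < size (wt (dl x))" "0 < size (wt (dr x))"
        using split_mem[OF x] wt_nonempty by (simp_all flip: nonempty_has_size)
      then show "dl x \<in> S" "dr x \<in> S" using split_mem[OF x] unfolding S_def M by auto
    qed
  qed (use finS in simp)
  ultimately show ?case by (metis (no_types, lifting) Int_Diff_Un finite_Un)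
qed

lemma finite_wt_le: "finite {x \<in> H. wt x \<subseteq># M}"
proof -
  have "{x \<in> H. wt x \<subseteq># M} = (\<Union>M'\<in>{M'. M' \<subseteq># M}. {x \<in> H. wt x = M'})" by auto
  then show ?thesis using finite_submultisets[of M] finite_wt by auto
qed

function expand :: "'h \<Rightarrow> 'h \<Rightarrow> 'h list" where
  "expand x z = (if z \<in> H - G \<and> dl z = x then x # expand x (dr z) else [z])"
  by auto
termination
proof (relation "measure (\<lambda>(x, z). size (wt z))")
  fix x z assume z: "z \<in> H - G \<and> dl z = x"
  then have "0 < size (wt (dl z))" using split_mem[of z] wt_nonempty[of "dl z"] by (simp flip: nonempty_has_size)
  then show "((x, dr z), (x, z)) \<in> measure (\<lambda>(x, z). size (wt z))" using split_wt[of z] z by simp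
qed simp

declare expand.simps [simp del]

lemma sum_expand: "z \<in> H \<Longrightarrow> sum_list (map wt (expand x z)) = wt z"
proof (induct x z rule: expand.induct)
  case (1 x z)
  then show ?case using split_mem[of z] split_wt[of z] expand.simps[of x z] by (cases "z \<in> H - G \<and> dl z = x") auto
qed

lemma expand_nonempty: "expand x z \<noteq> []"
  by (subst expand.simps) simp

lemma expand_inj: "z \<in> H \<Longrightarrow> z' \<in> H \<Longrightarrow> expand x z = expand x z' \<Longrightarrow> z = z'"
proof (induct x z arbitrary: z' rule: expand.induct)
  case (1 x z)
  show ?case
  proof (cases "z \<in> H - G \<and> dl z = x")
    case True
    then have e: "expand x z = x # expand x (dr z)" by (subst expand.simps) simp
    have z': "z' \<in> H - G \<and> dl z' = x"
    proof (rule ccontr)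
      assume "\<not> ?thesis"
      then have "expand x z' = [z']" by (subst expand.simps) auto
      then show False using 1(4) e expand_nonempty by simp
    qed
    then have "expand x z' = x # expand x (dr z')" by (subst expand.simps) simp
    then have "expand x (dr z) = expand x (dr z')" using 1(4) e by simp
    then have "dr z = dr z'" using 1(1)[OF True, of "dr z'"] split_mem[of z] split_mem[of z'] True z' by simp
    then show ?thesis using split_inj[of z z'] True z' by simp
  next
    case False
    then have e: "expand x z = [z]" by (subst expand.simps) auto
    show ?thesis
    proof (cases "z' \<in> H - G \<and> dl z' = x")
      case True
      then have "expand x z' = x # expand x (dr z')" by (subst expand.simps) simp
      then show ?thesis using 1(4) e expand_nonempty[of x "dr z'"] by simp
    next
      case False
      then have "expand x z' = [z']" by (subst expand.simps) auto
      then show ?thesis using 1(4) e by simp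
    qed
  qed
qed

text \<open>The bound \<open>M\<close> keeps \<open>U\<close> finite. Accordingly \<open>U\<close>
  is up-closed only among the elements of weight at most \<open>M\<close>.\<close>

context
  fixes M U x
  assumes U: "U \<subseteq> {x \<in> H. wt x \<subseteq># M}"
    and up_closed: "\<And>y z. y \<in> U \<Longrightarrow> z \<in> H \<Longrightarrow> wt z \<subseteq># M \<Longrightarrow> (y, z) \<in> r \<Longrightarrow> z \<in> U"
    and min: "x \<in> U" "\<And>y. y \<in> U \<Longrightarrow> y \<noteq> x \<Longrightarrow> (x, y) \<in> r"
begin

abbreviation (input) "gens V \<equiv> {z \<in> V. z \<in> G \<or> dl z \<notin> V}"

text \<open>If \<open>dl z = x\<close>, the Hall condition puts \<open>dl (dr z)\<close> at or below
  \<open>x\<close>, hence outside \<open>U - {x}\<close>. So \<open>dr z\<close> is again a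
  generator after the elimination, and the expansion goes on until it meets an old generator other
  than \<open>x\<close>.\<close>

lemma expand_form:
  "z \<in> gens (U - {x}) \<Longrightarrow> \<exists>k y. expand x z = replicate k x @ [y] \<and> y \<in> gens U \<and> y \<noteq> x"
proof (induct z rule: measure_induct_rule[where f="\<lambda>z. size (wt z)"])
  case (less z)
  note z = less.prems
  show ?case
    proof (cases "z \<in> H - G \<and> dl z = x")
      case True
      then have zH: "z \<in> H - G" by blast
      have "wt (dl z) + wt (dr z) \<subseteq># M" using U z split_wt[OF zH] by auto
      then have "wt (dr z) \<subseteq># M" by (rule subset_mset.order_trans[OF mset_subset_eq_add_right])
      then have drU: "dr z \<in> U" using up_closed[OF min(1)] split_mem[OF zH] split_less[OF zH] True by auto
      have "dr z \<noteq> x" using split_less[OF zH] True order(2) by (auto simp: irrefl_def)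
      moreover have "dr z \<in> G \<or> dl (dr z) \<notin> U - {x}"
      proof (rule ccontr)
        assume a: "\<not> ?thesis"
        then have "(dl (dr z), x) \<in> r" using split_hall[OF zH] True by auto
        moreover have "(x, dl (dr z)) \<in> r" using a min(2) by blast
        ultimately show False using order(1,2) by (meson irrefl_def transD)
      qed
      ultimately have "dr z \<in> gens (U - {x})" using drU by blast
      moreover have "size (wt (dr z)) < size (wt z)"
        using split_wt[OF zH] wt_nonempty split_mem[OF zH] by (simp add: nonempty_has_size)
      ultimately obtain k y where "expand x (dr z) = replicate k x @ [y]" "y \<in> gens U" "y \<noteq> x"
        using less.hyps[of "dr z"] by blast
      moreover have "expand x z = x # expand x (dr z)" using True by (subst expand.simps) simp
      ultimately show ?thesis by (intro exI[of _ "Suc k"] exI[of _ y]) simp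
    next
      case False
      then have "expand x z = replicate 0 x @ [z]" by (subst expand.simps) auto
      moreover have "z \<in> gens U" using z False U by auto
      ultimately show ?thesis using z by blast
    qed
qed

lemma min_gens: "x \<in> gens U"
proof (rule ccontr)
  assume "x \<notin> gens U"
  then have x: "x \<in> H - G" "dl x \<in> U" using min(1) U by auto
  then have "(dl x, x) \<in> r" using split_less by blast
  moreover from this have "(x, dl x) \<in> r" using min(2)[OF x(2)] order(2) unfolding irrefl_def by metis
  ultimately have "(x, x) \<in> r" using order(1) by (metis transD)
  then show False using order(2) by (simp add: irrefl_def)
qed

text \<open>The expansion embeds the words in the new generators into those words in the old ones
  that do not end in \<open>x\<close>. The words that do end in \<open>x\<close> are obtained by
  appending \<open>x\<close> to a word of weight \<open>N - wt x\<close>.\<close>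

lemma card_WL_step:
  "card (weight_lists wt (gens (U - {x})) N) + (if wt x \<subseteq># N then card (weight_lists wt (gens U) (N - wt x)) else 0) \<le> card (weight_lists wt (gens U) N)"
proof -
  let ?f = "\<lambda>xs. concat (map (expand x) xs)"
  have finU: "finite U" using U finite_wt_le finite_subset by blast
  have fin: "finite (weight_lists wt (gens U) N)" for N
    by (rule finite_WL) (use finU U wt_nonempty in auto)
  have inj: "inj_on ?f (weight_lists wt (gens (U - {x})) N)"
  proof (rule inj_onI)
    fix xs ys assume "xs \<in> weight_lists wt (gens (U - {x})) N" "ys \<in> weight_lists wt (gens (U - {x})) N" "?f xs = ?f ys"
    then have "set xs \<subseteq> gens (U - {x})" "set ys \<subseteq> gens (U - {x})" "?f xs = ?f ys" by (auto simp: weight_lists_def)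
    then show "xs = ys"
    proof (induct xs arbitrary: ys)
      case Nil
      then show ?case using expand_nonempty by (cases ys) auto
    next
      case (Cons a xs)
      then obtain b ys' where ys: "ys = b # ys'"
        using Cons.prems(3) expand_nonempty[of x a] by (cases ys) auto
      have ab: "a \<in> gens (U - {x})" "b \<in> gens (U - {x})" using Cons.prems ys by auto
      obtain k y where a: "expand x a = replicate k x @ [y]" "y \<noteq> x" using expand_form[OF ab(1)] by blast
      obtain k' y' where b: "expand x b = replicate k' x @ [y']" "y' \<noteq> x" using expand_form[OF ab(2)] by blast
      have "replicate k x @ y # ?f xs = replicate k' x @ y' # ?f ys'" using Cons.prems(3) a b by (simp add: ys)
      from prefix_code_inj[OF this a(2) b(2)] have e: "expand x a = expand x b" "?f xs = ?f ys'" using a b by auto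
      have "a = b" by (rule expand_inj[OF _ _ e(1)]) (use ab U in blast)+
      moreover have "xs = ys'" by (rule Cons.hyps) (use Cons.prems ys e(2) in auto)
      ultimately show ?case by (simp add: ys)
    qed
  qed
  have im: "?f ` weight_lists wt (gens (U - {x})) N \<subseteq> {xs \<in> weight_lists wt (gens U) N. xs \<noteq> [] \<longrightarrow> last xs \<noteq> x}"
  proof (rule image_subsetI)
    fix xs assume "xs \<in> weight_lists wt (gens (U - {x})) N"
    then have xs: "set xs \<subseteq> gens (U - {x})" "sum_list (map wt xs) = N" by (auto simp: weight_lists_def)
    have "sum_list (map wt (?f xs)) = sum_list (map wt xs) \<and> set (?f xs) \<subseteq> gens U \<and> (?f xs \<noteq> [] \<longrightarrow> last (?f xs) \<noteq> x)"
      using xs(1)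
    proof (induct xs)
      case (Cons a xs)
      then have a: "a \<in> gens (U - {x})" by simp
      obtain k y where e: "expand x a = replicate k x @ [y]" "y \<in> gens U" "y \<noteq> x" using expand_form[OF a] by blast
      have "x \<in> gens U" by (rule min_gens)
      then have sub: "set (expand x a) \<subseteq> gens U" using e(1,2) by auto
      have sm: "sum_list (map wt (expand x a)) = wt a" using sum_expand a U by auto
      have IH: "sum_list (map wt (?f xs)) = sum_list (map wt xs)" "set (?f xs) \<subseteq> gens U" "?f xs \<noteq> [] \<longrightarrow> last (?f xs) \<noteq> x"
        using Cons by auto
      have eq: "?f (a # xs) = expand x a @ ?f xs" by simp
      have "last (expand x a) \<noteq> x" using e(1,3) by simp
      then have "last (?f (a # xs)) \<noteq> x" unfolding eq using IH(3) by (cases "?f xs = []") (simp_all only: append_Nil2 last_appendR simp_thms)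
      moreover have "sum_list (map wt (?f (a # xs))) = sum_list (map wt (a # xs))"
        unfolding eq map_append sum_list_append sm IH(1) by simp
      moreover have "set (?f (a # xs)) \<subseteq> gens U" unfolding eq set_append using sub IH(2) by blast
      ultimately show ?case by blast
    qed simp
    then show "?f xs \<in> {xs \<in> weight_lists wt (gens U) N. xs \<noteq> [] \<longrightarrow> last xs \<noteq> x}" using xs(2) by (auto simp: weight_lists_def)
  qed
  have xg: "x \<in> gens U" by (rule min_gens)
  have 1: "card (weight_lists wt (gens (U - {x})) N) \<le> card {xs \<in> weight_lists wt (gens U) N. xs \<noteq> [] \<longrightarrow> last xs \<noteq> x}"
    by (rule card_inj_on_le[OF inj im]) (use fin in simp)
  have 2: "(if wt x \<subseteq># N then card (weight_lists wt (gens U) (N - wt x)) else 0) \<le>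
      card {xs \<in> weight_lists wt (gens U) N. \<not> (xs \<noteq> [] \<longrightarrow> last xs \<noteq> x)}"
  proof (cases "wt x \<subseteq># N")
    case True
    have "card (weight_lists wt (gens U) (N - wt x)) \<le> card {xs \<in> weight_lists wt (gens U) N. \<not> (xs \<noteq> [] \<longrightarrow> last xs \<noteq> x)}"
    proof (rule card_inj_on_le[where f="\<lambda>xs. xs @ [x]"])
      show "(\<lambda>xs. xs @ [x]) ` weight_lists wt (gens U) (N - wt x) \<subseteq> {xs \<in> weight_lists wt (gens U) N. \<not> (xs \<noteq> [] \<longrightarrow> last xs \<noteq> x)}"
        using xg True by (auto simp: weight_lists_def)
    qed (use fin in \<open>auto simp: inj_on_def\<close>)
    then show ?thesis using True by simp
  qed simp
  have "card {xs \<in> weight_lists wt (gens U) N. xs \<noteq> [] \<longrightarrow> last xs \<noteq> x} +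
      card {xs \<in> weight_lists wt (gens U) N. \<not> (xs \<noteq> [] \<longrightarrow> last xs \<noteq> x)} = card (weight_lists wt (gens U) N)"
    using fin by (subst card_Un_disjoint[symmetric]) (auto intro!: arg_cong[where f=card])
  then show ?thesis using 1 2 by linarith
qed

end

text \<open>The recursion that matches \<open>card_WL_step\<close>, according to whether the
  multiset contains \<open>x\<close>.\<close>

lemma card_MS_step:
  assumes "x \<in> U" "finite U" "U \<subseteq> H"
  shows "card (weight_msets wt U N) = card (weight_msets wt (U - {x}) N) + (if wt x \<subseteq># N then card (weight_msets wt U (N - wt x)) else 0)"
proof -
  have fin: "finite (weight_msets wt V N)" if "V \<subseteq> U" for V N
    unfolding MS_eq_WL by (intro finite_imageI finite_WL) (use that assms wt_nonempty finite_subset in auto)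
  have eq: "weight_msets wt U N = weight_msets wt (U - {x}) N \<union> (if wt x \<subseteq># N then add_mset x ` weight_msets wt U (N - wt x) else {})"
  proof (intro equalityI subsetI)
    fix X assume X: "X \<in> weight_msets wt U N"
    show "X \<in> weight_msets wt (U - {x}) N \<union> (if wt x \<subseteq># N then add_mset x ` weight_msets wt U (N - wt x) else {})"
    proof (cases "x \<in># X")
      case True
      then obtain Y where Y: "X = add_mset x Y" by (metis insert_DiffM)
      then have "wt x \<subseteq># N" "Y \<in> weight_msets wt U (N - wt x)" using X by (auto simp: weight_msets_def)
      then show ?thesis using Y by simp
    next
      case False
      then show ?thesis using X by (auto simp: weight_msets_def)
    qed
  next
    fix X assume "X \<in> weight_msets wt (U - {x}) N \<union> (if wt x \<subseteq># N then add_mset x ` weight_msets wt U (N - wt x) else {})"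
    then show "X \<in> weight_msets wt U N" using assms(1) by (auto simp: weight_msets_def split: if_splits)
  qed
  have x: "x \<notin># X" if "X \<in> weight_msets wt (U - {x}) N" for X using that by (auto simp: weight_msets_def)
  show ?thesis
  proof (cases "wt x \<subseteq># N")
    case True
    have "card (weight_msets wt U N) = card (weight_msets wt (U - {x}) N) + card (add_mset x ` weight_msets wt U (N - wt x))"
      unfolding eq if_P[OF True]
    proof (rule card_Un_disjoint)
      show "weight_msets wt (U - {x}) N \<inter> add_mset x ` weight_msets wt U (N - wt x) = {}"
      proof (rule equals0I)
        fix X assume "X \<in> weight_msets wt (U - {x}) N \<inter> add_mset x ` weight_msets wt U (N - wt x)"
        then show False using x[of X] by auto
      qed
    qed (simp_all add: fin)
    moreover have "card (add_mset x ` weight_msets wt U (N - wt x)) = card (weight_msets wt U (N - wt x))"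
      by (rule card_image) (simp add: inj_on_def)
    ultimately show ?thesis using True by simp
  next
    case False
    then show ?thesis using eq by simp
  qed
qed

lemma finite_total_min:
  assumes "finite U" "U \<noteq> {}" "U \<subseteq> H" obtains x where "x \<in> U" "\<And>y. y \<in> U \<Longrightarrow> y \<noteq> x \<Longrightarrow> (x, y) \<in> r"
proof -
  have "\<exists>x\<in>U. \<forall>y\<in>U. y \<noteq> x \<longrightarrow> (x, y) \<in> r" using assms
  proof (induct U rule: finite_ne_induct)
    case (insert a U)
    then obtain x where x: "x \<in> U" "\<forall>y\<in>U. y \<noteq> x \<longrightarrow> (x, y) \<in> r" by auto
    have "a \<noteq> x" using insert x by auto
    then consider "(a, x) \<in> r" | "(x, a) \<in> r" using order(3) insert.prems x(1) by (auto simp: total_on_def)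
    then show ?case
    proof cases
      case 1
      then have "(a, y) \<in> r" if "y \<in> U" for y using x(2) that order(1) by (metis transD)
      then show ?thesis by auto
    qed (use x in auto)
  qed auto
  then show ?thesis using that by blast
qed

text \<open>Comparison of the two recursions, by induction on the size of \<open>U\<close> for the
  terms without \<open>x\<close> and on the size of \<open>N\<close> for those with
  \<open>x\<close>.\<close>

lemma card_MS_le_WL:
  assumes "finite U" "U \<subseteq> {x \<in> H. wt x \<subseteq># M}"
    and "\<And>y z. y \<in> U \<Longrightarrow> z \<in> H \<Longrightarrow> wt z \<subseteq># M \<Longrightarrow> (y, z) \<in> r \<Longrightarrow> z \<in> U"
  shows "card (weight_msets wt U N) \<le> card (weight_lists wt {z \<in> U. z \<in> G \<or> dl z \<notin> U} N)"
  using assms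
proof (induct U arbitrary: N rule: measure_induct_rule[where f=card])
  case (less U)
  note finU = less.prems(1) and bounded = less.prems(2) and up = less.prems(3)
  show ?case
  proof (cases "U = {}")
    case True
    have "weight_msets wt {} N = mset ` weight_lists wt {} N" by (rule MS_eq_WL)
    then show ?thesis using True by (simp add: card_image_le weight_lists_def)
  next
    case False
    obtain x where x: "x \<in> U" "\<And>y. y \<in> U \<Longrightarrow> y \<noteq> x \<Longrightarrow> (x, y) \<in> r"
      using finite_total_min[OF less.prems(1) False] less.prems(2) by blast
    have IH: "card (weight_msets wt (U - {x}) N) \<le> card (weight_lists wt {z \<in> U - {x}. z \<in> G \<or> dl z \<notin> U - {x}} N)" for N
    proof (rule less.hyps)
      show "card (U - {x}) < card U" using x(1) less.prems(1) by (rule card_Diff1_less[rotated])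
      fix y z assume yz: "y \<in> U - {x}" "z \<in> H" "wt z \<subseteq># M" "(y, z) \<in> r"
      have "(x, y) \<in> r" using x(2) yz(1) by blast
      then have "(x, z) \<in> r" using yz(4) order(1) by (meson transD)
      then have "z \<noteq> x" using order(2) by (auto simp: irrefl_def)
      then show "z \<in> U - {x}" using less.prems(3) yz by blast
    qed (use less.prems in auto)
    show ?thesis
    proof (induct N rule: measure_induct_rule[where f=size])
      case (less N)
      have UH: "U \<subseteq> H" using bounded by blast
      have "size (N - wt x) < size N" if "wt x \<subseteq># N"
      proof -
        have "wt x \<noteq> {#}" using wt_nonempty x(1) UH by blast
        then have "0 < size (wt x)" by (simp add: nonempty_has_size)
        then show ?thesis using that size_Diff_submset[OF that] size_mset_mono[OF that] by linarith
      qed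
      then have smaller: "wt x \<subseteq># N \<Longrightarrow> card (weight_msets wt U (N - wt x)) \<le> card (weight_lists wt {z \<in> U. z \<in> G \<or> dl z \<notin> U} (N - wt x))"
        using less by blast
      have step: "card (weight_lists wt {z \<in> U - {x}. z \<in> G \<or> dl z \<notin> U - {x}} N) +
          (if wt x \<subseteq># N then card (weight_lists wt {z \<in> U. z \<in> G \<or> dl z \<notin> U} (N - wt x)) else 0)
          \<le> card (weight_lists wt {z \<in> U. z \<in> G \<or> dl z \<notin> U} N)"
        by (rule card_WL_step[where M=M]) (fact bounded up x)+
      have "(if wt x \<subseteq># N then card (weight_msets wt U (N - wt x)) else 0) \<le>
          (if wt x \<subseteq># N then card (weight_lists wt {z \<in> U. z \<in> G \<or> dl z \<notin> U} (N - wt x)) else 0)"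
        using smaller by simp
      with IH[of N] have "card (weight_msets wt U N) \<le> card (weight_lists wt {z \<in> U - {x}. z \<in> G \<or> dl z \<notin> U - {x}} N) +
          (if wt x \<subseteq># N then card (weight_lists wt {z \<in> U. z \<in> G \<or> dl z \<notin> U} (N - wt x)) else 0)"
        unfolding card_MS_step[OF x(1) finU UH, where N=N] by (rule add_mono)
      also note step
      finally show ?case .
    qed
  qed
qed

theorem card_MS_le_words: "finite (weight_msets wt H M)" "card (weight_msets wt H M) \<le> card {w. mset w = M}"
proof -
  let ?U = "{x \<in> H. wt x \<subseteq># M}"
  have finU: "finite ?U" by (rule finite_wt_le)
  have "wt x \<subseteq># M" if "X \<in> weight_msets wt H M" "x \<in># X" for X x
  proof -
    obtain Y where "X = add_mset x Y" using \<open>x \<in># X\<close> by (metis insert_DiffM)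
    then show ?thesis using \<open>X \<in> weight_msets wt H M\<close> by (auto simp: weight_msets_def)
  qed
  then have eq: "weight_msets wt H M = weight_msets wt ?U M" by (auto simp: weight_msets_def)
  show "finite (weight_msets wt H M)" unfolding eq unfolding MS_eq_WL
    by (rule finite_imageI, rule finite_WL[OF finU]) (use wt_nonempty in blast)
  \<comment> \<open>When \<open>U\<close> consists of all elements of weight at most
    \<open>M\<close>, it contains the left half of each of its composites, so only generators in
    \<open>G\<close> are left.\<close>
  have sub: "{z \<in> ?U. z \<in> G \<or> dl z \<notin> ?U} \<subseteq> G"
  proof
    fix z assume z: "z \<in> {z \<in> ?U. z \<in> G \<or> dl z \<notin> ?U}"
    show "z \<in> G"
    proof (rule ccontr)
      assume "z \<notin> G"
      then have zH: "z \<in> H - G" using z by blast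
      have "wt (dl z) + wt (dr z) \<subseteq># M" using z split_wt[OF zH] by auto
      then have "wt (dl z) \<subseteq># M" by (rule subset_mset.order_trans[OF mset_subset_eq_add_left])
      then show False using split_mem[OF zH] z \<open>z \<notin> G\<close> by blast
    qed
  qed
  have words: "finite {w. mset w = M}"
  proof -
    have "{w. mset w = M} \<subseteq> {w. set w \<subseteq> set_mset M \<and> length w \<le> size M}" by auto
    then show ?thesis by (rule finite_subset) (simp add: finite_lists_length_le)
  qed
  have "card (weight_msets wt ?U M) \<le> card (weight_lists wt {z \<in> ?U. z \<in> G \<or> dl z \<notin> ?U} M)"
    by (rule card_MS_le_WL[OF finU]) auto
  also have "\<dots> \<le> card {w. mset w = M}"
  proof (rule card_inj_on_le[where f="map gi"])
    show "inj_on (map gi) (weight_lists wt {z \<in> ?U. z \<in> G \<or> dl z \<notin> ?U} M)"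
      by (rule inj_on_mapI, rule inj_on_subset[OF G(2)]) (use sub in \<open>fastforce simp: weight_lists_def\<close>)
    have "sum_list (map wt xs) = mset (map gi xs)" if "set xs \<subseteq> G" for xs
      using that by (induct xs) (auto simp: G(3))
    then show "map gi ` weight_lists wt {z \<in> ?U. z \<in> G \<or> dl z \<notin> ?U} M \<subseteq> {w. mset w = M}"
      using sub by (fastforce simp: weight_lists_def)
  qed (rule words)
  finally show "card (weight_msets wt H M) \<le> card {w. mset w = M}" unfolding eq .
qed

end

section \<open>Hall polynomials\<close>

definition comm :: "'a::ring \<Rightarrow> 'a \<Rightarrow> 'a" where "comm x y = x * y - y * x"

lemma comm_simps [simp]: "comm 0 y = 0" "comm x 0 = 0" "comm x x = 0"
  by (simp_all add: comm_def)

lemma comm_add: "comm (x + x') y = comm x y + comm x' y" "comm x (y + y') = comm x y + comm x y'"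
  by (simp_all add: comm_def algebra_simps)

lemma comm_scaleR: "comm (c *\<^sub>R x) y = c *\<^sub>R comm x y" "comm x (c *\<^sub>R y) = c *\<^sub>R comm x (y :: 'a::real_algebra)"
  by (simp_all add: comm_def algebra_simps)

lemma comm_sum: "comm (sum f A) (sum g B) = (\<Sum>s\<in>A. \<Sum>t\<in>B. comm (f s) (g t))"
proof -
  have "sum g B * sum f A = (\<Sum>s\<in>A. \<Sum>t\<in>B. g t * f s)" by (subst sum.swap) (rule sum_product)
  then show ?thesis by (simp add: comm_def sum_product sum_subtractf)
qed

lift_definition to_complex :: "real tensor \<Rightarrow> complex tensor" is "\<lambda>f u. of_real (f u)" .
lift_definition real_part :: "complex tensor \<Rightarrow> real tensor" is "\<lambda>f u. Re (f u)" .
lift_definition cscale :: "complex \<Rightarrow> complex tensor \<Rightarrow> complex tensor" is "\<lambda>c f u. c * f u" .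

lemma rpart_cx [simp]: "real_part (to_complex f) = f"
  by transfer simp

lemma cx_mult: "to_complex (f * g) = to_complex f * to_complex g"
proof -
  have "of_real (conv u f g) = conv u (\<lambda>w. of_real (f w)) (\<lambda>w. of_real (g w) :: complex)" for u f g
    by (induct u arbitrary: f) simp_all
  then show ?thesis by transfer simp
qed

lemma cx_comm: "to_complex (comm f g) = comm (to_complex f) (to_complex g)"
proof -
  have "to_complex (f - g) = to_complex f - to_complex g" for f g by transfer simp
  then show ?thesis by (simp add: comm_def cx_mult)
qed

lemma csc_simps: "cscale 0 f = 0" "cscale c 0 = 0" "cscale 1 f = f" "cscale (c + d) f = cscale c f + cscale d f"
  "cscale (c - d) f = cscale c f - cscale d f" "cscale (c * d) f = cscale c (cscale d f)"
  "cscale c (f + g) = cscale c f + cscale c g" "cscale c (f - g) = cscale c f - cscale c g"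
  by (transfer, simp add: algebra_simps)+

lemma csc_sum: "cscale c (sum f A) = (\<Sum>t\<in>A. cscale c (f t))"
  by (induct A rule: infinite_finite_induct) (simp_all add: csc_simps)

lemma csc_mult: "cscale c f * g = cscale c (f * g)" "f * cscale c g = cscale c (f * g)"
proof -
  have "conv u (\<lambda>w. c * f w) g = c * conv u f g" "conv u f (\<lambda>w. c * g w) = c * conv u f g"
    for u and f g :: "nat list \<Rightarrow> complex"
    by (induct u arbitrary: f) (simp_all add: algebra_simps)
  then show "cscale c f * g = cscale c (f * g)" "f * cscale c g = cscale c (f * g)" by (transfer, simp)+
qed

lemma comm_csc: "comm (cscale c f) (cscale d g) = cscale (c * d) (comm f g)"
  by (simp add: comm_def csc_mult csc_simps) (metis csc_simps(6) mult.commute)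

section \<open>The map from the free Lie algebra to tensors\<close>

primrec assoc :: "nat bracketing \<Rightarrow> real tensor" where
  "assoc (Leaf i) = monom [i]"
| "assoc (Node s t) = comm (assoc s) (assoc t)"

primrec leaves :: "nat bracketing \<Rightarrow> nat multiset" where
  "leaves (Leaf i) = {#i#}"
| "leaves (Node s t) = leaves s + leaves t"

definition assoc_poly :: "(nat bracketing \<Rightarrow>\<^sub>0 complex) \<Rightarrow> complex tensor" where
  "assoc_poly p = (\<Sum>t\<in>Poly_Mapping.keys p. cscale (Poly_Mapping.lookup p t) (to_complex (assoc t)))"

lemma Pc_eq:
  assumes "finite A" "Poly_Mapping.keys p \<subseteq> A"
  shows "assoc_poly p = (\<Sum>t\<in>A. cscale (Poly_Mapping.lookup p t) (to_complex (assoc t)))"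
  unfolding assoc_poly_def using assms
  by (intro sum.mono_neutral_left) (auto simp: in_keys_iff csc_simps)

lemma Pc_add: "assoc_poly (p + q) = assoc_poly p + assoc_poly q"
proof -
  let ?A = "Poly_Mapping.keys p \<union> Poly_Mapping.keys q"
  have "Poly_Mapping.keys (p + q) \<subseteq> ?A" by (rule Poly_Mapping.keys_add)
  then show ?thesis
    using Pc_eq[of ?A p] Pc_eq[of ?A q] Pc_eq[of ?A "p + q"]
    by (simp add: lookup_add csc_simps sum.distrib)
qed

lemma Pc_diff: "assoc_poly (p - q) = assoc_poly p - assoc_poly q"
  using Pc_add[of "p - q" q] by simp

lemma Pc_scale: "assoc_poly (free_scale c p) = cscale c (assoc_poly p)"
proof -
  have "Poly_Mapping.keys (free_scale c p) \<subseteq> Poly_Mapping.keys p"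
    by (auto simp: in_keys_iff free_scale.rep_eq)
  then have "assoc_poly (free_scale c p) = (\<Sum>t\<in>Poly_Mapping.keys p. cscale (c * Poly_Mapping.lookup p t) (to_complex (assoc t)))"
    by (simp add: Pc_eq[of "Poly_Mapping.keys p"] free_scale.rep_eq)
  then show ?thesis by (simp add: assoc_poly_def csc_sum csc_simps)
qed

lemma Pc_mult: "assoc_poly (free_mult p q) = comm (assoc_poly p) (assoc_poly q)"
proof -
  let ?A = "Poly_Mapping.keys p" and ?B = "Poly_Mapping.keys q"
  let ?N = "\<lambda>(s, t). Node s t"
  have "Poly_Mapping.keys (free_mult p q) \<subseteq> ?N ` (?A \<times> ?B)"
  proof
    fix x assume "x \<in> Poly_Mapping.keys (free_mult p q)"
    then show "x \<in> ?N ` (?A \<times> ?B)"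
      by (cases x) (auto simp: in_keys_iff free_mult.rep_eq)
  qed
  then have "assoc_poly (free_mult p q) = (\<Sum>x\<in>?N ` (?A \<times> ?B). cscale (Poly_Mapping.lookup (free_mult p q) x) (to_complex (assoc x)))"
    by (intro Pc_eq) auto
  also have "\<dots> = (\<Sum>(s, t)\<in>?A \<times> ?B. cscale (Poly_Mapping.lookup p s * Poly_Mapping.lookup q t) (comm (to_complex (assoc s)) (to_complex (assoc t))))"
    by (subst sum.reindex) (auto simp: inj_on_def free_mult.rep_eq cx_comm case_prod_unfold)
  also have "\<dots> = comm (assoc_poly p) (assoc_poly q)"
    unfolding assoc_poly_def comm_sum comm_csc by (simp add: sum.cartesian_product)
  finally show ?thesis .
qed

lemma Pc_ideal: "p \<in> lie_ideal \<Longrightarrow> assoc_poly p = 0"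
proof (induct rule: lie_ideal.induct)
  case zero
  show ?case by (simp add: assoc_poly_def)
next
  case (jacobi p q s)
  show ?case by (simp add: Pc_add Pc_mult comm_def algebra_simps)
qed (simp_all add: Pc_add Pc_scale Pc_mult csc_simps)

lift_definition lie_tensor :: "nat free_lie \<Rightarrow> complex tensor" is assoc_poly
  unfolding lie_cong_def using Pc_ideal Pc_diff by fastforce

lemma lie_tensor_gen: "lie_tensor (lie_gen i) = to_complex (monom [i])"
  by transfer (simp add: assoc_poly_def csc_simps)

lemma lie_tensor_bracket: "lie_tensor (lie_bracket X Y) = comm (lie_tensor X) (lie_tensor Y)"
  by transfer (rule Pc_mult)

definition hall_poly :: "nat free_lie \<Rightarrow> real tensor" where
  "hall_poly X = real_part (lie_tensor X)"

definition mweight :: "nat multiset \<Rightarrow> nat \<Rightarrow> int" where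
  "mweight M = (\<lambda>j. int (count M j))"

lemma ctn_mw: "content u = mweight (mset u)" by (simp add: content_def mweight_def)

lemma mw_inj: "mweight M = mweight M' \<longleftrightarrow> M = M'"
  by (auto simp: mweight_def fun_eq_iff multiset_eq_iff)

lemma mw_add: "mweight (M + M') = (\<lambda>j. mweight M j + mweight M' j)"
  by (simp add: mweight_def)

lemma independent_of_card:
  assumes "finite B" "V \<subseteq> span B" "card B \<le> dim V" shows "independent B"
proof -
  obtain B' where B': "B' \<subseteq> B" "independent B'" "B \<subseteq> span B'"
    using real_vector.maximal_independent_subset by blast
  have finB': "finite B'" using B'(1) assms(1) finite_subset by blast
  have "V \<subseteq> span B'" using assms(2) B'(3) real_vector.span_minimal[OF B'(3)] by auto
  then have "dim V \<le> card B'" using real_vector.dim_le_card finB' by blast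
  then have "B' = B" using assms(1,3) B'(1) by (metis card_seteq le_trans)
  then show ?thesis using B'(2) by simp
qed

locale hall_set =
  fixes r :: "nat free_lie rel"
  assumes hall_order: "hall_order r"
begin

definition H :: "nat free_lie set" where "H = (\<Union>m\<in>{1..}. hall r m)"

definition G :: "nat free_lie set" where "G = range lie_gen"

lemma order: "trans r" "irrefl r" "total_on H r"
  and gen_less: "i < j \<Longrightarrow> (lie_gen i, lie_gen j) \<in> r"
  and degree_less: "1 \<le> j \<Longrightarrow> j < m \<Longrightarrow> Y \<in> hall r j \<Longrightarrow> Z \<in> hall r m \<Longrightarrow> (Y, Z) \<in> r"
  using hall_order unfolding hall_order_def strict_linear_order_on_def H_def by blast+

lemma not_less_refl: "(x, x) \<notin> r"
  using order(2) by (simp add: irrefl_def)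

lemma hall_1: "hall r 1 = G"
  by (subst hall.simps) (simp add: G_def)

lemma hall_mem: "m \<noteq> 1 \<Longrightarrow> X \<in> hall r m \<longleftrightarrow> (\<exists>Y Z. (Y, Z) \<in> hall_pairs r m \<and> X = lie_bracket Y Z)"
  by (subst hall.simps) auto

text \<open>An element of two stages would be smaller than itself. The order axioms alone thus
  provide a grading, before anything is known about independence.\<close>

lemma degree_unique: "1 \<le> j \<Longrightarrow> 1 \<le> m \<Longrightarrow> X \<in> hall r j \<Longrightarrow> X \<in> hall r m \<Longrightarrow> j = m"
  using degree_less[of j m X X] degree_less[of m j X X] not_less_refl by (meson linorder_neqE_nat)

lemma hall_pairs_mem:
  "(Y, Z) \<in> hall_pairs r m \<longleftrightarrow> (\<exists>a b. 1 \<le> a \<and> 1 \<le> b \<and> a + b = m \<and> Y \<in> hall r a \<and> Z \<in> hall r b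
    \<and> (Y, Z) \<in> r \<and> (\<forall>Z1 Z2. (Z1, Z2) \<in> hall_pairs r b \<longrightarrow> Z = lie_bracket Z1 Z2 \<longrightarrow> Z1 = Y \<or> (Z1, Y) \<in> r))"
  by (subst hall_pairs.simps) (simp add: Ball_def split_paired_All)

lemma G_sub: "G \<subseteq> H"
  unfolding hall_1[symmetric] H_def by auto

lemma pair_degree:
  assumes p: "(Y, Z) \<in> hall_pairs r m"
  shows "2 \<le> m \<and> lie_bracket Y Z \<in> hall r m" "Y \<in> H \<and> Z \<in> H \<and> (Y, Z) \<in> r"
proof -
  obtain a b where ab: "1 \<le> a" "1 \<le> b" "a + b = m" "Y \<in> hall r a" "Z \<in> hall r b" "(Y, Z) \<in> r"
    using p unfolding hall_pairs_mem[of Y Z m] by blast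
  then have "m \<noteq> 1" by linarith
  then have "lie_bracket Y Z \<in> hall r m" using hall_mem[of m "lie_bracket Y Z"] p by blast
  moreover have "2 \<le> m" using ab by linarith
  ultimately show "2 \<le> m \<and> lie_bracket Y Z \<in> hall r m" by blast
  show "Y \<in> H \<and> Z \<in> H \<and> (Y, Z) \<in> r" using ab unfolding H_def by auto
qed

lemma pair_H: "(Y, Z) \<in> hall_pairs r m \<Longrightarrow> Y \<in> H \<and> Z \<in> H \<and> (Y, Z) \<in> r \<and> lie_bracket Y Z \<in> H"
  using pair_degree[of Y Z m] unfolding H_def by force

text \<open>
  Before linear independence is known, a Hall element could be zero or a bracket in several ways.
  Therefore \<open>wt\<close> is defined by a chosen decomposition; it turns out to agree with \<open>hall_eta r\<close>.
\<close>

definition halves :: "nat free_lie \<Rightarrow> nat free_lie \<times> nat free_lie" where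
  "halves X = (SOME p. (\<exists>m. p \<in> hall_pairs r m) \<and> X = lie_bracket (fst p) (snd p))"

definition dl where "dl X = fst (halves X)"
definition dr where "dr X = snd (halves X)"

lemma spl_pair:
  assumes "X \<in> hall r m" "1 \<le> m" "X \<notin> G"
  shows "(dl X, dr X) \<in> hall_pairs r m" "X = lie_bracket (dl X) (dr X)" "2 \<le> m"
proof -
  have m: "m \<noteq> 1" using assms hall_1 by auto
  then obtain Y Z where "(Y, Z) \<in> hall_pairs r m" "X = lie_bracket Y Z" using hall_mem assms(1) by blast
  then have "\<exists>p. (\<exists>m. p \<in> hall_pairs r m) \<and> X = lie_bracket (fst p) (snd p)" by (intro exI[of _ "(Y, Z)"]) auto
  from someI_ex[OF this] obtain m' where m': "(dl X, dr X) \<in> hall_pairs r m'" and X: "X = lie_bracket (dl X) (dr X)"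
    unfolding dl_def dr_def halves_def by auto
  have "m' = m" using degree_unique[of m' m X] pair_degree(1)[OF m'] X assms(1,2) by simp
  then show "(dl X, dr X) \<in> hall_pairs r m" "X = lie_bracket (dl X) (dr X)" using m' X by auto
  show "2 \<le> m" using m assms(2) by simp
qed

definition degree :: "nat free_lie \<Rightarrow> nat" where
  "degree X = (THE m. 1 \<le> m \<and> X \<in> hall r m)"

lemma degree_eq: "1 \<le> m \<Longrightarrow> X \<in> hall r m \<Longrightarrow> degree X = m"
  unfolding degree_def using degree_unique by (intro the_equality) auto

lemma H_degree: assumes "X \<in> H" obtains m where "1 \<le> m" "X \<in> hall r m" "degree X = m"
  using assms degree_eq unfolding H_def by auto

lemma split_degree:
  assumes "X \<in> H - G" shows "dl X \<in> H" "dr X \<in> H" "degree (dl X) + degree (dr X) = degree X"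
    "degree (dl X) \<ge> 1" "degree (dr X) \<ge> 1"
proof -
  obtain m where m: "1 \<le> m" "X \<in> hall r m" "degree X = m" using assms H_degree by blast
  then obtain a b where "1 \<le> a" "1 \<le> b" "a + b = m" "dl X \<in> hall r a" "dr X \<in> hall r b"
    using spl_pair(1)[of X m] assms unfolding hall_pairs_mem[of "dl X"] by blast
  moreover from this have "degree (dl X) = a" "degree (dr X) = b" using degree_eq by blast+
  ultimately show "dl X \<in> H" "dr X \<in> H" "degree (dl X) + degree (dr X) = degree X"
    "degree (dl X) \<ge> 1" "degree (dr X) \<ge> 1" using m unfolding H_def by auto
qed

function wt :: "nat free_lie \<Rightarrow> nat multiset" where
  "wt X = (if X \<in> H - G then wt (dl X) + wt (dr X) else {#SOME i. X = lie_gen i#})"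
  by auto
termination
proof (relation "measure degree")
  fix X assume "X \<in> H - G"
  then show "(dl X, X) \<in> measure degree" "(dr X, X) \<in> measure degree" using split_degree[of X] by auto
qed simp

declare wt.simps [simp del]

lemma wt_split: "X \<in> H - G \<Longrightarrow> wt X = wt (dl X) + wt (dr X)"
  by (subst wt.simps) simp

lemma gen_inj: "lie_gen (i::nat) = lie_gen j \<Longrightarrow> i = j"
  using gen_less[of i j] gen_less[of j i] not_less_refl by (metis linorder_neqE_nat)

lemma wt_gen: "wt (lie_gen i) = {#i#}"
proof -
  have "(SOME j. lie_gen i = lie_gen j) = i" by (rule some_equality) (auto dest: gen_inj)
  then show ?thesis by (subst wt.simps) (simp add: G_def)
qed

lemma hall_induct [consumes 1, case_names gen bracket]:
  assumes "X \<in> H" "\<And>i. Q (lie_gen i)"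
    "\<And>X. X \<in> H - G \<Longrightarrow> Q (dl X) \<Longrightarrow> Q (dr X) \<Longrightarrow> Q X"
  shows "Q X"
  using assms(1)
proof (induct X rule: measure_induct_rule[where f=degree])
  case (less X)
  show ?case
  proof (cases "X \<in> G")
    case True
    then show ?thesis using assms(2) by (auto simp: G_def)
  next
    case False
    then have X: "X \<in> H - G" using less.prems by blast
    show ?thesis by (rule assms(3)[OF X]) (use split_degree[OF X] less.hyps in auto)
  qed
qed

lemma size_wt: "X \<in> H \<Longrightarrow> size (wt X) = degree X"
proof (induct rule: hall_induct)
  case (gen i)
  have "lie_gen i \<in> hall r 1" unfolding hall_1 G_def by blast
  then show ?case using degree_eq[of 1 "lie_gen i"] by (simp add: wt_gen)
next
  case (bracket X)
  then show ?case using wt_split split_degree(3)[of X] by simp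
qed

lemma wt_nonempty: "X \<in> H \<Longrightarrow> wt X \<noteq> {#}"
  using size_wt[of X] H_degree[of X] by (metis One_nat_def not_one_le_zero size_empty)

lemma split_pair: "X \<in> H - G \<Longrightarrow> \<exists>m. (dl X, dr X) \<in> hall_pairs r m" "X \<in> H - G \<Longrightarrow> X = lie_bracket (dl X) (dr X)"
  using spl_pair by (metis DiffD1 DiffD2 H_degree)+

lemma degree_less': "X \<in> H \<Longrightarrow> Y \<in> H \<Longrightarrow> degree X < degree Y \<Longrightarrow> (X, Y) \<in> r"
  using degree_less by (metis H_degree)

sublocale lazard H r G "\<lambda>x. SOME i. x = lie_gen i" dl dr wt
proof
  have *: "(SOME j. lie_gen i = lie_gen j) = i" for i :: nat by (rule some_equality) (auto dest: gen_inj)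
  show "inj_on (\<lambda>x. SOME i. x = lie_gen i) G" by (auto simp: inj_on_def G_def * )
  show "x \<in> G \<Longrightarrow> wt x = {#SOME i. x = lie_gen i#}" for x by (auto simp: G_def wt_gen * )
  fix x assume x: "x \<in> H - G"
  show "dl x \<in> H \<and> dr x \<in> H" using split_degree[OF x] by blast
  obtain m where m: "(dl x, dr x) \<in> hall_pairs r m" using split_pair(1)[OF x] by blast
  show "(dl x, dr x) \<in> r \<and> (dl x, x) \<in> r"
  proof
    show "(dl x, dr x) \<in> r" using pair_H[OF m] by blast
    show "(dl x, x) \<in> r" using degree_less'[of "dl x" x] split_degree[OF x] x by auto
  qed
  show "wt x = wt (dl x) + wt (dr x)" by (rule wt_split[OF x])
  show "dl (dr x) = dl x \<or> (dl (dr x), dl x) \<in> r" if "dr x \<notin> G"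
  proof -
    obtain b where b: "1 \<le> b" "dr x \<in> hall r b"
      "\<And>Z1 Z2. (Z1, Z2) \<in> hall_pairs r b \<Longrightarrow> dr x = lie_bracket Z1 Z2 \<Longrightarrow> Z1 = dl x \<or> (Z1, dl x) \<in> r"
      using m unfolding hall_pairs_mem[of "dl x"] by blast
    \<comment> \<open>The Hall condition quantifies over all ways of writing \<open>dr x\<close> as
      a bracket of its stage, hence it covers the chosen one.\<close>
    show ?thesis by (rule b(3)[OF spl_pair(1,2)[OF b(2,1) that]])
  qed
  show "x = y" if "y \<in> H - G" "dl x = dl y" "dr x = dr y" for y
    using split_pair(2)[OF x] split_pair(2)[OF that(1)] that by metis
qed (use order G_sub wt_nonempty in auto)

text \<open>Taking \<open>real_part\<close> in \<open>hall_poly\<close> loses nothing on Hall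
  elements: generators have real coefficients, and commutators preserve this.\<close>

lemma lie_tensor_H: "X \<in> H \<Longrightarrow> lie_tensor X = to_complex (hall_poly X)"
proof (induct rule: hall_induct)
  case (gen i)
  show ?case by (simp add: hall_poly_def lie_tensor_gen)
next
  case (bracket X)
  have "lie_tensor X = comm (lie_tensor (dl X)) (lie_tensor (dr X))"
    using split_pair(2)[OF bracket(1)] lie_tensor_bracket by metis
  also have "\<dots> = to_complex (comm (hall_poly (dl X)) (hall_poly (dr X)))" by (simp only: bracket(2,3) cx_comm)
  finally show ?case by (simp add: hall_poly_def)
qed

lemma lpoly_bracket: "Y \<in> H \<Longrightarrow> Z \<in> H \<Longrightarrow> hall_poly (lie_bracket Y Z) = comm (hall_poly Y) (hall_poly Z)"
  by (simp add: hall_poly_def[of "lie_bracket Y Z"] lie_tensor_bracket lie_tensor_H flip: cx_comm)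

lemma lpoly_gen: "hall_poly (lie_gen i) = monom [i]"
  by (simp add: hall_poly_def lie_tensor_gen)

lemma comm_wspace:
  assumes "f \<in> weight_space (mweight M)" "g \<in> weight_space (mweight M')" shows "comm f g \<in> weight_space (mweight (M + M'))"
  unfolding comm_def
  using mult_weight_space[OF assms] mult_weight_space[OF assms(2,1)]
  by (intro real_vector.subspace_diff[OF subspace_weight_space]) (simp_all add: mw_add add.commute)

lemma monom_gen_weight_space: "monom [i] \<in> weight_space (mweight {#i#})"
  using monom_weight_space[of "[i]"] by (simp add: ctn_mw)

lemma eta_rel_wspace: "hall_eta_rel r X \<alpha> \<Longrightarrow> X \<in> H \<and> hall_poly X \<in> weight_space (mweight \<alpha>)"
proof (induct rule: hall_eta_rel.induct)
  case (gen j)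
  show ?case using G_sub monom_gen_weight_space by (auto simp: G_def lpoly_gen)
next
  case (bracket Y Z m \<alpha> \<beta>)
  then show ?case using pair_H[OF bracket(1)] comm_wspace by (simp add: lpoly_bracket)
qed

lemma eta_rel_wt: "X \<in> H \<Longrightarrow> hall_eta_rel r X (wt X)"
proof (induct rule: hall_induct)
  case (gen i)
  show ?case unfolding wt_gen by (rule hall_eta_rel.gen)
next
  case (bracket X)
  obtain m where "(dl X, dr X) \<in> hall_pairs r m" using split_pair(1)[OF bracket(1)] by blast
  from hall_eta_rel.bracket[OF this bracket(2,3)] show ?case
    using split_pair(2)[OF bracket(1)] wt_split[OF bracket(1)] by simp
qed

text \<open>A nonzero tensor lies in only one weight space. Once Hall polynomials are known to be
  nonzero, this makes \<open>hall_eta\<close> well defined.\<close>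

lemma eta_rel_unique: "hall_eta_rel r X \<alpha> \<Longrightarrow> hall_poly X \<noteq> 0 \<Longrightarrow> \<alpha> = wt X"
proof -
  assume a: "hall_eta_rel r X \<alpha>" "hall_poly X \<noteq> 0"
  have 1: "X \<in> H" "hall_poly X \<in> weight_space (mweight \<alpha>)" using eta_rel_wspace[OF a(1)] by auto
  have 2: "hall_poly X \<in> weight_space (mweight (wt X))" using eta_rel_wspace[OF eta_rel_wt[OF 1(1)]] by blast
  obtain u where "coeff (hall_poly X) u \<noteq> 0" using a(2) tensor_eqI[of "hall_poly X" 0] by auto
  then have "content u = mweight \<alpha>" "content u = mweight (wt X)" using 1(2) 2 unfolding weight_space_def by blast+
  then have "mweight \<alpha> = mweight (wt X)" by simp
  then show ?thesis by (simp add: mw_inj)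
qed

section \<open>The span of the Hall polynomials is closed under brackets and derivations\<close>

definition L :: "(nat \<Rightarrow> int) \<Rightarrow> real tensor set" where
  "L \<mu> = span {hall_poly h | h. h \<in> H \<and> mweight (wt h) = \<mu>}"

lemma subspace_L: "subspace (L \<mu>)" by (simp add: L_def)

lemma lpoly_L: "h \<in> H \<Longrightarrow> hall_poly h \<in> L (mweight (wt h))"
  unfolding L_def by (intro real_vector.span_base) blast

lemma L_induct:
  assumes "f \<in> L \<mu>" "subspace {f. Q f}" "\<And>h. h \<in> H \<Longrightarrow> mweight (wt h) = \<mu> \<Longrightarrow> Q (hall_poly h)"
  shows "Q f"
  using real_vector.span_induct[of f "{hall_poly h | h. h \<in> H \<and> mweight (wt h) = \<mu>}" Q] assms unfolding L_def by blast

lemma subspace_comm_left: "subspace V \<Longrightarrow> subspace {f. comm f g \<in> (V :: real tensor set)}"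
  by (auto simp: real_vector.subspace_def comm_add comm_scaleR)

lemma subspace_comm_right: "subspace V \<Longrightarrow> subspace {f. comm g f \<in> (V :: real tensor set)}"
  by (auto simp: real_vector.subspace_def comm_add comm_scaleR)

lemma comm_jacobi: "comm x (comm y z) = comm (comm x y) z + comm y (comm x z)"
  by (simp add: comm_def algebra_simps)

text \<open>
  If \<open>Z = [Z\<^sub>1, Z\<^sub>2]\<close> with \<open>Y < Z\<^sub>1\<close>, the Jacobi identity leads to brackets of shorter elements, followed by
  brackets of the same weight whose smaller entry exceeds \<open>Y\<close>.
\<close>

lemma comm_lpoly_less:
  assumes "Y \<in> H" "Z \<in> H" "(Y, Z) \<in> r"
  shows "comm (hall_poly Y) (hall_poly Z) \<in> L (mweight (wt Y + wt Z))"
proof -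
  \<comment> \<open>The cardinality of this set of Hall elements above \<open>Y\<close> is the
    measure of the inner induction: it is finite by \<open>finite_wt_le\<close> and drops when
    \<open>Y\<close> is replaced by a larger element. The outer induction is on the total
    degree.\<close>
  define U where "U M Y = {h \<in> H. wt h \<subseteq># M \<and> (Y, h) \<in> r}" for M Y
  have finU: "finite (U M Y)" for M Y
    using finite_wt_le[of M] by (rule rev_finite_subset) (auto simp: U_def)
  have "\<forall>k Y Z. Y \<in> H \<and> Z \<in> H \<and> (Y, Z) \<in> r \<and> size (wt Y + wt Z) = n \<and> card (U (wt Y + wt Z) Y) = k \<longrightarrow>
      comm (hall_poly Y) (hall_poly Z) \<in> L (mweight (wt Y + wt Z))" for n
  proof (induct n rule: less_induct)
    case (less n)
    have IH1: "comm (hall_poly Y) (hall_poly Z) \<in> L (mweight (wt Y + wt Z))"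
      if "Y \<in> H" "Z \<in> H" "(Y, Z) \<in> r" "size (wt Y + wt Z) < n" for Y Z
      using less that by blast
    show ?case
    proof
      fix k
      show "\<forall>Y Z. Y \<in> H \<and> Z \<in> H \<and> (Y, Z) \<in> r \<and> size (wt Y + wt Z) = n \<and> card (U (wt Y + wt Z) Y) = k \<longrightarrow>
        comm (hall_poly Y) (hall_poly Z) \<in> L (mweight (wt Y + wt Z))"
      proof (induct k rule: less_induct)
        case (less k)
        have IH2: "comm (hall_poly Y) (hall_poly Z) \<in> L (mweight (wt Y + wt Z))"
          if "Y \<in> H" "Z \<in> H" "(Y, Z) \<in> r" "size (wt Y + wt Z) = n" "card (U (wt Y + wt Z) Y) < k" for Y Z
          using less that by blast
        show ?case
        proof (intro allI impI, elim conjE)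
          fix Y Z assume YZ: "Y \<in> H" "Z \<in> H" "(Y, Z) \<in> r" "size (wt Y + wt Z) = n" "card (U (wt Y + wt Z) Y) = k"
          define M where "M = wt Y + wt Z"
          obtain a where a: "1 \<le> a" "Y \<in> hall r a" using H_degree[OF YZ(1)] by blast
          obtain b where b: "1 \<le> b" "Z \<in> hall r b" using H_degree[OF YZ(2)] by blast
          show "comm (hall_poly Y) (hall_poly Z) \<in> L (mweight (wt Y + wt Z))"
          proof (cases "\<forall>Z1 Z2. (Z1, Z2) \<in> hall_pairs r b \<longrightarrow> Z = lie_bracket Z1 Z2 \<longrightarrow> Z1 = Y \<or> (Z1, Y) \<in> r")
            case True
            then have p: "(Y, Z) \<in> hall_pairs r (a + b)" unfolding hall_pairs_mem[of Y Z] using a b YZ(3) by blast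
            let ?X = "lie_bracket Y Z"
            have X: "?X \<in> H" using pair_H[OF p] by blast
            show ?thesis
            \<comment> \<open>The chosen weight of the Hall element \<open>?X\<close> is known to be
              \<open>wt Y + wt Z\<close> only if its polynomial is nonzero; a vanishing polynomial
              lies in \<open>L\<close> anyway.\<close>
            proof (cases "hall_poly ?X = 0")
              case True
              then show ?thesis using lpoly_bracket[OF YZ(1,2)] real_vector.subspace_0[OF subspace_L] by simp
            next
              case False
              have "wt Y + wt Z = wt ?X"
                by (rule eta_rel_unique[OF hall_eta_rel.bracket[OF p eta_rel_wt[OF YZ(1)] eta_rel_wt[OF YZ(2)]] False])
              then show ?thesis using lpoly_L[OF X] lpoly_bracket[OF YZ(1,2)] by simp
            qed
          next
            case False
            then obtain Z1 Z2 where Z: "(Z1, Z2) \<in> hall_pairs r b" "Z = lie_bracket Z1 Z2" "Z1 \<noteq> Y" "(Z1, Y) \<notin> r" by blast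
            have Z12: "Z1 \<in> H" "Z2 \<in> H" "(Z1, Z2) \<in> r" using pair_H[OF Z(1)] by auto
            have YZ1: "(Y, Z1) \<in> r" using order(3) Z YZ(1) Z12(1) unfolding total_on_def by blast
            have YZ2: "(Y, Z2) \<in> r" using order(1) YZ1 Z12(3) by (meson transD)
            have lZ: "hall_poly Z = comm (hall_poly Z1) (hall_poly Z2)" using lpoly_bracket[OF Z12(1,2)] Z(2) by simp
            show ?thesis
            proof (cases "hall_poly Z = 0")
              case True
              then show ?thesis using real_vector.subspace_0[OF subspace_L] by simp
            next
              case False
              then have wZ: "wt Z = wt Z1 + wt Z2"
                using eta_rel_unique[OF hall_eta_rel.bracket[OF Z(1) eta_rel_wt[OF Z12(1)] eta_rel_wt[OF Z12(2)]]] Z(2) by simp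
              have ne: "0 < size (wt Z1)" "0 < size (wt Z2)"
                using wt_nonempty[OF Z12(1)] wt_nonempty[OF Z12(2)] by (simp_all flip: nonempty_has_size)
              \<comment> \<open>A bracket of total weight \<open>M\<close> with both entries above
                \<open>Y\<close> falls under the inner induction, after exchanging the entries if
                necessary.\<close>
              have main: "comm (hall_poly h) (hall_poly h') \<in> L (mweight M)"
                if h: "h \<in> H" "h' \<in> H" "wt h + wt h' = M" "(Y, h) \<in> r" "(Y, h') \<in> r" for h h'
              proof -
                have less: "card (U M g) < k" if g: "g \<in> H" "wt g \<subseteq># M" "(Y, g) \<in> r" for g
                proof -
                  have "U M g \<subset> U M Y"
                  proof
                    show "U M g \<subseteq> U M Y" using g(3) order(1) unfolding U_def by (auto dest: transD)
                    have "g \<in> U M Y" using g by (simp add: U_def)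
                    moreover have "g \<notin> U M g" using not_less_refl by (simp add: U_def)
                    ultimately show "U M g \<noteq> U M Y" by blast
                  qed
                  then show ?thesis using psubset_card_mono[OF finU[of M Y]] YZ(5) by (simp add: M_def)
                qed
                have sz: "size (wt h + wt h') = n" "size (wt h' + wt h) = n" using h(3) YZ(4) by (simp_all add: M_def add.commute)
                have M': "wt h' + wt h = M" using h(3) by (simp add: add.commute)
                have sub: "wt h \<subseteq># M" "wt h' \<subseteq># M" unfolding h(3)[symmetric] by simp_all
                consider "h = h'" | "(h, h') \<in> r" | "(h', h) \<in> r" using order(3) h(1,2) unfolding total_on_def by blast
                then show ?thesis
                proof cases
                  case 1
                  then show ?thesis using real_vector.subspace_0[OF subspace_L] by simp
                next
                  case 2
                  show ?thesis using IH2[OF h(1,2) 2 sz(1)] less[OF h(1) sub(1) h(4)] unfolding h(3) by blast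
                next
                  case 3
                  have "comm (hall_poly h') (hall_poly h) \<in> L (mweight M)"
                    using IH2[OF h(2,1) 3 sz(2)] less[OF h(2) sub(2) h(5)] unfolding M' by blast
                  then have "- comm (hall_poly h') (hall_poly h) \<in> L (mweight M)" by (rule real_vector.subspace_neg[OF subspace_L])
                  then show ?thesis by (simp add: comm_def)
                qed
              qed
              \<comment> \<open>Elements arising from a bracket with \<open>Y\<close> have a larger
                degree than \<open>Y\<close> and therefore exceed it in the order.\<close>
              have big: "(Y, h) \<in> r" if "h \<in> H" "wt h = wt Y + wt Z'" "0 < size (wt Z')" for h Z'
                using degree_less'[OF YZ(1) that(1)] that size_wt[OF YZ(1)] size_wt[OF that(1)] by simp
              have "comm (hall_poly Y) (hall_poly Z1) \<in> L (mweight (wt Y + wt Z1))"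
                by (rule IH1[OF YZ(1) Z12(1) YZ1]) (use YZ(4) wZ ne in simp)
              then have 1: "comm (comm (hall_poly Y) (hall_poly Z1)) (hall_poly Z2) \<in> L (mweight M)"
              proof (rule L_induct[OF _ subspace_comm_left[OF subspace_L]])
                fix h assume h: "h \<in> H" "mweight (wt h) = mweight (wt Y + wt Z1)"
                then have wh: "wt h = wt Y + wt Z1" by (simp add: mw_inj)
                show "comm (hall_poly h) (hall_poly Z2) \<in> L (mweight M)"
                  by (rule main[OF h(1) Z12(2) _ big[OF h(1) wh ne(1)] YZ2]) (simp add: wh M_def wZ add.assoc)
              qed
              have "comm (hall_poly Y) (hall_poly Z2) \<in> L (mweight (wt Y + wt Z2))"
                by (rule IH1[OF YZ(1) Z12(2) YZ2]) (use YZ(4) wZ ne in simp)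
              then have 2: "comm (hall_poly Z1) (comm (hall_poly Y) (hall_poly Z2)) \<in> L (mweight M)"
              proof (rule L_induct[OF _ subspace_comm_right[OF subspace_L]])
                fix h assume h: "h \<in> H" "mweight (wt h) = mweight (wt Y + wt Z2)"
                then have wh: "wt h = wt Y + wt Z2" by (simp add: mw_inj)
                show "comm (hall_poly Z1) (hall_poly h) \<in> L (mweight M)"
                  by (rule main[OF Z12(1) h(1) _ YZ1 big[OF h(1) wh ne(2)]]) (simp add: wh M_def wZ algebra_simps)
              qed
              show ?thesis unfolding lZ comm_jacobi[of "hall_poly Y"] M_def[symmetric]
                by (rule real_vector.subspace_add[OF subspace_L 1 2])
            qed
          qed
        qed
      qed
    qed
  qed
  then show ?thesis using assms by blast
qed

lemma comm_lpoly:
  assumes "Y \<in> H" "Z \<in> H" shows "comm (hall_poly Y) (hall_poly Z) \<in> L (mweight (wt Y + wt Z))"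
proof -
  consider "Y = Z" | "(Y, Z) \<in> r" | "(Z, Y) \<in> r" using order(3) assms unfolding total_on_def by blast
  then show ?thesis
  proof cases
    case 1
    then show ?thesis using real_vector.subspace_0[OF subspace_L] by simp
  next
    case 2
    then show ?thesis by (rule comm_lpoly_less[OF assms])
  next
    case 3
    have "- comm (hall_poly Z) (hall_poly Y) \<in> L (mweight (wt Z + wt Y))"
      by (rule real_vector.subspace_neg[OF subspace_L comm_lpoly_less[OF assms(2,1) 3]])
    then show ?thesis by (simp add: comm_def add.commute)
  qed
qed

lemma comm_L:
  assumes "f \<in> L \<mu>" "g \<in> L \<nu>" shows "comm f g \<in> L (\<lambda>j. \<mu> j + \<nu> j)"
  using assms(1)
proof (rule L_induct[OF _ subspace_comm_left[OF subspace_L]])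
  fix h assume h: "h \<in> H" "mweight (wt h) = \<mu>"
  show "comm (hall_poly h) g \<in> L (\<lambda>j. \<mu> j + \<nu> j)"
    using assms(2)
  proof (rule L_induct[OF _ subspace_comm_right[OF subspace_L]])
    fix h' assume h': "h' \<in> H" "mweight (wt h') = \<nu>"
    show "comm (hall_poly h) (hall_poly h') \<in> L (\<lambda>j. \<mu> j + \<nu> j)"
      using comm_lpoly[OF h(1) h'(1)] h(2) h'(2) by (simp add: mw_add)
  qed
qed

lemma asc_L: "assoc t \<in> L (mweight (leaves t))"
proof (induct t)
  case (Leaf i)
  then show ?case using lpoly_L[of "lie_gen i"] G_sub by (auto simp: lpoly_gen wt_gen G_def)
next
  case (Node s t)
  then show ?case using comm_L[OF Node] by (simp add: mw_add)
qed

lemma lpoly_asc: "X \<in> H \<Longrightarrow> \<exists>t. hall_poly X = assoc t \<and> leaves t = wt X"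
proof (induct rule: hall_induct)
  case (gen i)
  show ?case by (intro exI[of _ "Leaf i"]) (simp add: lpoly_gen wt_gen)
next
  case (bracket X)
  then obtain s t where st: "hall_poly (dl X) = assoc s" "leaves s = wt (dl X)" "hall_poly (dr X) = assoc t" "leaves t = wt (dr X)" by blast
  have "hall_poly X = comm (hall_poly (dl X)) (hall_poly (dr X))"
    using split_pair(2)[OF bracket(1)] lpoly_bracket split_degree(1,2)[OF bracket(1)] by metis
  then show ?case using st wt_split[OF bracket(1)] by (intro exI[of _ "Node s t"]) simp
qed

text \<open>Derivations do not respect the Hall condition. Stability is therefore proved for
  arbitrary bracketings, all of which lie in \<open>L\<close> by \<open>asc_L\<close>.\<close>

lemma der_asc: "der a b (assoc t) \<in> L (shift 1 a b (mweight (leaves t)))"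
proof (induct t)
  case (Leaf i)
  show ?case
  proof (cases "i = b")
    case True
    have "der a b (monom [b]) = monom [a]"
    proof (rule tensor_eqI)
      fix u show "coeff (der a b (monom [b])) u = coeff (monom [a]) u"
      proof (cases u)
        case (Cons x v)
        have "der_aux v a b (\<lambda>v. coeff (monom [b]) (x # v)) = 0"
        proof (rule ccontr)
          assume nz: "\<not> ?thesis"
          from der_aux_nonzero[OF this] obtain w where "coeff (monom [b]) (x # w) \<noteq> 0" "length w = length v" by blast
          then have "v = []" by (auto simp: coeff_monom split: if_splits)
          then show False using nz by simp
        qed
        then show ?thesis using Cons by (auto simp: coeff_der coeff_monom)
      qed (simp add: coeff_der coeff_monom)
    qed
    moreover have "shift 1 a b (mweight {#b#}) = mweight {#a#}" by (auto simp: shift_def mweight_def)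
    ultimately show ?thesis using True asc_L[of "Leaf a"] by simp
  next
    case False
    have "der a b (monom [i]) = 0"
    proof (cases "a = b")
      case True
      then show ?thesis using der_diag[OF monom_gen_weight_space, of b i] False by (simp add: mweight_def)
    next
      case ab: False
      show ?thesis by (rule der_raise_empty[OF monom_gen_weight_space]) (use False ab in \<open>simp_all add: mweight_def\<close>)
    qed
    then show ?thesis using real_vector.subspace_0[OF subspace_L] by simp
  qed
next
  case (Node s t)
  have "der a b (comm (assoc s) (assoc t)) = comm (der a b (assoc s)) (assoc t) + comm (assoc s) (der a b (assoc t))"
    by (simp add: comm_def der_diff der_mult)
  moreover have "comm (der a b (assoc s)) (assoc t) \<in> L (shift 1 a b (mweight (leaves s + leaves t)))"
    using comm_L[OF Node(1) asc_L[of t]] by (simp add: mw_add shift_def algebra_simps)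
  moreover have "comm (assoc s) (der a b (assoc t)) \<in> L (shift 1 a b (mweight (leaves s + leaves t)))"
    using comm_L[OF asc_L[of s] Node(2)] by (simp add: mw_add shift_def algebra_simps)
  ultimately show ?case using real_vector.subspace_add[OF subspace_L] by simp
qed

lemma der_L: "f \<in> L \<mu> \<Longrightarrow> der a b f \<in> L (shift 1 a b \<mu>)"
proof (rule L_induct[of f \<mu>])
  show "subspace {f. der a b f \<in> L (shift 1 a b \<mu>)}"
    using subspace_L by (auto simp: real_vector.subspace_def der_add der_scale)
  fix h assume "h \<in> H" "mweight (wt h) = \<mu>"
  then show "der a b (hall_poly h) \<in> L (shift 1 a b \<mu>)" using lpoly_asc[of h] der_asc by metis
qed

end

section \<open>Linear independence of Hall polynomials\<close>

lemma ex_descent: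
  "\<not> sorted_wrt R xs \<Longrightarrow> transp R \<Longrightarrow> \<exists>us x y vs. xs = us @ x # y # vs \<and> \<not> R x y"
proof (induct xs)
  case (Cons a xs)
  show ?case
  proof (cases "sorted_wrt R xs")
    case True
    then obtain y vs where xs: "xs = y # vs" using Cons.prems(1) by (cases xs) auto
    have "\<not> R a y"
    proof
      assume "R a y"
      then have "\<forall>z\<in>set xs. R a z" using True Cons.prems(2) xs by (auto dest: transpD)
      then show False using Cons.prems(1) True by simp
    qed
    then show ?thesis using xs by (intro exI[of _ "[]"]) auto
  next
    case False
    then obtain us x y vs where "xs = us @ x # y # vs" "\<not> R x y" using Cons by blast
    then show ?thesis by (intro exI[of _ "a # us"]) auto
  qed
qed simp

lemma sorted_wrt_unique:
  assumes "sorted_wrt R xs" "sorted_wrt R ys" "mset xs = mset ys"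
    "\<And>x y. R x y \<Longrightarrow> R y x \<Longrightarrow> x = y"
  shows "xs = ys"
  using assms(1-3)
proof (induct xs arbitrary: ys)
  case (Cons a xs)
  then obtain b ys' where ys: "ys = b # ys'" by (cases ys) auto
  have "a = b"
  proof (rule ccontr)
    assume ne: "a \<noteq> b"
    have "b \<in> set (a # xs)" "a \<in> set (b # ys')"
      using mset_eq_setD[OF Cons.prems(3)] ys by auto
    then have "R a b" "R b a" using Cons.prems(1,2) ys ne by auto
    then show False using assms(4) ne by blast
  qed
  then show ?case using Cons ys by auto
qed simp

context hall_set
begin

definition hall_prod :: "nat free_lie list \<Rightarrow> real tensor" where
  "hall_prod xs = prod_list (map hall_poly xs)"

lemma PP_simps [simp]: "hall_prod [] = 1" "hall_prod (x # xs) = hall_poly x * hall_prod xs" "hall_prod (xs @ ys) = hall_prod xs * hall_prod ys"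
  by (simp_all add: hall_prod_def)

abbreviation desc :: "nat free_lie \<Rightarrow> nat free_lie \<Rightarrow> bool" where
  "desc x y \<equiv> x = y \<or> (y, x) \<in> r"

definition desc_lists :: "nat multiset \<Rightarrow> nat free_lie list set" where
  "desc_lists M = {xs. set xs \<subseteq> H \<and> sorted_wrt desc xs \<and> sum_list (map wt xs) = M}"

text \<open>The number of pairs that violate the decreasing order; it is the second component of the
  termination measure in \<open>PP_span\<close>.\<close>

primrec ascents :: "nat free_lie list \<Rightarrow> nat" where
  "ascents [] = 0"
| "ascents (x # xs) = length (filter (\<lambda>y. (x, y) \<in> r) xs) + ascents xs"

lemma transp_desc: "transp desc"
  using order(1) by (auto simp: transp_def dest: transD)

lemma less_asym: "(x, y) \<in> r \<Longrightarrow> (y, x) \<notin> r"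
  using order(1) not_less_refl by (meson transD)

lemma ascents_swap: "(x, y) \<in> r \<Longrightarrow> ascents (us @ y # x # vs) < ascents (us @ x # y # vs)"
  by (induct us) (use less_asym in auto)

text \<open>The spanning half of the Poincare--Birkhoff--Witt theorem: at an ascent, replace x y by
  y x + [x, y]. The first term has fewer ascents, and by \<open>comm_lpoly\<close> the second is a
  combination of shorter products.\<close>

lemma PP_span: "set xs \<subseteq> H \<Longrightarrow> hall_prod xs \<in> span (hall_prod ` desc_lists (sum_list (map wt xs)))"
proof (induct xs rule: wf_induct[OF wf_measures[of "[length, ascents]"]])
  case (1 xs)
  let ?T = "span (hall_prod ` desc_lists (sum_list (map wt xs)))"
  have IH: "hall_prod ys \<in> ?T" if "length ys < length xs \<or> length ys = length xs \<and> ascents ys < ascents xs" "set ys \<subseteq> H"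
    "sum_list (map wt ys) = sum_list (map wt xs)" for ys
  proof -
    have "hall_prod ys \<in> span (hall_prod ` desc_lists (sum_list (map wt ys)))"
      using 1(1)[rule_format, of ys] that(1,2) by auto
    then show ?thesis unfolding that(3) .
  qed
  show ?case
  proof (cases "sorted_wrt desc xs")
    case True
    then show ?thesis using 1(2) by (intro real_vector.span_base) (auto simp: desc_lists_def)
  next
    case False
    then obtain us x y vs where xs: "xs = us @ x # y # vs" and nd: "\<not> desc x y"
      using ex_descent[OF _ transp_desc] by blast
    have xy: "x \<in> H" "y \<in> H" "set us \<subseteq> H" "set vs \<subseteq> H" using 1(2) xs by auto
    then have less: "(x, y) \<in> r" using nd order(3) unfolding total_on_def by blast
    have "hall_prod (us @ y # x # vs) \<in> ?T"
    proof (rule IH)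
      show "sum_list (map wt (us @ y # x # vs)) = sum_list (map wt xs)" by (simp add: xs algebra_simps)
    qed (use xy ascents_swap[OF less] in \<open>auto simp: xs\<close>)
    moreover have "hall_prod us * f * hall_prod vs \<in> ?T" if "f \<in> L (mweight (wt x + wt y))" for f
      using that
    proof (rule L_induct)
      show "subspace {f. hall_prod us * f * hall_prod vs \<in> ?T}"
        by (auto simp: real_vector.subspace_def algebra_simps intro: real_vector.span_add real_vector.span_scale real_vector.span_zero)
      fix h assume h: "h \<in> H" "mweight (wt h) = mweight (wt x + wt y)"
      then have "wt h = wt x + wt y" by (simp add: mw_inj)
      then have "hall_prod (us @ h # vs) \<in> ?T"
        using xy h(1) by (intro IH) (auto simp: xs algebra_simps)
      then show "hall_prod us * hall_poly h * hall_prod vs \<in> ?T" by (simp add: mult.assoc)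
    qed
    then have "hall_prod us * comm (hall_poly x) (hall_poly y) * hall_prod vs \<in> ?T" using comm_lpoly[OF xy(1,2)] by blast
    moreover have "hall_prod xs = hall_prod (us @ y # x # vs) + hall_prod us * comm (hall_poly x) (hall_poly y) * hall_prod vs"
      by (simp add: xs comm_def algebra_simps)
    ultimately show ?thesis using real_vector.span_add by metis
  qed
qed

lemma PP_gens: "hall_prod (map lie_gen w) = monom w"
proof (induct w)
  case (Cons x w)
  then show ?case using monom_Cons[of x w] by (simp add: lpoly_gen)
qed (simp add: monom_Nil)

lemma PP_independent: "finite (desc_lists M)" "inj_on hall_prod (desc_lists M)" "independent (hall_prod ` desc_lists M)"
proof -
  have inj: "inj_on mset (desc_lists M)"
  proof (rule inj_onI)
    fix xs ys assume "xs \<in> desc_lists M" "ys \<in> desc_lists M" "mset xs = mset ys"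
    then show "xs = ys" using less_asym by (intro sorted_wrt_unique[of desc]) (auto simp: desc_lists_def)
  qed
  have sub: "mset ` desc_lists M \<subseteq> weight_msets wt H M"
    by (auto simp: desc_lists_def weight_msets_def simp flip: sum_mset_sum_list)
  show fin: "finite (desc_lists M)" using inj sub card_MS_le_words(1) by (rule inj_on_finite)
  have words: "words (mweight M) = {w. mset w = M}" by (auto simp: words_def ctn_mw mw_inj)
  have "card (desc_lists M) \<le> card (weight_msets wt H M)" using inj sub card_MS_le_words(1) by (rule card_inj_on_le)
  also have "\<dots> \<le> card {w. mset w = M}" by (rule card_MS_le_words(2))
  finally have le: "card (desc_lists M) \<le> dim (weight_space (mweight M))" by (simp add: dim_weight_space words)
  have "monom ` words (mweight M) \<subseteq> span (hall_prod ` desc_lists M)"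
  proof (rule image_subsetI)
    fix w assume "w \<in> words (mweight M)"
    then have "mset w = M" by (simp add: words)
    moreover have "sum_list (map wt (map lie_gen w)) = mset w" by (induct w) (simp_all add: wt_gen)
    moreover have "set (map lie_gen w) \<subseteq> H" using G_sub by (auto simp: G_def)
    ultimately show "monom w \<in> span (hall_prod ` desc_lists M)" using PP_span[of "map lie_gen w"] PP_gens[of w] by metis
  qed
  then have "span (monom ` words (mweight M)) \<subseteq> span (hall_prod ` desc_lists M)" by (rule real_vector.span_minimal) simp
  then have sp: "weight_space (mweight M) \<subseteq> span (hall_prod ` desc_lists M)" using wspace_span by blast
  \<comment> \<open>If two lists had the same product, a spanning set would have fewer elements than
    the dimension.\<close>
  have "dim (weight_space (mweight M)) \<le> card (hall_prod ` desc_lists M)" by (rule real_vector.dim_le_card[OF sp]) (simp add: fin)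
  moreover have "card (hall_prod ` desc_lists M) \<le> card (desc_lists M)" by (rule card_image_le[OF fin])
  ultimately have eq: "card (hall_prod ` desc_lists M) = card (desc_lists M)" using le by linarith
  show "inj_on hall_prod (desc_lists M)" using eq fin by (simp add: eq_card_imp_inj_on)
  show "independent (hall_prod ` desc_lists M)" by (rule independent_of_card[OF _ sp]) (use fin eq le in auto)
qed

text \<open>Different weights are separated by their words, and within one weight the Hall
  polynomials are the decreasing products of length one.\<close>

lemma hall_independent:
  assumes B: "finite B" "B \<subseteq> H" and s: "(\<Sum>h\<in>B. c h *\<^sub>R hall_poly h) = 0" and h: "h \<in> B"
  shows "c h = 0"
proof -
  let ?M = "wt h"
  let ?B = "{g \<in> B. wt g = ?M}"
  have ws: "hall_poly g \<in> weight_space (mweight (wt g))" if "g \<in> B" for g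
    using eta_rel_wspace[OF eta_rel_wt] B(2) that by blast
  have "(\<Sum>g\<in>?B. c g *\<^sub>R hall_poly g) = 0"
  proof (rule tensor_eqI)
    fix u
    show "coeff (\<Sum>g\<in>?B. c g *\<^sub>R hall_poly g) u = coeff 0 u"
    proof (cases "content u = mweight ?M")
      case True
      have "coeff (hall_poly g) u = 0" if "g \<in> B - ?B" for g
      proof (rule ccontr)
        assume "coeff (hall_poly g) u \<noteq> 0"
        then have "content u = mweight (wt g)" using ws[of g] that by (simp add: weight_space_def)
        then show False using True that by (simp add: mw_inj)
      qed
      then have "(\<Sum>g\<in>?B. c g * coeff (hall_poly g) u) = (\<Sum>g\<in>B. c g * coeff (hall_poly g) u)"
        using B(1) by (intro sum.mono_neutral_left) auto
      also have "\<dots> = coeff (\<Sum>h\<in>B. c h *\<^sub>R hall_poly h) u" by (simp add: coeff_sum)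
      finally show ?thesis using s by (simp add: coeff_sum)
    next
      case False
      have "coeff (hall_poly g) u = 0" if "g \<in> ?B" for g
        using ws[of g] that False by (auto simp: weight_space_def)
      then show ?thesis by (simp add: coeff_sum)
    qed
  qed
  moreover have SSg: "[g] \<in> desc_lists ?M" if "g \<in> ?B" for g using that B(2) by (auto simp: desc_lists_def)
  have inj: "inj_on hall_poly ?B"
  proof (rule inj_onI)
    fix x y assume xy: "x \<in> ?B" "y \<in> ?B" "hall_poly x = hall_poly y"
    then have "[x] = [y]" using inj_onD[OF PP_independent(2), of "[x]" "[y]" ?M] SSg by simp
    then show "x = y" by simp
  qed
  ultimately have z: "(\<Sum>v\<in>hall_poly ` ?B. c (inv_into ?B hall_poly v) *\<^sub>R v) = 0"
    by (simp add: sum.reindex)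
  have "hall_poly ` ?B \<subseteq> hall_prod ` desc_lists ?M"
  proof (rule image_subsetI)
    fix g assume "g \<in> ?B"
    then have "hall_prod [g] \<in> hall_prod ` desc_lists ?M" using SSg by blast
    then show "hall_poly g \<in> hall_prod ` desc_lists ?M" by simp
  qed
  then have ind: "independent (hall_poly ` ?B)" using PP_independent(3) real_vector.independent_mono by blast
  have "c (inv_into ?B hall_poly (hall_poly h)) = 0"
    using real_vector.independentD[OF ind _ subset_refl z, of "hall_poly h"] B(1) h by auto
  then show ?thesis using inj h by simp
qed

lemma lpoly_nonzero: "h \<in> H \<Longrightarrow> hall_poly h \<noteq> 0"
  using hall_independent[of "{h}" "\<lambda>_. 1" h] by auto

lemma hall_eta_wt: "X \<in> H \<Longrightarrow> hall_eta r X = wt X"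
  unfolding hall_eta_def
  by (rule the_equality) (use eta_rel_wt eta_rel_unique lpoly_nonzero in auto)

end

section \<open>Exterior powers\<close>

lemma family_independent:
  assumes "finite S" "\<And>c s. (\<Sum>s\<in>S. c s *\<^sub>R \<phi> s) = (0::'v::real_vector) \<Longrightarrow> s \<in> S \<Longrightarrow> c s = 0"
  shows "inj_on \<phi> S" "independent (\<phi> ` S)"
proof -
  show inj: "inj_on \<phi> S"
  proof (rule inj_onI, rule ccontr)
    fix x y assume xy: "x \<in> S" "y \<in> S" "\<phi> x = \<phi> y" "x \<noteq> y"
    \<comment> \<open>A collision of \<open>x\<close> and \<open>y\<close> is the linear relation
      with coefficients 1 and -1.\<close>
    let ?c = "\<lambda>s. of_bool (s = x) - of_bool (s = y) :: real"
    have "(\<Sum>s\<in>S. ?c s *\<^sub>R \<phi> s) = (\<Sum>s\<in>S. (if s = x then \<phi> s else 0) - (if s = y then \<phi> s else 0))"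
      by (rule sum.cong) auto
    also have "\<dots> = 0" using assms(1) xy by (simp add: sum_subtractf)
    finally have "?c x = 0" using assms(2)[of ?c x] xy(1) by simp
    then show False using xy(4) by simp
  qed
  show "independent (\<phi> ` S)"
  proof (rule real_vector.independent_if_scalars_zero)
    fix c x assume s: "(\<Sum>x\<in>\<phi> ` S. c x *\<^sub>R x) = 0" and "x \<in> \<phi> ` S"
    then obtain t where "t \<in> S" "x = \<phi> t" by blast
    then show "c x = 0" using s assms(2)[of "\<lambda>s. c (\<phi> s)" t] by (simp add: sum.reindex[OF inj])
  qed (use assms(1) in simp)
qed

text \<open>Adjacent transpositions generate all permutations. The hypothesis concerns only
  rearrangements of \<open>M\<close>, since in the application the swap rule is known only for
  members of \<open>hall_lists\<close>.\<close>

lemma perm_invariant: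
  assumes swap: "\<And>us x y vs. mset (us @ x # y # vs) = M \<Longrightarrow> g (us @ x # y # vs) = g (us @ y # x # vs)"
    and M: "mset xs = M" "mset ys = M"
  shows "g xs = g ys"
proof -
  have front: "g (us @ p @ a # q) = g (us @ a # p @ q)" if "mset (us @ p @ a # q) = M" for us p a q
    using that
  proof (induct p arbitrary: q rule: rev_induct)
    case (snoc z p)
    have "g (us @ (p @ [z]) @ a # q) = g ((us @ p) @ a # z # q)"
      using swap[of "us @ p" z a q] snoc.prems by simp
    also have "\<dots> = g (us @ a # p @ z # q)" using snoc.hyps[of "z # q"] snoc.prems by (simp add: add_mset_commute)
    finally show ?case by simp
  qed simp
  have "mset (us @ xs) = M \<Longrightarrow> mset xs = mset ys \<Longrightarrow> g (us @ xs) = g (us @ ys)" for us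
  proof (induct xs arbitrary: us ys)
    case (Cons a xs)
    have "a \<in> set ys" using mset_eq_setD[OF Cons.prems(2)] by auto
    then obtain p q where ys: "ys = p @ a # q" by (meson split_list)
    then have eq: "mset xs = mset (p @ q)" using Cons.prems(2) by simp
    have "g (us @ a # xs) = g (us @ a # p @ q)" using Cons.hyps[of "us @ [a]" "p @ q"] Cons.prems(1) eq by simp
    also have "\<dots> = g (us @ ys)" using front[of us p a q] Cons.prems ys by simp
    finally show ?case .
  qed simp
  from this[of "[]"] show ?thesis using M by simp
qed

section \<open>Swaps of neighbouring blocks\<close>

lemma der_aux_append:
  "der_aux (u @ v) a b f = der_aux u a b (\<lambda>w. f (w @ v)) + der_aux v a b (\<lambda>w. f (u @ w))"
  by (induct u arbitrary: f) simp_all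

lemma der_aux_cong: "(\<And>w. length w = length u \<Longrightarrow> f w = g w) \<Longrightarrow> der_aux u a b f = der_aux u a b g"
proof (induct u arbitrary: f g)
  case (Cons x u)
  have "der_aux u a b (\<lambda>v. f (x # v)) = der_aux u a b (\<lambda>v. g (x # v))"
    by (rule Cons.hyps) (simp add: Cons.prems)
  moreover have "f (b # u) = g (b # u)" by (simp add: Cons.prems)
  ultimately show ?case by simp
qed simp

definition swap_blocks :: "nat \<Rightarrow> nat \<Rightarrow> nat list \<Rightarrow> nat list" where
  "swap_blocks n k u = take (n * k) u @ take n (drop (n * k + n) u) @ take n (drop (n * k) u) @ drop (n * k + n + n) u"

lemma bswap_append: "length p = n * k \<Longrightarrow> length q = n \<Longrightarrow> length s = n \<Longrightarrow> swap_blocks n k (p @ q @ s @ t) = p @ s @ q @ t"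
  by (simp add: swap_blocks_def)

lemma block_split:
  assumes "length u = n * i" "Suc k < i"
  obtains p q s t where "u = p @ q @ s @ t" "length p = n * k" "length q = n" "length s = n"
    "length t = n * (i - k - 2)"
proof -
  obtain j where j: "i = Suc (Suc k) + j" using assms(2) less_iff_Suc_add by (metis Suc_leI le_iff_add)
  have "u = take (n * k) u @ take n (drop (n * k) u) @ take n (drop (n * k + n) u) @ drop (n * k + n + n) u"
    by (metis append_take_drop_id drop_drop add.commute)
  then show ?thesis by (rule that) (use assms(1) in \<open>auto simp: j algebra_simps\<close>)
qed

lift_definition block_swap :: "nat \<Rightarrow> nat \<Rightarrow> real tensor \<Rightarrow> real tensor" is "\<lambda>n k f u. f (swap_blocks n k u)" .

lemma coeff_bs: "coeff (block_swap n k f) u = coeff f (swap_blocks n k u)"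
  by transfer simp

lemma length_bswap_any: "length (swap_blocks n k u) = length u"
  by (simp add: swap_blocks_def)

lemma linear_bs: "linear (block_swap n k)"
  by (rule linearI) (auto intro!: tensor_eqI simp: coeff_bs)

text \<open>By the Leibniz rule a derivation acts on one block at a time, so it commutes with
  permuting the blocks. Outside length \<open>n * i\<close> both sides vanish.\<close>

lemma der_bs:
  assumes f: "\<And>u. coeff f u \<noteq> 0 \<Longrightarrow> length u = n * i" and k: "Suc k < i"
  shows "der a b (block_swap n k f) = block_swap n k (der a b f)"
proof (rule tensor_eqI)
  fix u
  show "coeff (der a b (block_swap n k f)) u = coeff (block_swap n k (der a b f)) u"
  proof (cases "length u = n * i")
    case False
    have "coeff (der a b g) v = 0" if "\<And>u. coeff g u \<noteq> 0 \<Longrightarrow> length u = n * i" "length v \<noteq> n * i" for g v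
    proof (rule ccontr)
      assume "coeff (der a b g) v \<noteq> 0"
      then obtain w where "coeff g w \<noteq> 0" "length w = length v"
        using der_aux_nonzero[of v a b "coeff g"] by (auto simp: coeff_der)
      then show False using that(1)[of w] that(2) by simp
    qed
    note vanish = this
    have "coeff (der a b (block_swap n k f)) u = 0"
    proof (rule vanish[OF _ False])
      fix w assume "coeff (block_swap n k f) w \<noteq> 0"
      then show "length w = n * i" using f[of "swap_blocks n k w"] by (simp add: coeff_bs length_bswap_any)
    qed
    moreover have "coeff (der a b f) (swap_blocks n k u) = 0"
      using vanish[of f "swap_blocks n k u"] f False by (simp add: length_bswap_any)
    ultimately show ?thesis by (simp add: coeff_bs)
  next
    case True
    obtain p q s t where u: "u = p @ q @ s @ t" and l: "length p = n * k" "length q = n" "length s = n"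
      using block_split[OF True k] by metis
    let ?F = "\<lambda>w. coeff f (swap_blocks n k w)"
    have "der_aux u a b ?F = der_aux p a b (\<lambda>w. ?F (w @ q @ s @ t)) + der_aux q a b (\<lambda>w. ?F (p @ w @ s @ t)) +
        der_aux s a b (\<lambda>w. ?F (p @ q @ w @ t)) + der_aux t a b (\<lambda>w. ?F (p @ q @ s @ w))"
      by (simp add: u der_aux_append)
    also have "der_aux p a b (\<lambda>w. ?F (w @ q @ s @ t)) = der_aux p a b (\<lambda>w. coeff f (w @ s @ q @ t))"
      by (rule der_aux_cong) (simp add: bswap_append l)
    also have "der_aux q a b (\<lambda>w. ?F (p @ w @ s @ t)) = der_aux q a b (\<lambda>w. coeff f (p @ s @ w @ t))"
      by (rule der_aux_cong) (simp add: bswap_append l)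
    also have "der_aux s a b (\<lambda>w. ?F (p @ q @ w @ t)) = der_aux s a b (\<lambda>w. coeff f (p @ w @ q @ t))"
      by (rule der_aux_cong) (simp add: bswap_append l)
    also have "der_aux t a b (\<lambda>w. ?F (p @ q @ s @ w)) = der_aux t a b (\<lambda>w. coeff f (p @ s @ q @ w))"
      by (rule der_aux_cong) (simp add: bswap_append l)
    finally have "der_aux u a b ?F = der_aux (p @ s @ q @ t) a b (coeff f)"
      by (simp add: der_aux_append)
    moreover have "coeff (block_swap n k f) = ?F" by (rule ext) (rule coeff_bs)
    ultimately show ?thesis by (simp add: coeff_der coeff_bs u bswap_append l)
  qed
qed

context hall_set
begin

text \<open>
  The exterior power is the space of those elements of \<open>L \<otimes> \<dots> \<otimes> L\<close> on which all swaps of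
  neighbouring blocks of \<open>n\<close> letters act by \<open>-1\<close>.
\<close>

definition hall_lists :: "nat \<Rightarrow> nat \<Rightarrow> (nat \<Rightarrow> int) \<Rightarrow> nat free_lie list set" where
  "hall_lists n i \<mu> = {hs. set hs \<subseteq> hall r n \<and> length hs = i \<and> mweight (sum_list (map wt hs)) = \<mu>}"

definition hall_tensors :: "nat \<Rightarrow> nat \<Rightarrow> (nat \<Rightarrow> int) \<Rightarrow> real tensor set" where
  "hall_tensors n i \<mu> = span (hall_prod ` hall_lists n i \<mu>)"

definition alternating :: "nat \<Rightarrow> nat \<Rightarrow> (nat \<Rightarrow> int) \<Rightarrow> real tensor set" where
  "alternating n i \<mu> = {f \<in> hall_tensors n i \<mu>. \<forall>k. Suc k < i \<longrightarrow> block_swap n k f = - f}"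

lemma hall_H: "1 \<le> n \<Longrightarrow> hall r n \<subseteq> H"
  by (auto simp: H_def)

lemma size_wt_hall: "1 \<le> n \<Longrightarrow> h \<in> hall r n \<Longrightarrow> size (wt h) = n"
  using size_wt hall_H degree_eq by blast

lemma PP_wspace: "set hs \<subseteq> H \<Longrightarrow> hall_prod hs \<in> weight_space (mweight (sum_list (map wt hs)))"
proof (induct hs)
  case Nil
  then show ?case using monom_weight_space[of "[]"] by (simp add: ctn_mw monom_Nil)
next
  case (Cons h hs)
  then show ?case
    using mult_weight_space[of "hall_poly h" "mweight (wt h)" "hall_prod hs"] eta_rel_wspace[OF eta_rel_wt, of h] by (simp add: mw_add)
qed

lemma size_sum_wt: "1 \<le> n \<Longrightarrow> set hs \<subseteq> hall r n \<Longrightarrow> size (sum_list (map wt hs)) = n * length hs"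
  by (induct hs) (auto simp: size_wt_hall)

lemma PP_length:
  assumes "1 \<le> n" "set hs \<subseteq> hall r n" "coeff (hall_prod hs) u \<noteq> 0" shows "length u = n * length hs"
proof -
  have "hall_prod hs \<in> weight_space (mweight (sum_list (map wt hs)))" using PP_wspace assms(2) hall_H[OF assms(1)] by auto
  then have "mset u = sum_list (map wt hs)" using assms(3) by (simp add: weight_space_def ctn_mw mw_inj)
  then have "length u = size (sum_list (map wt hs))" by (metis size_mset)
  then show ?thesis using size_sum_wt[OF assms(1,2)] by simp
qed

lemma coeff_PP_append:
  assumes "1 \<le> n" "set hs \<subseteq> hall r n" "length u = n * length hs"
  shows "coeff (hall_prod hs * g) (u @ v) = coeff (hall_prod hs) u * coeff g v"
  unfolding coeff_mult by (rule conv_append[where n="n * length hs"]) (use PP_length[OF assms(1,2)] assms(3) in blast)+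

lemma coeff_lpoly_append:
  assumes "1 \<le> n" "h \<in> hall r n" "length u = n"
  shows "coeff (hall_poly h * g) (u @ v) = coeff (hall_poly h) u * coeff g v"
  using coeff_PP_append[of n "[h]" u g v] assms by simp

lemma finite_HL: "1 \<le> n \<Longrightarrow> finite (hall_lists n i \<mu>)"
proof (cases "hall_lists n i \<mu> = {}")
  case False
  assume n: "1 \<le> n"
  obtain hs0 where hs0: "hs0 \<in> hall_lists n i \<mu>" using False by blast
  define M where "M = sum_list (map wt hs0)"
  have M: "\<mu> = mweight M" using hs0 by (simp add: hall_lists_def M_def)
  have "hall_lists n i \<mu> \<subseteq> {hs. set hs \<subseteq> {x \<in> H. wt x \<subseteq># M} \<and> length hs = i}"
  proof
    fix hs assume "hs \<in> hall_lists n i \<mu>"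
    then have hs: "set hs \<subseteq> hall r n" "length hs = i" "sum_list (map wt hs) = M" by (auto simp: hall_lists_def M mw_inj)
    have "wt h \<subseteq># M" if "h \<in> set hs" for h
      using that unfolding hs(3)[symmetric] by (induct hs) (auto intro: subset_mset.add_increasing subset_mset.add_increasing2)
    then show "hs \<in> {hs. set hs \<subseteq> {x \<in> H. wt x \<subseteq># M} \<and> length hs = i}" using hs hall_H[OF n] by auto
  qed
  then show ?thesis using finite_lists_length_eq[OF finite_wt_le] finite_subset by blast
qed simp

text \<open>Here all lists of \<open>i\<close> Hall elements occur, not only decreasing ones; this
  is the independence of pure tensors in a tensor power. As all factors have degree
  \<open>n\<close>, the coefficient at \<open>u @ v\<close> factors, and for fixed \<open>v\<close>
  a relation becomes one between Hall polynomials.\<close>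

lemma PP_hall_independent:
  assumes n: "1 \<le> n"
  shows "finite S \<Longrightarrow> (\<And>hs. hs \<in> S \<Longrightarrow> set hs \<subseteq> hall r n \<and> length hs = i) \<Longrightarrow>
    (\<Sum>hs\<in>S. c hs *\<^sub>R hall_prod hs) = 0 \<Longrightarrow> hs \<in> S \<Longrightarrow> c hs = 0"
proof (induct i arbitrary: S c hs)
  case 0
  then have "S = {[]}" by auto
  then show ?case using 0 by simp
next
  case (Suc i)
  define B T where "B = hd ` S" and "T = tl ` S"
  have cons: "hs = hd hs # tl hs \<and> hd hs \<in> hall r n \<and> set (tl hs) \<subseteq> hall r n \<and> length (tl hs) = i" if "hs \<in> S" for hs
    using Suc.prems(2)[OF that] by (cases hs) auto
  have fin: "finite B" "finite T" using Suc.prems(1) by (auto simp: B_def T_def)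
  have BT: "B \<subseteq> hall r n" "\<And>t. t \<in> T \<Longrightarrow> set t \<subseteq> hall r n \<and> length t = i"
    using cons by (auto simp: B_def T_def)
  \<comment> \<open>The relation is extended by zero coefficients from \<open>S\<close> to all pairs
    of a head and a tail, so that it becomes a double sum.\<close>
  define d where "d h t = (if h # t \<in> S then c (h # t) else 0)" for h t
  have "(\<Sum>hs\<in>S. c hs *\<^sub>R hall_prod hs) = (\<Sum>(h, t)\<in>B \<times> T. d h t *\<^sub>R (hall_poly h * hall_prod t))"
  proof -
    have "(\<Sum>(h, t)\<in>B \<times> T. d h t *\<^sub>R (hall_poly h * hall_prod t)) = (\<Sum>hs\<in>(\<lambda>(h, t). h # t) ` (B \<times> T). (if hs \<in> S then c hs else 0) *\<^sub>R hall_prod hs)"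
      by (subst sum.reindex) (auto simp: inj_on_def d_def case_prod_unfold intro!: sum.cong)
    also have "\<dots> = (\<Sum>hs\<in>S. (if hs \<in> S then c hs else 0) *\<^sub>R hall_prod hs)"
    proof (rule sum.mono_neutral_right)
      show "S \<subseteq> (\<lambda>(h, t). h # t) ` (B \<times> T)"
      proof
        fix hs assume hs: "hs \<in> S"
        then show "hs \<in> (\<lambda>(h, t). h # t) ` (B \<times> T)"
          using cons[OF hs] by (intro image_eqI[of _ _ "(hd hs, tl hs)"]) (auto simp: B_def T_def)
      qed
    qed (use fin in auto)
    finally show ?thesis by simp
  qed
  then have z: "(\<Sum>h\<in>B. \<Sum>t\<in>T. d h t *\<^sub>R (hall_poly h * hall_prod t)) = 0"
    using Suc.prems(3) by (simp add: sum.cartesian_product)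
  have dz: "(\<Sum>t\<in>T. d h t *\<^sub>R hall_prod t) = 0" if h: "h \<in> B" for h
  proof (rule tensor_eqI)
    fix v
    have "(\<Sum>h\<in>B. (\<Sum>t\<in>T. d h t * coeff (hall_prod t) v) *\<^sub>R hall_poly h) = 0"
    proof (rule tensor_eqI)
      fix u
      show "coeff (\<Sum>h\<in>B. (\<Sum>t\<in>T. d h t * coeff (hall_prod t) v) *\<^sub>R hall_poly h) u = coeff 0 u"
      proof (cases "length u = n")
        case True
        have "0 = coeff (\<Sum>h\<in>B. \<Sum>t\<in>T. d h t *\<^sub>R (hall_poly h * hall_prod t)) (u @ v)" unfolding z by simp
        also have "\<dots> = (\<Sum>h\<in>B. \<Sum>t\<in>T. d h t * (coeff (hall_poly h) u * coeff (hall_prod t) v))"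
          unfolding coeff_sum using coeff_lpoly_append[OF n _ True] BT(1) by (intro sum.cong refl) auto
        also have "\<dots> = coeff (\<Sum>h\<in>B. (\<Sum>t\<in>T. d h t * coeff (hall_prod t) v) *\<^sub>R hall_poly h) u"
          unfolding coeff_sum coeff_simps real_scaleR_def sum_distrib_right by (simp add: mult_ac)
        finally show ?thesis by simp
      next
        case False
        have "coeff (hall_poly h) u = 0" if "h \<in> B" for h
          using PP_length[OF n, of "[h]" u] BT(1) that False by auto
        then show ?thesis by (simp add: coeff_sum)
      qed
    qed
    then have "(\<Sum>t\<in>T. d h t * coeff (hall_prod t) v) = 0"
      using hall_independent[OF fin(1) _ _ h, of "\<lambda>h. \<Sum>t\<in>T. d h t * coeff (hall_prod t) v"] BT(1) hall_H[OF n] by blast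
    then show "coeff (\<Sum>t\<in>T. d h t *\<^sub>R hall_prod t) v = coeff 0 v" by (simp add: coeff_sum)
  qed
  have "d (hd hs) (tl hs) = 0"
    by (rule Suc.hyps[OF fin(2) BT(2) dz]) (use Suc.prems(4) in \<open>auto simp: B_def T_def\<close>)
  then show ?case using cons[OF Suc.prems(4)] Suc.prems(4) by (simp add: d_def)
qed

lemma LT_wspace: "1 \<le> n \<Longrightarrow> hall_tensors n i \<mu> \<subseteq> weight_space \<mu>"
proof -
  assume n: "1 \<le> n"
  have "hall_prod ` hall_lists n i \<mu> \<subseteq> weight_space \<mu>"
    using PP_wspace hall_H[OF n] by (auto simp: hall_lists_def)
  then show ?thesis unfolding hall_tensors_def by (rule real_vector.span_minimal) (rule subspace_weight_space)
qed

lemma LT_length: "1 \<le> n \<Longrightarrow> f \<in> hall_tensors n i \<mu> \<Longrightarrow> coeff f u \<noteq> 0 \<Longrightarrow> length u = n * i"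
proof (rule ccontr)
  assume n: "1 \<le> n" and f: "f \<in> hall_tensors n i \<mu>" and nz: "coeff f u \<noteq> 0" and l: "length u \<noteq> n * i"
  have "coeff f u = 0" using f unfolding hall_tensors_def
  proof (induct rule: real_vector.span_induct_alt)
    case (step c x y)
    then obtain hs where "x = hall_prod hs" "set hs \<subseteq> hall r n" "length hs = i" by (auto simp: hall_lists_def)
    then have "coeff x u = 0" using PP_length[OF n, of hs u] l by auto
    then show ?case using step by simp
  qed simp
  then show False using nz by simp
qed

lemma LT_mult:
  assumes n: "1 \<le> n" and x: "x \<in> L \<mu>" "\<And>h. h \<in> H \<Longrightarrow> mweight (wt h) = \<mu> \<Longrightarrow> h \<in> hall r n" and y: "y \<in> hall_tensors n i \<nu>"
  shows "x * y \<in> hall_tensors n (Suc i) (\<lambda>j. \<mu> j + \<nu> j)"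
  using x(1)
proof (rule L_induct)
  let ?V = "hall_tensors n (Suc i) (\<lambda>j. \<mu> j + \<nu> j)"
  have sV: "subspace ?V" by (simp add: hall_tensors_def)
  show "subspace {x. x * y \<in> ?V}"
    using sV by (auto simp: real_vector.subspace_def algebra_simps)
  fix h assume h: "h \<in> H" "mweight (wt h) = \<mu>"
  show "hall_poly h * y \<in> ?V"
    using y unfolding hall_tensors_def[of n i]
  proof (rule real_vector.span_induct)
    show "subspace {y. hall_poly h * y \<in> ?V}"
      using sV by (auto simp: real_vector.subspace_def algebra_simps)
    fix z assume "z \<in> hall_prod ` hall_lists n i \<nu>"
    then obtain hs where hs: "hs \<in> hall_lists n i \<nu>" "z = hall_prod hs" by blast
    have "h # hs \<in> hall_lists n (Suc i) (\<lambda>j. \<mu> j + \<nu> j)"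
      using hs(1) x(2)[OF h] h(2) by (auto simp: hall_lists_def mw_add)
    then have "hall_prod (h # hs) \<in> ?V" unfolding hall_tensors_def by (intro real_vector.span_base) blast
    then show "hall_poly h * z \<in> ?V" by (simp add: hs(2))
  qed
qed

lemma hall_of_weight: "1 \<le> n \<Longrightarrow> h \<in> H \<Longrightarrow> size (wt h) = n \<Longrightarrow> h \<in> hall r n"
  using size_wt H_degree by metis

lemma size_shift:
  assumes "mweight M' = shift 1 a b (mweight M)" shows "size M' = size M"
proof -
  have "count (M' + {#b#}) j = count (M + {#a#}) j" for j
    using fun_cong[OF assms, of j] by (cases "j = a"; cases "j = b") (simp_all add: mweight_def shift_def)
  then have "M' + {#b#} = M + {#a#}" by (rule multiset_eqI)
  from arg_cong[OF this, of size] show ?thesis by simp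
qed

lemma der_PP:
  assumes n: "1 \<le> n"
  shows "set hs \<subseteq> hall r n \<Longrightarrow> der a b (hall_prod hs) \<in> hall_tensors n (length hs) (shift 1 a b (mweight (sum_list (map wt hs))))"
proof (induct hs)
  case Nil
  have "der a b 1 = 0" using der_mult[of a b 1 1] by simp
  then show ?case by (simp add: hall_tensors_def real_vector.span_zero)
next
  case (Cons h hs)
  have h: "h \<in> hall r n" "h \<in> H" using Cons.prems hall_H[OF n] by auto
  have 1: "der a b (hall_poly h) * hall_prod hs \<in> hall_tensors n (Suc (length hs)) (\<lambda>j. shift 1 a b (mweight (wt h)) j + mweight (sum_list (map wt hs)) j)"
  proof (rule LT_mult[OF n der_L[OF lpoly_L[OF h(2)]]])
    fix g assume "g \<in> H" "mweight (wt g) = shift 1 a b (mweight (wt h))"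
    then show "g \<in> hall r n" using size_shift size_wt_hall[OF n h(1)] by (intro hall_of_weight[OF n]) auto
  next
    show "hall_prod hs \<in> hall_tensors n (length hs) (mweight (sum_list (map wt hs)))"
      unfolding hall_tensors_def using Cons.prems by (intro real_vector.span_base) (auto simp: hall_lists_def)
  qed
  have 2: "hall_poly h * der a b (hall_prod hs) \<in> hall_tensors n (Suc (length hs)) (\<lambda>j. mweight (wt h) j + shift 1 a b (mweight (sum_list (map wt hs))) j)"
  proof (rule LT_mult[OF n lpoly_L[OF h(2)]])
    fix g assume "g \<in> H" "mweight (wt g) = mweight (wt h)"
    then show "g \<in> hall r n" using size_wt_hall[OF n h(1)] by (intro hall_of_weight[OF n]) (auto simp: mw_inj)
  qed (use Cons in auto)
  have e: "(\<lambda>j. shift 1 a b (mweight (wt h)) j + mweight (sum_list (map wt hs)) j) = shift 1 a b (mweight (sum_list (map wt (h # hs))))"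
    "(\<lambda>j. mweight (wt h) j + shift 1 a b (mweight (sum_list (map wt hs))) j) = shift 1 a b (mweight (sum_list (map wt (h # hs))))"
    by (auto simp: shift_def mw_add)
  show ?case using real_vector.span_add[OF 1[unfolded e hall_tensors_def] 2[unfolded e hall_tensors_def]] by (simp add: der_mult hall_tensors_def)
qed

lemma der_LT: "1 \<le> n \<Longrightarrow> f \<in> hall_tensors n i \<mu> \<Longrightarrow> der a b f \<in> hall_tensors n i (shift 1 a b \<mu>)"
proof -
  assume n: "1 \<le> n" and f: "f \<in> hall_tensors n i \<mu>"
  show ?thesis using f unfolding hall_tensors_def[of n i \<mu>]
  proof (rule real_vector.span_induct)
    show "subspace {f. der a b f \<in> hall_tensors n i (shift 1 a b \<mu>)}"
      by (auto simp: hall_tensors_def real_vector.subspace_def der_add der_scale intro: real_vector.span_zero real_vector.span_add real_vector.span_scale)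
    fix x assume "x \<in> hall_prod ` hall_lists n i \<mu>"
    then show "der a b x \<in> hall_tensors n i (shift 1 a b \<mu>)" using der_PP[OF n] by (auto simp: hall_lists_def)
  qed
qed

lemma weight_module_ALT: assumes n: "1 \<le> n" shows "weight_module (alternating n i)"
  unfolding weight_module_def
proof (intro allI conjI)
  fix \<mu> a b
  show "subspace (alternating n i \<mu>)" unfolding alternating_def hall_tensors_def
    by (auto simp: real_vector.subspace_def linear_add[OF linear_bs] linear_0[OF linear_bs] linear_scale[OF linear_bs]
      intro: real_vector.span_zero real_vector.span_add real_vector.span_scale)
  show "alternating n i \<mu> \<subseteq> weight_space \<mu>" using LT_wspace[OF n] by (auto simp: alternating_def)
  show "der a b ` alternating n i \<mu> \<subseteq> alternating n i (shift 1 a b \<mu>)"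
  proof (rule image_subsetI)
    fix f assume f: "f \<in> alternating n i \<mu>"
    then have fL: "f \<in> hall_tensors n i \<mu>" by (simp add: alternating_def)
    have "block_swap n k (der a b f) = - der a b f" if "Suc k < i" for k
    proof -
      have "block_swap n k (der a b f) = der a b (block_swap n k f)" using der_bs[OF LT_length[OF n fL] that] by simp
      also have "\<dots> = - der a b f" using f that der_diff[of a b 0 f] by (simp add: alternating_def)
      finally show ?thesis .
    qed
    then show "der a b f \<in> alternating n i (shift 1 a b \<mu>)" using der_LT[OF n fL] by (simp add: alternating_def)
  qed
qed

end

definition swap_at :: "nat \<Rightarrow> 'h list \<Rightarrow> 'h list" where
  "swap_at k hs = take k hs @ hs ! Suc k # hs ! k # drop (Suc (Suc k)) hs"

lemma swp_append: "length us = k \<Longrightarrow> swap_at k (us @ x # y # vs) = us @ y # x # vs"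
  by (auto simp: swap_at_def nth_append)

lemma swp_split:
  assumes "Suc k < length hs"
  obtains us x y vs where "hs = us @ x # y # vs" "length us = k" "swap_at k hs = us @ y # x # vs"
proof -
  have e: "hs = take k hs @ hs ! k # hs ! Suc k # drop (Suc (Suc k)) hs"
    using assms by (metis Cons_nth_drop_Suc Suc_lessD append_take_drop_id)
  show ?thesis by (rule that[OF e]) (use assms in \<open>simp_all add: swap_at_def\<close>)
qed

context hall_set
begin

text \<open>Each Hall factor occupies exactly one block of \<open>n\<close> letters, so exchanging
  blocks exchanges factors.\<close>

lemma bs_PP:
  assumes n: "1 \<le> n" and hs: "set (us @ x # y # vs) \<subseteq> hall r n"
  shows "block_swap n (length us) (hall_prod (us @ x # y # vs)) = hall_prod (us @ y # x # vs)"
proof (rule tensor_eqI)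
  fix u
  let ?i = "length (us @ x # y # vs)" and ?k = "length us"
  have m: "set us \<subseteq> hall r n" "x \<in> hall r n" "y \<in> hall r n" "set vs \<subseteq> hall r n" using hs by auto
  show "coeff (block_swap n ?k (hall_prod (us @ x # y # vs))) u = coeff (hall_prod (us @ y # x # vs)) u"
  proof (cases "length u = n * ?i")
    case True
    have "Suc ?k < ?i" by simp
    then obtain p q s t where u: "u = p @ q @ s @ t" and l: "length p = n * ?k" "length q = n" "length s = n"
      using block_split[OF True] by metis
    have "coeff (hall_prod (us @ x # y # vs)) (p @ s @ q @ t) = coeff (hall_prod us) p * (coeff (hall_poly x) s * (coeff (hall_poly y) q * coeff (hall_prod vs) t))"
      using m l n by (simp add: coeff_PP_append coeff_lpoly_append)
    moreover have "coeff (hall_prod (us @ y # x # vs)) (p @ q @ s @ t) = coeff (hall_prod us) p * (coeff (hall_poly y) q * (coeff (hall_poly x) s * coeff (hall_prod vs) t))"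
      using m l n by (simp add: coeff_PP_append coeff_lpoly_append)
    ultimately show ?thesis by (simp only: coeff_bs u bswap_append[OF l] mult_ac)
  next
    case False
    have "coeff (hall_prod (us @ x # y # vs)) (swap_blocks n ?k u) = 0"
      using PP_length[OF n hs, of "swap_blocks n ?k u"] False by (auto simp: length_bswap_any)
    moreover have "coeff (hall_prod (us @ y # x # vs)) u = 0"
      using PP_length[OF n, of "us @ y # x # vs" u] False hs by auto
    ultimately show ?thesis by (simp only: coeff_bs)
  qed
qed

lemma swp_HL:
  assumes "hs \<in> hall_lists n i \<mu>" "Suc k < i" shows "swap_at k hs \<in> hall_lists n i \<mu>" "swap_at k (swap_at k hs) = hs"
proof -
  have "Suc k < length hs" using assms by (simp add: hall_lists_def)
  then obtain us x y vs where e: "hs = us @ x # y # vs" "length us = k" "swap_at k hs = us @ y # x # vs" by (rule swp_split)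
  show "swap_at k hs \<in> hall_lists n i \<mu>" using assms(1) unfolding e(3) by (simp add: hall_lists_def e(1) algebra_simps)
  show "swap_at k (swap_at k hs) = hs" by (simp add: e(3) swp_append[OF e(2)]) (simp add: e(1))
qed

lemma bs_lincomb:
  assumes n: "1 \<le> n" and k: "Suc k < i"
  shows "block_swap n k (\<Sum>hs\<in>hall_lists n i \<mu>. c hs *\<^sub>R hall_prod hs) = (\<Sum>hs\<in>hall_lists n i \<mu>. c (swap_at k hs) *\<^sub>R hall_prod hs)"
proof -
  have "block_swap n k (\<Sum>hs\<in>hall_lists n i \<mu>. c hs *\<^sub>R hall_prod hs) = (\<Sum>hs\<in>hall_lists n i \<mu>. c hs *\<^sub>R block_swap n k (hall_prod hs))"
    by (simp add: linear_sum[OF linear_bs] linear_scale[OF linear_bs])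
  also have "\<dots> = (\<Sum>hs\<in>hall_lists n i \<mu>. c hs *\<^sub>R hall_prod (swap_at k hs))"
  proof (rule sum.cong[OF refl])
    fix hs assume hs: "hs \<in> hall_lists n i \<mu>"
    then have "Suc k < length hs" using k by (simp add: hall_lists_def)
    then obtain us x y vs where e: "hs = us @ x # y # vs" "length us = k" "swap_at k hs = us @ y # x # vs" by (rule swp_split)
    have "set (us @ x # y # vs) \<subseteq> hall r n" using hs e(1) by (simp add: hall_lists_def)
    from bs_PP[OF n this] show "c hs *\<^sub>R block_swap n k (hall_prod hs) = c hs *\<^sub>R hall_prod (swap_at k hs)" by (simp only: e(2,3) e(1)[symmetric])
  qed
  also have "\<dots> = (\<Sum>hs\<in>hall_lists n i \<mu>. c (swap_at k hs) *\<^sub>R hall_prod hs)"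
    by (rule sum.reindex_bij_witness[where i="swap_at k" and j="swap_at k"]) (use swp_HL k in auto)
  finally show ?thesis .
qed

section \<open>Signs and a basis of the antisymmetric tensors\<close>

definition pair_sign :: "nat free_lie \<Rightarrow> nat free_lie \<Rightarrow> real" where
  "pair_sign x y = (if x = y then 0 else if (x, y) \<in> r then 1 else - 1)"

text \<open>On Hall elements, the sign of the permutation that sorts the list, and 0 if an entry is
  repeated. A product over pairs makes the effect of an adjacent swap immediate.\<close>

primrec list_sign :: "nat free_lie list \<Rightarrow> real" where
  "list_sign [] = 1"
| "list_sign (x # xs) = prod_list (map (pair_sign x) xs) * list_sign xs"

lemma sg_swap: "x \<in> H \<Longrightarrow> y \<in> H \<Longrightarrow> pair_sign y x = - pair_sign x y"
  using order(3) less_asym by (auto simp: pair_sign_def total_on_def)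

lemma sgnl_swap: "x \<in> H \<Longrightarrow> y \<in> H \<Longrightarrow> list_sign (us @ y # x # vs) = - list_sign (us @ x # y # vs)"
  by (induct us) (simp_all add: sg_swap[of x y] algebra_simps)

lemma sgnl_square: "distinct xs \<Longrightarrow> list_sign xs * list_sign xs = 1"
proof (induct xs)
  case (Cons x xs)
  have "prod_list (map (pair_sign x) ys) * prod_list (map (pair_sign x) ys) = 1" if "x \<notin> set ys" for ys
    using that by (induct ys) (auto simp: pair_sign_def)
  then have "prod_list (map (pair_sign x) xs) * prod_list (map (pair_sign x) xs) = 1" using Cons.prems by simp
  then show ?case using Cons by (simp add: mult.assoc mult.left_commute)
qed simp

definition hall_subsets :: "nat \<Rightarrow> nat \<Rightarrow> (nat \<Rightarrow> int) \<Rightarrow> nat free_lie set set" where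
  "hall_subsets n i \<mu> = {A. A \<subseteq> hall r n \<and> finite A \<and> card A = i \<and> mweight (\<Sum>h\<in>A. wt h) = \<mu>}"

lemma HL_distinct: "hs \<in> hall_lists n i \<mu> \<Longrightarrow> distinct hs \<longleftrightarrow> set hs \<in> hall_subsets n i \<mu>"
proof -
  assume hs: "hs \<in> hall_lists n i \<mu>"
  have "distinct hs \<Longrightarrow> sum_list (map wt hs) = (\<Sum>h\<in>set hs. wt h)" by (simp add: sum_list_distinct_conv_sum_set)
  then show ?thesis using hs distinct_card[of hs] card_distinct[of hs] by (auto simp: hall_lists_def hall_subsets_def)
qed

lemma subs_list:
  assumes "A \<in> hall_subsets n i \<mu>" obtains l where "l \<in> hall_lists n i \<mu>" "distinct l" "set l = A"
proof -
  obtain l where l: "set l = A" "distinct l" using assms finite_distinct_list unfolding hall_subsets_def by blast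
  then have "l \<in> hall_lists n i \<mu>" using assms distinct_card[of l] sum_list_distinct_conv_sum_set[of l wt] by (simp add: hall_lists_def hall_subsets_def)
  then show ?thesis using that l by blast
qed

lemma finite_subs: assumes "1 \<le> n" shows "finite (hall_subsets n i \<mu>)"
proof -
  have "hall_subsets n i \<mu> \<subseteq> set ` hall_lists n i \<mu>"
  proof
    fix A assume "A \<in> hall_subsets n i \<mu>"
    then obtain l where "l \<in> hall_lists n i \<mu>" "set l = A" by (rule subs_list)
    then show "A \<in> set ` hall_lists n i \<mu>" by blast
  qed
  then show ?thesis by (rule finite_subset) (rule finite_imageI[OF finite_HL[OF assms]])
qed

text \<open>A repeated entry can be moved next to its twin, where the swap fixes the list and so
  forces the coefficient to be its own negative. Moreover \<open>c\<close> and
  \<open>list_sign\<close> both change sign under a swap, so their product is the same for all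
  rearrangements.\<close>

lemma alternating_coeff:
  assumes n: "1 \<le> n" and alt: "\<And>k hs. Suc k < i \<Longrightarrow> hs \<in> hall_lists n i \<mu> \<Longrightarrow> c (swap_at k hs) = - (c hs :: real)"
    and hs: "hs \<in> hall_lists n i \<mu>"
  shows "\<not> distinct hs \<Longrightarrow> c hs = 0"
    and "l \<in> hall_lists n i \<mu> \<Longrightarrow> mset l = mset hs \<Longrightarrow> c hs * list_sign hs = c l * list_sign l"
proof -
  let ?M = "mset hs"
  have mem: "ys \<in> hall_lists n i \<mu>" if "mset ys = ?M" for ys
    using hs that mset_eq_setD[OF that] mset_eq_length[OF that] sum_mset_sum_list[of "map wt ys"] sum_mset_sum_list[of "map wt hs"]
    by (simp add: hall_lists_def)
  have sw: "c (us @ y # x # vs) = - c (us @ x # y # vs)" if "mset (us @ x # y # vs) = ?M" for us x y vs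
  proof -
    have m: "us @ x # y # vs \<in> hall_lists n i \<mu>" using mem[OF that] .
    then have "Suc (length us) < i" by (auto simp: hall_lists_def)
    from alt[OF this m] show ?thesis by (simp add: swp_append)
  qed
  show "c hs = 0" if nd: "\<not> distinct hs"
  proof -
    obtain xs ys zs y where d: "hs = xs @ [y] @ ys @ [y] @ zs" using not_distinct_decomp[OF nd] by blast
    have "\<bar>c hs\<bar> = \<bar>c (y # y # xs @ ys @ zs)\<bar>"
      by (rule perm_invariant[where M="?M" and g="\<lambda>hs. \<bar>c hs\<bar>"]) (use sw in \<open>simp_all add: d\<close>)
    moreover have "c (y # y # xs @ ys @ zs) = 0" using sw[of "[]" y y "xs @ ys @ zs"] by (simp add: d)
    ultimately show ?thesis by simp
  qed
  show "c hs * list_sign hs = c l * list_sign l" if "mset l = mset hs"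
  proof (rule perm_invariant[where M="?M" and g="\<lambda>hs. c hs * list_sign hs"])
    fix us x y vs assume m: "mset (us @ x # y # vs) = ?M"
    then have xy: "x \<in> H" "y \<in> H" using mem[OF m] hall_H[OF n] by (auto simp: hall_lists_def)
    show "c (us @ x # y # vs) * list_sign (us @ x # y # vs) = c (us @ y # x # vs) * list_sign (us @ y # x # vs)"
      by (simp only: sw[OF m] sgnl_swap[OF xy, of us vs] minus_mult_minus)
  qed (use that in simp_all)
qed

text \<open>The antisymmetrised products \<open>alt A\<close>, one for each \<open>i\<close>-element
  set \<open>A\<close> of Hall elements, are the images of the wedge products and form a
  basis.\<close>

lemma dim_ALT:
  assumes n: "1 \<le> n" shows "dim (alternating n i \<mu>) = card (hall_subsets n i \<mu>)"
proof -
  define alt where "alt A = (\<Sum>hs\<in>hall_lists n i \<mu>. (if set hs = A then list_sign hs else 0) *\<^sub>R hall_prod hs)" for A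
  have fin: "finite (hall_lists n i \<mu>)" by (rule finite_HL[OF n])
  have finS: "finite (hall_subsets n i \<mu>)" by (rule finite_subs[OF n])
  have indep: "c hs = 0" if "(\<Sum>hs\<in>hall_lists n i \<mu>. c hs *\<^sub>R hall_prod hs) = 0" "hs \<in> hall_lists n i \<mu>" for c hs
    by (rule PP_hall_independent[OF n fin _ that, of i]) (auto simp: hall_lists_def)
  have comb: "(\<Sum>A\<in>hall_subsets n i \<mu>. a A *\<^sub>R alt A) =
      (\<Sum>hs\<in>hall_lists n i \<mu>. (if set hs \<in> hall_subsets n i \<mu> then a (set hs) * list_sign hs else 0) *\<^sub>R hall_prod hs)" for a
  proof -
    have "(\<Sum>A\<in>hall_subsets n i \<mu>. a A *\<^sub>R alt A) =
        (\<Sum>hs\<in>hall_lists n i \<mu>. \<Sum>A\<in>hall_subsets n i \<mu>. (if set hs = A then a A * list_sign hs else 0) *\<^sub>R hall_prod hs)"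
      unfolding alt_def real_vector.scale_sum_right
      by (subst sum.swap) (intro sum.cong refl, simp)
    also have "\<dots> = (\<Sum>hs\<in>hall_lists n i \<mu>. (if set hs \<in> hall_subsets n i \<mu> then a (set hs) * list_sign hs else 0) *\<^sub>R hall_prod hs)"
      by (rule sum.cong[OF refl]) (simp add: finS flip: real_vector.scale_sum_left)
    finally show ?thesis .
  qed
  have alt_mem: "alt A \<in> alternating n i \<mu>" for A
  proof -
    have "alt A \<in> hall_tensors n i \<mu>" unfolding alt_def hall_tensors_def
      by (intro real_vector.span_sum real_vector.span_scale real_vector.span_base) auto
    moreover have "block_swap n k (alt A) = - alt A" if k: "Suc k < i" for k
    proof -
      have "block_swap n k (alt A) = (\<Sum>hs\<in>hall_lists n i \<mu>. (if set (swap_at k hs) = A then list_sign (swap_at k hs) else 0) *\<^sub>R hall_prod hs)"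
        unfolding alt_def by (rule bs_lincomb[OF n k])
      also have "\<dots> = (\<Sum>hs\<in>hall_lists n i \<mu>. - ((if set hs = A then list_sign hs else 0) *\<^sub>R hall_prod hs))"
      proof (rule sum.cong[OF refl])
        fix hs assume hs: "hs \<in> hall_lists n i \<mu>"
        then have "Suc k < length hs" using k by (simp add: hall_lists_def)
        then obtain us x y vs where e: "hs = us @ x # y # vs" "length us = k" "swap_at k hs = us @ y # x # vs" by (rule swp_split)
        have "x \<in> H" "y \<in> H" using hs hall_H[OF n] by (auto simp: hall_lists_def e(1))
        then have "list_sign (swap_at k hs) = - list_sign hs" using sgnl_swap[of x y us vs] e(1,3) by metis
        moreover have "set (us @ y # x # vs) = set (us @ x # y # vs)" by auto
        then have "set (swap_at k hs) = set hs" using e(1,3) by metis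
        ultimately show "(if set (swap_at k hs) = A then list_sign (swap_at k hs) else 0) *\<^sub>R hall_prod hs = - ((if set hs = A then list_sign hs else 0) *\<^sub>R hall_prod hs)"
          by simp
      qed
      finally show ?thesis by (simp add: alt_def sum_negf)
    qed
    ultimately show ?thesis by (simp add: alternating_def)
  qed
  have sub_indep: "a A = 0" if z: "(\<Sum>A\<in>hall_subsets n i \<mu>. a A *\<^sub>R alt A) = 0" and A: "A \<in> hall_subsets n i \<mu>" for a A
  proof -
    obtain l where l: "l \<in> hall_lists n i \<mu>" "distinct l" "set l = A" using subs_list[OF A] .
    have "(if set l \<in> hall_subsets n i \<mu> then a (set l) * list_sign l else 0) = 0"
      using indep[OF _ l(1), of "\<lambda>hs. if set hs \<in> hall_subsets n i \<mu> then a (set hs) * list_sign hs else 0"] z comb by simp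
    then show ?thesis using A l sgnl_square[OF l(2)] by auto
  qed
  have span: "alternating n i \<mu> \<subseteq> span (alt ` hall_subsets n i \<mu>)"
  proof
    fix f assume f: "f \<in> alternating n i \<mu>"
    have injP: "inj_on hall_prod (hall_lists n i \<mu>)" by (rule family_independent(1)[OF fin]) (rule indep)
    have "f \<in> span (hall_prod ` hall_lists n i \<mu>)" using f by (simp add: alternating_def hall_tensors_def)
    then obtain d where "f = (\<Sum>v\<in>hall_prod ` hall_lists n i \<mu>. d v *\<^sub>R v)"
      using real_vector.span_finite[of "hall_prod ` hall_lists n i \<mu>"] fin by auto
    then have fe: "f = (\<Sum>hs\<in>hall_lists n i \<mu>. d (hall_prod hs) *\<^sub>R hall_prod hs)" by (simp add: sum.reindex[OF injP])
    define c where "c hs = d (hall_prod hs)" for hs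
    have anti: "c (swap_at k hs) = - c hs" if k: "Suc k < i" and hs: "hs \<in> hall_lists n i \<mu>" for k hs
    proof -
      have "block_swap n k f = - f" using f k by (simp add: alternating_def)
      then have "block_swap n k f + f = 0" by simp
      then have "(\<Sum>hs\<in>hall_lists n i \<mu>. (c (swap_at k hs) + c hs) *\<^sub>R hall_prod hs) = 0"
        using bs_lincomb[OF n k, where \<mu>=\<mu> and c=c] fe by (simp add: c_def scaleR_add_left sum.distrib)
      from indep[OF this hs] show ?thesis by simp
    qed
    \<comment> \<open>The coefficient of \<open>alt A\<close> is read off from an arbitrary ordering
      of \<open>A\<close>; by the second part of \<open>alternating_coeff\<close> every ordering
      gives the same value.\<close>
    define a where "a A = (let l = SOME l. l \<in> hall_lists n i \<mu> \<and> distinct l \<and> set l = A in c l * list_sign l)" for A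
    have "c hs = (if set hs \<in> hall_subsets n i \<mu> then a (set hs) * list_sign hs else 0)" if hs: "hs \<in> hall_lists n i \<mu>" for hs
    proof (cases "distinct hs")
      case True
      define l where "l = (SOME l. l \<in> hall_lists n i \<mu> \<and> distinct l \<and> set l = set hs)"
      have l: "l \<in> hall_lists n i \<mu>" "distinct l" "set l = set hs"
        unfolding l_def using someI[of "\<lambda>l. l \<in> hall_lists n i \<mu> \<and> distinct l \<and> set l = set hs" hs] hs True by auto
      have ml: "mset l = mset hs" using l True by (simp add: set_eq_iff_mset_eq_distinct)
      have "c hs * list_sign hs = c l * list_sign l" by (rule alternating_coeff(2)[OF n anti hs l(1) ml])
      also have "\<dots> = a (set hs)" unfolding a_def l_def Let_def ..
      finally have ah: "a (set hs) = c hs * list_sign hs" by simp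
      have "a (set hs) * list_sign hs = c hs * (list_sign hs * list_sign hs)" unfolding ah by (rule mult.assoc)
      then have "a (set hs) * list_sign hs = c hs" using sgnl_square[OF True] by simp
      then show ?thesis using HL_distinct[OF hs] True by simp
    next
      case False
      have "c hs = 0" by (rule alternating_coeff(1)[OF n anti hs False])
      then show ?thesis using HL_distinct[OF hs] False by simp
    qed
    then have "f = (\<Sum>hs\<in>hall_lists n i \<mu>. (if set hs \<in> hall_subsets n i \<mu> then a (set hs) * list_sign hs else 0) *\<^sub>R hall_prod hs)"
      unfolding fe c_def[symmetric] by (intro sum.cong refl) auto
    also have "\<dots> = (\<Sum>A\<in>hall_subsets n i \<mu>. a A *\<^sub>R alt A)" by (rule comb[symmetric])
    also have "\<dots> \<in> span (alt ` hall_subsets n i \<mu>)"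
      by (intro real_vector.span_sum real_vector.span_scale real_vector.span_base) auto
    finally show "f \<in> span (alt ` hall_subsets n i \<mu>)" .
  qed
  have "card (alt ` hall_subsets n i \<mu>) = dim (alternating n i \<mu>)"
  proof (rule real_vector.basis_card_eq_dim[OF _ span])
    show "alt ` hall_subsets n i \<mu> \<subseteq> alternating n i \<mu>" using alt_mem by blast
    show "independent (alt ` hall_subsets n i \<mu>)" by (rule family_independent(2)[OF finS]) (rule sub_indep)
  qed
  moreover have "inj_on alt (hall_subsets n i \<mu>)" by (rule family_independent(1)[OF finS]) (rule sub_indep)
  ultimately show ?thesis by (simp add: card_image)
qed

text \<open>The series is e_i[F_n]: the elementary function picks each set of \<open>i\<close>
  distinct Hall elements once and multiplies their monomials. For \<open>i = 1\<close> it is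
  F_n.\<close>

lemma schur_positive_subsets:
  assumes n: "1 \<le> n"
  shows "schur_positive (\<lambda>m. int (card {A. A \<subseteq> hall r n \<and> finite A \<and> card A = i \<and> (\<Sum>h\<in>A. wt h) = m}))"
proof (rule schur_positive_weight_module[OF weight_module_ALT[OF n], of "n * i" _ i])
  fix m :: "nat multiset"
  have "{A. A \<subseteq> hall r n \<and> finite A \<and> card A = i \<and> (\<Sum>h\<in>A. wt h) = m} = hall_subsets n i (mweight m)"
    by (simp add: hall_subsets_def mw_inj)
  then show "int (card {A. A \<subseteq> hall r n \<and> finite A \<and> card A = i \<and> (\<Sum>h\<in>A. wt h) = m}) =
      int (dim (alternating n i (\<lambda>j. int (count m j))))"
    by (simp add: dim_ALT[OF n] flip: mweight_def)
next
  fix m :: "nat multiset" assume "size m \<noteq> n * i"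
  moreover have "size (\<Sum>h\<in>A. wt h) = n * card A" if "finite A" "A \<subseteq> hall r n" for A
    using that by (induct A rule: finite_induct) (simp_all add: size_wt_hall[OF n])
  ultimately have E: "{A. A \<subseteq> hall r n \<and> finite A \<and> card A = i \<and> (\<Sum>h\<in>A. wt h) = m} = {}" by auto
  show "int (card {A. A \<subseteq> hall r n \<and> finite A \<and> card A = i \<and> (\<Sum>h\<in>A. wt h) = m}) = 0"
    unfolding E by simp
qed

text \<open>Countability allows the Hall elements to be enumerated by natural numbers, as the choice
  inside \<open>plethysm\<close> presupposes.\<close>

lemma countable_hall: "1 \<le> n \<Longrightarrow> countable (hall r n)"
proof -
  assume n: "1 \<le> n"
  have "hall r n \<subseteq> (\<Union>w. {x \<in> H. wt x = mset w})"
    using hall_H[OF n] by (auto intro: ex_mset[THEN exE] simp: eq_commute)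
  moreover have "countable (\<Union>w. {x \<in> H. wt x = mset w})"
    using finite_wt by (intro countable_UN) (auto intro: countable_finite)
  ultimately show ?thesis by (rule countable_subset)
qed

end

section \<open>Plethysm\<close>

lemma monomial_enumeration_exists:
  assumes "countable B" "\<And>m. finite {x \<in> B. w x = m}"
  shows "\<exists>J \<alpha>. monomial_enumeration (monomial_sum B w) J \<alpha>"
proof -
  define J where "J = to_nat_on B ` B"
  define \<alpha> where "\<alpha> = w \<circ> inv_into B (to_nat_on B)"
  have inj: "inj_on (to_nat_on B) B" by (rule inj_on_to_nat_on[OF assms(1)])
  have eq: "{j \<in> J. \<alpha> j = m} = to_nat_on B ` {x \<in> B. w x = m}" for m
    using inj by (auto simp: J_def \<alpha>_def)
  have "card {j \<in> J. \<alpha> j = m} = card {x \<in> B. w x = m}" for m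
    unfolding eq by (rule card_image) (rule inj_on_subset[OF inj], blast)
  then have "monomial_enumeration (monomial_sum B w) J \<alpha>"
    using assms(2) by (simp add: monomial_enumeration_def monomial_sum_def eq)
  then show ?thesis by blast
qed

text \<open>The monomials of the elementary function are the multisets without repetition, that is,
  finite sets of indices. The hypotheses on \<open>\<alpha>\<close> make the sum that defines the
  substitution finite.\<close>

lemma monomial_subst_elementary:
  assumes fib: "\<And>m. finite {j \<in> J. \<alpha> j = m}" and ne: "\<And>j. j \<in> J \<Longrightarrow> \<alpha> j \<noteq> {#}"
  shows "monomial_subst (elementary i) J \<alpha> m =
    int (card {A. A \<subseteq> J \<and> finite A \<and> card A = i \<and> (\<Sum>j\<in>A. \<alpha> j) = m})"
proof -
  have G: "{\<gamma>. set_mset \<gamma> \<subseteq> J \<and> sum_mset (image_mset \<alpha> \<gamma>) = m} = weight_msets \<alpha> J m" by (simp add: weight_msets_def)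
  let ?U = "{j \<in> J. \<alpha> j \<subseteq># m}"
  have "?U = (\<Union>m'\<in>{m'. m' \<subseteq># m}. {j \<in> J. \<alpha> j = m'})" by auto
  then have finU: "finite ?U" using finite_submultisets[of m] fib by auto
  have "\<alpha> j \<subseteq># m" if "X \<in> weight_msets \<alpha> J m" "j \<in># X" for X j
  proof -
    obtain Y where "X = add_mset j Y" using \<open>j \<in># X\<close> by (metis insert_DiffM)
    then show ?thesis using \<open>X \<in> weight_msets \<alpha> J m\<close> by (auto simp: weight_msets_def)
  qed
  then have eq: "weight_msets \<alpha> J m = weight_msets \<alpha> ?U m" by (auto simp: weight_msets_def)
  have fin: "finite (weight_msets \<alpha> J m)" unfolding eq unfolding MS_eq_WL
    by (rule finite_imageI, rule finite_WL[OF finU]) (use ne in blast)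
  let ?E = "{A :: nat set. finite A \<and> card A = i}"
  have inj: "inj_on mset_set ?E" by (rule inj_onI) (metis (mono_tags) finite_set_mset_mset_set mem_Collect_eq)
  \<comment> \<open>\<open>mset_set\<close> is injective on finite sets, so all coefficients are 0
    or 1.\<close>
  have el: "elementary i \<gamma> = of_bool (\<gamma> \<in> mset_set ` ?E)" for \<gamma>
  proof (cases "\<gamma> \<in> mset_set ` ?E")
    case True
    then obtain A where A: "A \<in> ?E" "\<gamma> = mset_set A" by blast
    then have "{B \<in> ?E. mset_set B = \<gamma>} = {A}" using inj by (auto dest: inj_onD)
    then show ?thesis using True by (simp add: elementary_def monomial_sum_def)
  next
    case False
    then have "{B \<in> ?E. mset_set B = \<gamma>} = {}" by blast
    then have "card {B \<in> ?E. mset_set B = \<gamma>} = 0" by (simp only: card.empty)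
    then show ?thesis using False by (simp add: elementary_def monomial_sum_def)
  qed
  have "monomial_subst (elementary i) J \<alpha> m = (\<Sum>\<gamma>\<in>weight_msets \<alpha> J m. of_bool (\<gamma> \<in> mset_set ` ?E))"
    unfolding monomial_subst_def G by (rule sum.cong[OF refl el])
  also have "\<dots> = int (card (weight_msets \<alpha> J m \<inter> mset_set ` ?E))"
    using fin by (simp add: sum_of_bool_eq)
  also have "weight_msets \<alpha> J m \<inter> mset_set ` ?E = mset_set ` {A. A \<subseteq> J \<and> finite A \<and> card A = i \<and> (\<Sum>j\<in>A. \<alpha> j) = m}"
  proof (intro equalityI subsetI)
    fix \<gamma> assume "\<gamma> \<in> weight_msets \<alpha> J m \<inter> mset_set ` ?E"
    then obtain A where "finite A" "card A = i" "\<gamma> = mset_set A" "\<gamma> \<in> weight_msets \<alpha> J m" by blast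
    then show "\<gamma> \<in> mset_set ` {A. A \<subseteq> J \<and> finite A \<and> card A = i \<and> (\<Sum>j\<in>A. \<alpha> j) = m}"
      by (intro image_eqI[of _ _ A]) (auto simp: weight_msets_def sum_unfold_sum_mset)
  qed (auto simp: weight_msets_def sum_unfold_sum_mset)
  also have "card \<dots> = card {A. A \<subseteq> J \<and> finite A \<and> card A = i \<and> (\<Sum>j\<in>A. \<alpha> j) = m}"
    by (rule card_image) (rule inj_on_subset[OF inj], blast)
  finally show ?thesis .
qed

text \<open>Families in which each monomial has the same finite multiplicity are matched fibre by
  fibre. This relates the enumeration chosen in \<open>plethysm\<close>, of which only the
  multiplicities are known, to the Hall elements.\<close>

lemma fibre_bijection:
  assumes fJ: "\<And>m. finite {j \<in> J. \<alpha> j = m}" and fB: "\<And>m. finite {x \<in> B. w x = m}"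
    and card: "\<And>m. card {j \<in> J. \<alpha> j = m} = card {x \<in> B. w x = m}"
  obtains \<phi> where "bij_betw \<phi> J B" "\<And>j. j \<in> J \<Longrightarrow> w (\<phi> j) = \<alpha> j"
proof -
  have "\<exists>f. bij_betw f {j \<in> J. \<alpha> j = m} {x \<in> B. w x = m}" for m
    by (rule finite_same_card_bij[OF fJ fB card])
  then obtain f where f: "\<And>m. bij_betw (f m) {j \<in> J. \<alpha> j = m} {x \<in> B. w x = m}" by metis
  define \<phi> where "\<phi> j = f (\<alpha> j) j" for j
  have mem: "\<phi> j \<in> B \<and> w (\<phi> j) = \<alpha> j" if "j \<in> J" for j
    using bij_betwE[OF f[of "\<alpha> j"]] that by (auto simp: \<phi>_def)
  have "inj_on \<phi> J"
  proof (rule inj_onI)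
    fix j j' assume j: "j \<in> J" "j' \<in> J" "\<phi> j = \<phi> j'"
    then have "\<alpha> j = \<alpha> j'" using mem by metis
    then show "j = j'" using inj_onD[OF bij_betw_imp_inj_on[OF f[of "\<alpha> j"]], of j j'] j by (simp add: \<phi>_def)
  qed
  moreover have "\<phi> ` J = B"
  proof (intro equalityI subsetI)
    fix x assume "x \<in> B"
    then have "x \<in> f (w x) ` {j \<in> J. \<alpha> j = w x}" using bij_betw_imp_surj_on[OF f[of "w x"]] by auto
    then obtain j where j: "x = f (w x) j" "j \<in> J" "\<alpha> j = w x" by blast
    then have "x = \<phi> j" by (simp add: \<phi>_def)
    then show "x \<in> \<phi> ` J" using j(2) by blast
  qed (use mem in auto)
  ultimately show ?thesis using that[of \<phi>] mem by (auto simp: bij_betw_def)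
qed

lemma plethysm_elementary:
  assumes B: "countable B" "\<And>m. finite {x \<in> B. w x = m}" and ne: "\<And>x. x \<in> B \<Longrightarrow> w x \<noteq> {#}"
  shows "plethysm (elementary i) (monomial_sum B w) m =
    int (card {A. A \<subseteq> B \<and> finite A \<and> card A = i \<and> (\<Sum>x\<in>A. w x) = m})"
proof -
  obtain J \<alpha> where s: "(SOME (J, \<alpha>). monomial_enumeration (monomial_sum B w) J \<alpha>) = (J, \<alpha>)" by (cases "SOME (J, \<alpha>). monomial_enumeration (monomial_sum B w) J \<alpha>")
  have "\<exists>p. (\<lambda>(J, \<alpha>). monomial_enumeration (monomial_sum B w) J \<alpha>) p"
    using monomial_enumeration_exists[OF B] by auto
  from someI_ex[OF this] have en: "monomial_enumeration (monomial_sum B w) J \<alpha>" by (simp add: s)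
  then have fJ: "finite {j \<in> J. \<alpha> j = m}" and eq: "monomial_sum B w m = monomial_sum J \<alpha> m" for m
    by (simp_all add: monomial_enumeration_def)
  have card: "card {j \<in> J. \<alpha> j = m} = card {x \<in> B. w x = m}" for m
    using eq[of m] by (simp add: monomial_sum_def)
  obtain \<phi> where \<phi>: "bij_betw \<phi> J B" "\<And>j. j \<in> J \<Longrightarrow> w (\<phi> j) = \<alpha> j"
    using fibre_bijection[OF fJ B(2) card] by metis
  have neJ: "\<alpha> j \<noteq> {#}" if "j \<in> J" for j
    using ne[of "\<phi> j"] \<phi> that bij_betwE[OF \<phi>(1)] by auto
  have inj: "inj_on \<phi> J" and surj: "\<phi> ` J = B" using \<phi>(1) by (auto simp: bij_betw_def)
  have sum: "(\<Sum>x\<in>\<phi> ` A. w x) = (\<Sum>j\<in>A. \<alpha> j)" if "A \<subseteq> J" for A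
    using that \<phi>(2) by (subst sum.reindex[OF inj_on_subset[OF inj that]]) (auto intro: sum.cong)
  have "{A. A \<subseteq> B \<and> finite A \<and> card A = i \<and> (\<Sum>x\<in>A. w x) = m} =
      image \<phi> ` {A. A \<subseteq> J \<and> finite A \<and> card A = i \<and> (\<Sum>j\<in>A. \<alpha> j) = m}"
  proof (intro equalityI subsetI)
    fix A assume A: "A \<in> {A. A \<subseteq> B \<and> finite A \<and> card A = i \<and> (\<Sum>x\<in>A. w x) = m}"
    then obtain A' where A': "A' \<subseteq> J" "A = \<phi> ` A'" using surj by (auto simp: subset_image_iff)
    have inj': "inj_on \<phi> A'" by (rule inj_on_subset[OF inj A'(1)])
    have "finite A'" using A A'(2) finite_imageD[OF _ inj'] by simp
    moreover have "card A' = i" using A A'(2) card_image[OF inj'] by simp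
    moreover have "(\<Sum>j\<in>A'. \<alpha> j) = m" using A sum[OF A'(1)] A'(2) by simp
    ultimately show "A \<in> image \<phi> ` {A. A \<subseteq> J \<and> finite A \<and> card A = i \<and> (\<Sum>j\<in>A. \<alpha> j) = m}" using A' by blast
  next
    fix A assume "A \<in> image \<phi> ` {A. A \<subseteq> J \<and> finite A \<and> card A = i \<and> (\<Sum>j\<in>A. \<alpha> j) = m}"
    then obtain A' where A': "A' \<subseteq> J" "finite A'" "card A' = i" "(\<Sum>j\<in>A'. \<alpha> j) = m" "A = \<phi> ` A'" by blast
    then show "A \<in> {A. A \<subseteq> B \<and> finite A \<and> card A = i \<and> (\<Sum>x\<in>A. w x) = m}"
      using sum[OF A'(1)] card_image[OF inj_on_subset[OF inj A'(1)]] surj by auto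
  qed
  moreover have "inj_on (image \<phi>) {A. A \<subseteq> J \<and> finite A \<and> card A = i \<and> (\<Sum>j\<in>A. \<alpha> j) = m}"
    by (rule inj_onI) (use inj_on_image_eq_iff[OF inj] in auto)
  ultimately have "card {A. A \<subseteq> B \<and> finite A \<and> card A = i \<and> (\<Sum>x\<in>A. w x) = m} =
      card {A. A \<subseteq> J \<and> finite A \<and> card A = i \<and> (\<Sum>j\<in>A. \<alpha> j) = m}"
    by (simp add: card_image)
  then show ?thesis
    using monomial_subst_elementary[OF fJ neJ, of i m] by (simp add: plethysm_def s)
qed

theorem corollary3p20:
  fixes r :: "nat free_lie rel" and n i :: nat
  assumes "hall_order r" and "1 \<le> n" and "1 \<le> i"
  shows "schur_positive (hall_series r n) \<and>
    schur_positive (plethysm (elementary i) (hall_series r n))"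
proof -
  interpret hall_set r by unfold_locales (fact assms(1))
  have eta: "hall_eta r h = wt h" if "h \<in> hall r n" for h
    using hall_eta_wt that hall_H[OF assms(2)] by blast
  have fin: "finite {x \<in> hall r n. wt x = m}" for m
    using finite_wt[of m] by (rule rev_finite_subset) (use hall_H[OF assms(2)] in auto)
  have series: "hall_series r n = monomial_sum (hall r n) wt"
    unfolding hall_series_def monomial_sum_def using eta by (auto simp: fun_eq_iff intro!: arg_cong[where f=card])
  have "hall_series r n m = int (card {A. A \<subseteq> hall r n \<and> finite A \<and> card A = 1 \<and> (\<Sum>h\<in>A. wt h) = m})" for m
  proof -
    have "{A. A \<subseteq> hall r n \<and> finite A \<and> card A = 1 \<and> (\<Sum>h\<in>A. wt h) = m} = (\<lambda>h. {h}) ` {h \<in> hall r n. wt h = m}"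
      by (auto simp: card_1_singleton_iff)
    then show ?thesis by (simp add: series monomial_sum_def card_image)
  qed
  then have "schur_positive (hall_series r n)"
    using schur_positive_subsets[OF assms(2), of 1] by presburger
  moreover have "plethysm (elementary i) (hall_series r n) =
      (\<lambda>m. int (card {A. A \<subseteq> hall r n \<and> finite A \<and> card A = i \<and> (\<Sum>h\<in>A. wt h) = m}))"
    unfolding series
    by (rule ext, rule plethysm_elementary[OF countable_hall[OF assms(2)] fin])
      (use wt_nonempty hall_H[OF assms(2)] in blast)
  ultimately show ?thesis using schur_positive_subsets[OF assms(2), of i] by simp
qed

end
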